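(* Let $\theta=(\{\theta_s\}_{s\in S},\{X_s\}_{s\in S})$ be a topologically free action of an inverse semigroup $S$ on a locally compact, Hausdorff, zero-dimensional space $X$, and let $\mathcal O$ be an $S\ltimes X$-sheaf of fields. If $S\ltimes X$ is Hausdorff, then $\Gamma_c(S\ltimes X,\mathcal O)$ is semiprimitive.
   Context: "Compact" includes Hausdorff. Zero-dimensional: having a basis of compact open sets. An action $\theta$ of an inverse semigroup $S$ on $X$ is a semigroup homomorphism $s\mapsto\theta_s$ to the inverse semigroup of homeomorphisms between open subsets of $X$, where $\theta_s:X_{s^*}\to X_s$, and such that $\bigcup_{s\in S}X_s=X$. $\theta$ is topologically free if for every $s\in S$ the interior of $\{x\in X_{s^*}\mid\theta_s(x)=x\}$ equals $\{x\in X_{s^*}\mid \text{there is an idempotent } e\in E(S) \text{ with } e\le s \text{ and } x\in X_e\}$. Groupoid of germs $S\ltimes X$: unit space $X$; arrows are classes $[s,x]$ of pairs $(s,x)\in S\times X$ with $x\in X_{s^*}$, where $(s,x)\sim(t,y)$ iff $x=y$ and there is $u\le s,t$ with $x\in X_{u^*}$; $\boldsymbol d([s,x])=x$, $\boldsymbol r([s,x])=\theta_s(x)$, $[s,\theta_t(x)][t,x]=[st,x]$, $[s,x]^{-1}=[s^*,\theta_s(x)]$; basic open sets $(s,U)=\{[s,x]:x\in U\}$ for $U\subseteq X_{s^*}$ open. It is an ample groupoid: a topological groupoid with locally compact Hausdorff unit space having a basis of compact open sets and with $\boldsymbol r$ a local homeomorphism. For an ample groupoid $\mathscr G$: a bisection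 is a subset on which $\boldsymbol d$ and $\boldsymbol r$ are injective. A $\mathscr G$-sheaf $(E,p,\alpha)$ is a space $E$, a local homeomorphism $p:E\to\mathscr G^{(0)}$ and a continuous map $\alpha:\mathscr G\times_{\boldsymbol d,p}E\to E$, $(\gamma,e)\mapsto\alpha_\gamma(e)$, with $\alpha_{p(e)}(e)=e$, $p(\alpha_\gamma(e))=\boldsymbol r(\gamma)$, and $\alpha_\beta(\alpha_\gamma(e))=\alpha_{\beta\gamma}(e)$ whenever defined. A $\mathscr G$-sheaf of rings $\mathcal O=(E,p,\alpha)$ is a $\mathscr G$-sheaf with a unital ring structure on each stalk $\mathcal O_x=p^{-1}(x)$ such that fiberwise addition and multiplication $E\times_{p,p}E\to E$ and the unit section $x\mapsto1_x$ are continuous, and each $\alpha_\gamma:\mathcal O_{\boldsymbol d(\gamma)}\to\mathcal O_{\boldsymbol r(\gamma)}$ is a (unital) ring homomorphism; it is a sheaf of fields if all stalks are fields. $\Gamma_c(\mathscr G,\mathcal O)$ is the additive group generated by all maps $f:\mathscr G\to E$ with $p\circ f=\boldsymbol r$ for which there is a compact open bisection $U$ with $f|_U$ continuous and $f=0$ off $U$; it is a ring under pointwise addition and convolution $(f*g)(\gamma)=\sum_{\beta\rho=\gamma}f(\beta)\alpha_\beta(g(\rho))$. A ring is semiprimitive if its Jacobson radical is zero; equivalently, if it has a faithful semisimple module. *)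

theory Defs
  imports "HOL-Analysis.Analysis" "HOL-Algebra.Product_Groups" "HOL-Algebra.Module"
begin

section \<open>Jacobson radical and semiprimitivity of rings without identity\<close>

text \<open>
  Rings are HOL-Algebra records.  They need not be unital and the field \<open>one\<close> is never consulted;
  likewise the fields \<open>mult\<close> and \<open>one\<close> of a module record are irrelevant.
\<close>

locale left_module = M?: abelian_group M
  for R :: "('r, 'c) ring_scheme" (structure) and M :: "('r, 'm, 'd) module_scheme" (structure) +
  assumes act_closed: "\<lbrakk>r \<in> carrier R; m \<in> carrier M\<rbrakk> \<Longrightarrow> r \<odot>\<^bsub>M\<^esub> m \<in> carrier M"
    and act_l_distr: "\<lbrakk>r \<in> carrier R; s \<in> carrier R; m \<in> carrier M\<rbrakk>
      \<Longrightarrow> (r \<oplus>\<^bsub>R\<^esub> s) \<odot>\<^bsub>M\<^esub> m = r \<odot>\<^bsub>M\<^esub> m \<oplus>\<^bsub>M\<^esub> s \<odot>\<^bsub>M\<^esub> m"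
    and act_r_distr: "\<lbrakk>r \<in> carrier R; m \<in> carrier M; n \<in> carrier M\<rbrakk>
      \<Longrightarrow> r \<odot>\<^bsub>M\<^esub> (m \<oplus>\<^bsub>M\<^esub> n) = r \<odot>\<^bsub>M\<^esub> m \<oplus>\<^bsub>M\<^esub> r \<odot>\<^bsub>M\<^esub> n"
    and act_assoc: "\<lbrakk>r \<in> carrier R; s \<in> carrier R; m \<in> carrier M\<rbrakk>
      \<Longrightarrow> (r \<otimes>\<^bsub>R\<^esub> s) \<odot>\<^bsub>M\<^esub> m = r \<odot>\<^bsub>M\<^esub> (s \<odot>\<^bsub>M\<^esub> m)"

text \<open>As the ring need not be unital, simplicity includes \<open>R M \<noteq> 0\<close>.\<close>

definition simple_left_module ::
  "('r, 'c) ring_scheme \<Rightarrow> ('r, 'm, 'd) module_scheme \<Rightarrow> bool" where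
  "simple_left_module R M \<longleftrightarrow> left_module R M
     \<and> (\<exists>r\<in>carrier R. \<exists>m\<in>carrier M. r \<odot>\<^bsub>M\<^esub> m \<noteq> \<zero>\<^bsub>M\<^esub>)
     \<and> (\<forall>N. submodule N R M \<longrightarrow> N = {\<zero>\<^bsub>M\<^esub>} \<or> N = carrier M)"

text \<open>
  The elements annihilating all simple left modules.  A HOL formula cannot quantify over types,
  so the carriers of the modules are taken in the type \<open>'r set\<close>.  This loses nothing: a simple
  module is isomorphic to a quotient of \<open>R\<close> by a left ideal, whose elements are cosets; see
  \<open>jacobson_radical_annihilates\<close> below.
\<close>

definition jacobson_radical :: "('r, 'c) ring_scheme \<Rightarrow> 'r set" where
  "jacobson_radical R = {r \<in> carrier R.
     \<forall>M :: ('r, 'r set) module. simple_left_module R M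
       \<longrightarrow> (\<forall>m\<in>carrier M. r \<odot>\<^bsub>M\<^esub> m = \<zero>\<^bsub>M\<^esub>)}"

definition semiprimitive :: "('r, 'c) ring_scheme \<Rightarrow> bool" where
  "semiprimitive R \<longleftrightarrow> jacobson_radical R = {\<zero>\<^bsub>R\<^esub>}"

section \<open>Inverse semigroups and their actions\<close>

class inverse_semigroup = semigroup_mult +
  assumes ex1_inverse: "\<exists>!t. s * t * s = s \<and> t * s * t = t"
begin

definition star :: "'a \<Rightarrow> 'a" where
  "star s = (THE t. s * t * s = s \<and> t * s * t = t)"

definition idem :: "'a \<Rightarrow> bool" where
  "idem e \<longleftrightarrow> e * e = e"

definition nat_le :: "'a \<Rightarrow> 'a \<Rightarrow> bool"  (infix \<open>\<preceq>\<close> 50) where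
  "s \<preceq> t \<longleftrightarrow> (\<exists>e. idem e \<and> s = t * e)"

lemma star_props: "s * star s * s = s" "star s * s * star s = star s"
  using theI'[OF ex1_inverse[of s]] unfolding star_def by auto

lemma star_unique: "s * t * s = s \<Longrightarrow> t * s * t = t \<Longrightarrow> star s = t"
  using ex1_inverse[of s] star_props[of s] by blast

lemma star_idem: "idem e \<Longrightarrow> star e = e"
  by (simp add: idem_def star_unique)

lemma idem_mult:
  assumes "idem e" "idem f" shows "idem (e * f)"
proof -
  have ee: "e * e = e" "f * f = f" using assms by (auto simp: idem_def)
  have ee': "e * (e * z) = e * z" "f * (f * z) = f * z" for z
    using ee by (simp_all flip: mult.assoc)
  define x where "x = star (e * f)"
  have x: "e * f * x * (e * f) = e * f" "x * (e * f) * x = x"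
    unfolding x_def by (rule star_props)+
  have x2: "x * (e * (f * (x * z))) = x * z" for z
    using arg_cong[OF x(2), of "\<lambda>w. w * z"] by (simp add: mult.assoc)
  have "star (e * f) = f * x * e"
  proof (rule star_unique)
    show "e * f * (f * x * e) * (e * f) = e * f" using x(1) by (simp add: mult.assoc ee')
    show "f * x * e * (e * f) * (f * x * e) = f * x * e"
      using x2[of e] by (simp add: mult.assoc ee')
  qed
  hence xx: "x = f * x * e" by (simp add: x_def)
  have "x * x = f * (x * (e * (f * (x * e))))" by (subst (1 2) xx) (simp add: mult.assoc)
  also have "\<dots> = x" using x2[of e] xx by (simp add: mult.assoc)
  finally have ix: "x * x = x" .
  hence "star x = x" by (simp add: star_unique)
  moreover have "star x = e * f" using x by (intro star_unique) auto
  ultimately show ?thesis using ix by (simp add: idem_def)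
qed

lemma idem_commute:
  assumes "idem e" "idem f" shows "e * f = f * e"
proof -
  have ee: "e * e = e" "f * f = f" using assms by (auto simp: idem_def)
  have ee': "e * (e * z) = e * z" "f * (f * z) = f * z" for z
    using ee by (simp_all flip: mult.assoc)
  have i: "e * f * (e * f) = e * f" "f * e * (f * e) = f * e"
    using idem_mult[OF assms] idem_mult[OF assms(2,1)] by (auto simp: idem_def)
  have "star (e * f) = f * e" using i by (intro star_unique) (simp_all add: mult.assoc ee')
  moreover have "star (e * f) = e * f" using i by (intro star_unique) (simp_all add: i)
  ultimately show ?thesis by simp
qed

lemma star_star: "star (star s) = s"
  by (rule star_unique) (simp_all add: star_props)

lemma idem_star_mult: "idem (star s * s)" "idem (s * star s)"
  using star_props[of s] by (auto simp: idem_def mult.assoc)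

lemma idem_mult_swap:
  assumes "idem e" shows "idem (star t * e * t)" "e * t = t * (star t * e * t)"
proof -
  have c: "e * (t * star t) = t * star t * e" by (rule idem_commute[OF assms idem_star_mult(2)])
  have "e * t = e * (t * star t) * t" using star_props(1)[of t] by (simp add: mult.assoc)
  thus sw: "e * t = t * (star t * e * t)" by (simp only: c) (simp add: mult.assoc)
  have "star t * e * t * (star t * e * t) = star t * e * (t * (star t * e * t))"
    by (simp add: mult.assoc)
  also have "\<dots> = star t * (e * e) * t" by (simp only: sw[symmetric]) (simp add: mult.assoc)
  finally show "idem (star t * e * t)" using assms by (simp add: idem_def)
qed

lemma nat_le_mult: "u \<preceq> s \<Longrightarrow> v \<preceq> t \<Longrightarrow> u * v \<preceq> s * t"
proof -
  assume "u \<preceq> s" "v \<preceq> t"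
  then obtain e f where e: "idem e" "u = s * e" and f: "idem f" "v = t * f"
    by (auto simp: nat_le_def)
  have "u * v = s * (e * t) * f" by (simp add: e f mult.assoc)
  also have "\<dots> = s * t * (star t * e * t * f)"
    by (subst idem_mult_swap(2)[OF e(1)]) (simp add: mult.assoc)
  finally show ?thesis
    unfolding nat_le_def using idem_mult[OF idem_mult_swap(1)[OF e(1)] f(1)] by blast
qed

lemma nat_le_refl: "s \<preceq> s"
  unfolding nat_le_def using idem_star_mult(1)[of s] star_props(1)[of s]
  by (intro exI[of _ "star s * s"]) (simp add: mult.assoc)

end

text \<open>
  \<open>D s\<close> is the open set usually written \<open>X\<^sub>s\<close>; the values of \<open>\<theta> s\<close> outside \<open>D (star s)\<close> carry no
  information.  The assumptions \<open>dom_mult\<close> and \<open>map_mult\<close> say that \<open>\<theta> (s * t)\<close> is the composite of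
  the partial maps \<open>\<theta> s\<close> and \<open>\<theta> t\<close>, domains included.
\<close>

locale inverse_semigroup_action =
  fixes X :: "'x topology" and D :: "'s::inverse_semigroup \<Rightarrow> 'x set" and \<theta> :: "'s \<Rightarrow> 'x \<Rightarrow> 'x"
  assumes open_D: "openin X (D s)"
    and homeo: "homeomorphic_map (subtopology X (D (star s))) (subtopology X (D s)) (\<theta> s)"
    and dom_mult: "D (star (s * t)) = {x \<in> D (star t). \<theta> t x \<in> D (star s)}"
    and map_mult: "x \<in> D (star (s * t)) \<Longrightarrow> \<theta> (s * t) x = \<theta> s (\<theta> t x)"
    and cover: "(\<Union>s. D s) = topspace X"

definition topologically_free ::
  "'x topology \<Rightarrow> ('s::inverse_semigroup \<Rightarrow> 'x set) \<Rightarrow> ('s \<Rightarrow> 'x \<Rightarrow> 'x) \<Rightarrow> bool" where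
  "topologically_free X D \<theta> \<longleftrightarrow>
     (\<forall>s. X interior_of {x \<in> D (star s). \<theta> s x = x}
          = {x \<in> D (star s). \<exists>e. idem e \<and> e \<preceq> s \<and> x \<in> D e})"

text \<open>Compactness is understood to include the Hausdorff property.\<close>

definition compact_open :: "'a topology \<Rightarrow> 'a set \<Rightarrow> bool" where
  "compact_open T K \<longleftrightarrow> openin T K \<and> compactin T K \<and> Hausdorff_space (subtopology T K)"

definition zero_dimensional :: "'a topology \<Rightarrow> bool" where
  "zero_dimensional T \<longleftrightarrow> openin T = arbitrary union_of compact_open T"

section \<open>Topological groupoids and the groupoid of germs\<close>

text \<open>
  The unit space is a space of its own, with \<open>gunit\<close> the inclusion of units into the arrows.
  The product \<open>gmult G \<beta> \<gamma>\<close> is meaningful when \<open>dmap G \<beta> = rmap G \<gamma>\<close>.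
\<close>

record ('g, 'x) groupoid =
  arrows :: "'g topology"
  units :: "'x topology"
  dmap :: "'g \<Rightarrow> 'x"
  rmap :: "'g \<Rightarrow> 'x"
  gmult :: "'g \<Rightarrow> 'g \<Rightarrow> 'g"
  ginv :: "'g \<Rightarrow> 'g"
  gunit :: "'x \<Rightarrow> 'g"

definition bisection :: "('g, 'x) groupoid \<Rightarrow> 'g set \<Rightarrow> bool" where
  "bisection G U \<longleftrightarrow> U \<subseteq> topspace (arrows G) \<and> inj_on (dmap G) U \<and> inj_on (rmap G) U"

definition germ_rel :: "('s::inverse_semigroup \<Rightarrow> 'x set) \<Rightarrow> (('s \<times> 'x) \<times> ('s \<times> 'x)) set" where
  "germ_rel D = {((s, x), (t, y)). x \<in> D (star s) \<and> y \<in> D (star t) \<and> x = y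
                   \<and> (\<exists>u. u \<preceq> s \<and> u \<preceq> t \<and> x \<in> D (star u))}"

definition germ :: "('s::inverse_semigroup \<Rightarrow> 'x set) \<Rightarrow> 's \<Rightarrow> 'x \<Rightarrow> ('s \<times> 'x) set" where
  "germ D s x = germ_rel D `` {(s, x)}"

text \<open>
  The structure maps are given on classes: \<open>the_elem\<close> extracts the common value on all
  representatives, and in \<open>gmult\<close>, \<open>ginv\<close> and \<open>gunit\<close> the unions range over equal classes.  The
  formulas on representatives are \<open>dmap_germ\<close>, \<open>rmap_germ\<close>, \<open>gmult_germ\<close>, \<open>ginv_germ\<close> and
  \<open>gunit_germ\<close> below.
\<close>

definition germ_groupoid ::
  "'x topology \<Rightarrow> ('s::inverse_semigroup \<Rightarrow> 'x set) \<Rightarrow> ('s \<Rightarrow> 'x \<Rightarrow> 'x)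
     \<Rightarrow> (('s \<times> 'x) set, 'x) groupoid" where
  "germ_groupoid X D \<theta> = \<lparr>
     arrows = topology_generated_by {germ D s ` U | s U. openin X U \<and> U \<subseteq> D (star s)},
     units = X,
     dmap = (\<lambda>g. the_elem ((\<lambda>(s, x). x) ` g)),
     rmap = (\<lambda>g. the_elem ((\<lambda>(s, x). \<theta> s x) ` g)),
     gmult = (\<lambda>g h. \<Union>{germ D (s * t) x | s t x. (s, \<theta> t x) \<in> g \<and> (t, x) \<in> h}),
     ginv = (\<lambda>g. \<Union>{germ D (star s) (\<theta> s x) | s x. (s, x) \<in> g}),
     gunit = (\<lambda>x. \<Union>{germ D e x | e. idem e \<and> x \<in> D e})\<rparr>"

section \<open>Sheaves of rings and the convolution ring\<close>

definition local_homeomorphism :: "'a topology \<Rightarrow> 'b topology \<Rightarrow> ('a \<Rightarrow> 'b) \<Rightarrow> bool" where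
  "local_homeomorphism S T f \<longleftrightarrow>
     (\<forall>a\<in>topspace S. \<exists>U. openin S U \<and> a \<in> U \<and> openin T (f ` U)
        \<and> homeomorphic_map (subtopology S U) (subtopology T (f ` U)) f)"

locale groupoid_sheaf =
  fixes G :: "('g, 'x) groupoid" and E :: "'e topology"
    and p :: "'e \<Rightarrow> 'x" and \<alpha> :: "'g \<Rightarrow> 'e \<Rightarrow> 'e"
  assumes p_local_homeo: "local_homeomorphism E (units G) p"
    and act_continuous:
      "continuous_map (subtopology (prod_topology (arrows G) E) {(\<gamma>, e). dmap G \<gamma> = p e}) E
         (\<lambda>(\<gamma>, e). \<alpha> \<gamma> e)"
    and act_unit: "e \<in> topspace E \<Longrightarrow> \<alpha> (gunit G (p e)) e = e"
    and p_act: "\<lbrakk>\<gamma> \<in> topspace (arrows G); e \<in> topspace E; dmap G \<gamma> = p e\<rbrakk>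
      \<Longrightarrow> p (\<alpha> \<gamma> e) = rmap G \<gamma>"
    and act_mult: "\<lbrakk>\<beta> \<in> topspace (arrows G); \<gamma> \<in> topspace (arrows G); e \<in> topspace E;
        dmap G \<beta> = rmap G \<gamma>; dmap G \<gamma> = p e\<rbrakk>
      \<Longrightarrow> \<alpha> \<beta> (\<alpha> \<gamma> e) = \<alpha> (gmult G \<beta> \<gamma>) e"

text \<open>\<open>\<O> x\<close> is the stalk at \<open>x\<close> with its ring structure; \<open>ring_hom\<close> includes preservation of \<open>\<one>\<close>.\<close>

locale sheaf_of_rings = groupoid_sheaf G E p \<alpha>
  for G :: "('g, 'x) groupoid" and E :: "'e topology"
    and p :: "'e \<Rightarrow> 'x" and \<alpha> :: "'g \<Rightarrow> 'e \<Rightarrow> 'e" +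
  fixes \<O> :: "'x \<Rightarrow> 'e ring"
  assumes stalk_ring: "x \<in> topspace (units G) \<Longrightarrow> ring (\<O> x)"
    and stalk_carrier: "x \<in> topspace (units G) \<Longrightarrow> carrier (\<O> x) = {e \<in> topspace E. p e = x}"
    and add_continuous:
      "continuous_map (subtopology (prod_topology E E) {(a, b). p a = p b}) E
         (\<lambda>(a, b). a \<oplus>\<^bsub>\<O> (p a)\<^esub> b)"
    and mult_continuous:
      "continuous_map (subtopology (prod_topology E E) {(a, b). p a = p b}) E
         (\<lambda>(a, b). a \<otimes>\<^bsub>\<O> (p a)\<^esub> b)"
    and one_continuous: "continuous_map (units G) E (\<lambda>x. \<one>\<^bsub>\<O> x\<^esub>)"
    and act_hom: "\<gamma> \<in> topspace (arrows G) \<Longrightarrow> \<alpha> \<gamma> \<in> ring_hom (\<O> (dmap G \<gamma>)) (\<O> (rmap G \<gamma>))"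

locale sheaf_of_fields = sheaf_of_rings +
  assumes stalk_field: "x \<in> topspace (units G) \<Longrightarrow> field (\<O> x)"

text \<open>
  All (not necessarily continuous) sections \<open>f\<close> of the stalks along \<open>rmap G\<close>, i.e. maps with
  \<open>p \<circ> f = rmap G\<close>, under pointwise addition.  Such maps are \<open>undefined\<close> off the arrows of \<open>G\<close>, so
  that they are determined by their values on arrows.
\<close>

definition section_group :: "('g, 'x) groupoid \<Rightarrow> ('x \<Rightarrow> 'e ring) \<Rightarrow> ('g \<Rightarrow> 'e) monoid" where
  "section_group G \<O> = product_group (topspace (arrows G)) (\<lambda>\<gamma>. add_monoid (\<O> (rmap G \<gamma>)))"

definition elementary_sections ::
  "('g, 'x) groupoid \<Rightarrow> 'e topology \<Rightarrow> ('x \<Rightarrow> 'e ring) \<Rightarrow> ('g \<Rightarrow> 'e) set" where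
  "elementary_sections G E \<O> = {f \<in> carrier (section_group G \<O>).
     \<exists>U. compact_open (arrows G) U \<and> bisection G U
       \<and> continuous_map (subtopology (arrows G) U) E f
       \<and> (\<forall>\<gamma>\<in>topspace (arrows G) - U. f \<gamma> = \<zero>\<^bsub>\<O> (rmap G \<gamma>)\<^esub>)}"

text \<open>
  The convolution sum is restricted to its nonzero terms, since \<open>finsum\<close> is only meaningful over a
  finite index set.
\<close>

definition convolution ::
  "('g, 'x) groupoid \<Rightarrow> ('g \<Rightarrow> 'e \<Rightarrow> 'e) \<Rightarrow> ('x \<Rightarrow> 'e ring) \<Rightarrow> ('g \<Rightarrow> 'e) \<Rightarrow> ('g \<Rightarrow> 'e) \<Rightarrow> 'g \<Rightarrow> 'e" where
  "convolution G \<alpha> \<O> f g = (\<lambda>\<gamma>\<in>topspace (arrows G).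
     finsum (\<O> (rmap G \<gamma>)) (\<lambda>(\<beta>, \<rho>). f \<beta> \<otimes>\<^bsub>\<O> (rmap G \<gamma>)\<^esub> \<alpha> \<beta> (g \<rho>))
       {(\<beta>, \<rho>). \<beta> \<in> topspace (arrows G) \<and> \<rho> \<in> topspace (arrows G) \<and> dmap G \<beta> = rmap G \<rho>
          \<and> gmult G \<beta> \<rho> = \<gamma> \<and> f \<beta> \<otimes>\<^bsub>\<O> (rmap G \<gamma>)\<^esub> \<alpha> \<beta> (g \<rho>) \<noteq> \<zero>\<^bsub>\<O> (rmap G \<gamma>)\<^esub>})"

text \<open>
  The ring \<open>\<Gamma>\<^sub>c(G, \<O>)\<close>.  The field \<open>one\<close> holds the section that is \<open>1\<close> on units and \<open>0\<close> elsewhere,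
  which in general does not belong to the carrier.
\<close>

definition Gamma_c ::
  "('g, 'x) groupoid \<Rightarrow> 'e topology \<Rightarrow> ('g \<Rightarrow> 'e \<Rightarrow> 'e) \<Rightarrow> ('x \<Rightarrow> 'e ring) \<Rightarrow> ('g \<Rightarrow> 'e) ring" where
  "Gamma_c G E \<alpha> \<O> = \<lparr>
     carrier = generate (section_group G \<O>) (elementary_sections G E \<O>),
     mult = convolution G \<alpha> \<O>,
     one = (\<lambda>\<gamma>\<in>topspace (arrows G). if \<gamma> \<in> gunit G ` topspace (units G)
              then \<one>\<^bsub>\<O> (rmap G \<gamma>)\<^esub> else \<zero>\<^bsub>\<O> (rmap G \<gamma>)\<^esub>),
     zero = (\<lambda>\<gamma>\<in>topspace (arrows G). \<zero>\<^bsub>\<O> (rmap G \<gamma>)\<^esub>),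
     add = (\<lambda>f g. \<lambda>\<gamma>\<in>topspace (arrows G). f \<gamma> \<oplus>\<^bsub>\<O> (rmap G \<gamma>)\<^esub> g \<gamma>)\<rparr>"

section \<open>Consistency of the definitions\<close>

context inverse_semigroup_action
begin

lemma mem_topspace: "x \<in> D s \<Longrightarrow> x \<in> topspace X"
  using open_D openin_subset by blast

lemma theta_mem: "x \<in> D (star s) \<Longrightarrow> \<theta> s x \<in> D s"
proof -
  have "\<theta> s ` topspace (subtopology X (D (star s))) = topspace (subtopology X (D s))"
    using homeo by (rule homeomorphic_imp_surjective_map)
  thus "x \<in> D (star s) \<Longrightarrow> \<theta> s x \<in> D s"
    using mem_topspace by auto
qed

lemma theta_idem:
  assumes e: "idem e" and x: "x \<in> D e" shows "\<theta> e x = x"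
proof -
  have inj: "inj_on (\<theta> e) (D e)"
    using homeomorphic_imp_injective_map[OF homeo[of e]] openin_subset[OF open_D[of e]]
    by (simp add: star_idem[OF e] Int_absorb1)
  have "\<theta> e x = \<theta> e (\<theta> e x)"
    using map_mult[of x e e] e x by (simp add: star_idem idem_def)
  thus ?thesis using inj x theta_mem[of x e] by (auto simp: star_idem[OF e] dest: inj_onD)
qed

lemma nat_le_D:
  assumes "u \<preceq> s" "x \<in> D (star u)" shows "x \<in> D (star s)" "\<theta> u x = \<theta> s x"
proof -
  obtain e where e: "idem e" "u = s * e" using assms(1) by (auto simp: nat_le_def)
  have x: "x \<in> D e" "\<theta> e x \<in> D (star s)" using assms(2) e dom_mult[of s e] by (auto simp: star_idem)
  thus "x \<in> D (star s)" "\<theta> u x = \<theta> s x"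
    using map_mult[of x s e] assms(2) theta_idem[OF e(1)] e(2) by auto
qed

lemma germ_eq:
  assumes "x \<in> D (star s)"
  shows "germ D s x = {(t, y). y = x \<and> (\<exists>u. u \<preceq> s \<and> u \<preceq> t \<and> x \<in> D (star u))}"
  using assms nat_le_D(1) by (auto simp: germ_def germ_rel_def)

lemma germ_self: "x \<in> D (star s) \<Longrightarrow> (s, x) \<in> germ D s x"
  using nat_le_refl by (auto simp: germ_eq)

lemma nat_le_glb:
  assumes "u \<preceq> t" "v \<preceq> t" "x \<in> D (star u)" "x \<in> D (star v)"
  shows "\<exists>w. w \<preceq> u \<and> w \<preceq> v \<and> x \<in> D (star w)"
proof -
  obtain e f where e: "idem e" "u = t * e" and f: "idem f" "v = t * f"
    using assms by (auto simp: nat_le_def)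
  have "x \<in> D e" "x \<in> D f"
    using assms(3,4) e f dom_mult[of t e] dom_mult[of t f] by (auto simp: star_idem)
  hence "x \<in> D (star (u * f))"
    using assms(3) dom_mult[of u f] theta_idem[OF f(1)] by (simp add: star_idem[OF f(1)])
  moreover have "u * f \<preceq> u" using f nat_le_def by blast
  moreover have "u * f = v * e" by (simp add: e f mult.assoc idem_commute)
  hence "u * f \<preceq> v" using e(1) unfolding nat_le_def by blast
  ultimately show ?thesis by blast
qed

lemma nat_le_trans: "u \<preceq> v \<Longrightarrow> v \<preceq> (w :: 's) \<Longrightarrow> u \<preceq> w"
  unfolding nat_le_def using idem_mult mult.assoc by metis

lemma equiv_germ_rel: "equiv {(s, x). x \<in> D (star s)} (germ_rel D)"
proof (rule equivI)
  show "germ_rel D \<subseteq> {(s, x). x \<in> D (star s)} \<times> {(s, x). x \<in> D (star s)}"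
    by (auto simp: germ_rel_def)
  show "refl_on {(s, x). x \<in> D (star s)} (germ_rel D)"
    unfolding refl_on_def germ_rel_def by (auto intro: nat_le_refl)
  show "sym (germ_rel D)" by (auto simp: sym_def germ_rel_def)
  show "trans (germ_rel D)"
  proof (rule transI)
    fix a b c assume "(a, b) \<in> germ_rel D" "(b, c) \<in> germ_rel D"
    then obtain s t r x u v where *: "a = (s, x)" "b = (t, x)" "c = (r, x)"
      "x \<in> D (star s)" "x \<in> D (star r)" "u \<preceq> s" "u \<preceq> t" "x \<in> D (star u)"
      "v \<preceq> t" "v \<preceq> r" "x \<in> D (star v)"
      by (auto simp: germ_rel_def)
    then obtain w where "w \<preceq> u" "w \<preceq> v" "x \<in> D (star w)"
      using nat_le_glb[of u t v x] by blast
    hence "w \<preceq> s" "w \<preceq> r" "x \<in> D (star w)" using * nat_le_trans by blast+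
    thus "(a, c) \<in> germ_rel D" unfolding germ_rel_def using *(1,3-5) by auto
  qed
qed

lemma germ_cong: "(t, y) \<in> germ D s x \<Longrightarrow> y = x \<and> x \<in> D (star t) \<and> germ D t x = germ D s x"
  using equiv_class_eq[OF equiv_germ_rel, of "(s, x)" "(t, x)"]
  by (auto simp: germ_def germ_rel_def)

lemma germ_eqI: "u \<preceq> s \<Longrightarrow> u \<preceq> t \<Longrightarrow> x \<in> D (star u) \<Longrightarrow> germ D s x = germ D t x"
proof -
  assume u: "u \<preceq> s" "u \<preceq> t" "x \<in> D (star u)"
  hence "(s, x) \<in> germ D t x"
    unfolding germ_eq[OF nat_le_D(1)[OF u(2,3)]] by blast
  thus ?thesis using germ_cong by blast
qed

lemma dmap_germ: "x \<in> D (star s) \<Longrightarrow> dmap (germ_groupoid X D \<theta>) (germ D s x) = x"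
proof -
  assume x: "x \<in> D (star s)"
  have "(\<lambda>(s, x). x) ` germ D s x = {x}"
    using germ_self[OF x] unfolding germ_eq[OF x] by (auto simp: image_iff)
  thus ?thesis by (simp add: germ_groupoid_def)
qed

lemma rmap_germ: "x \<in> D (star s) \<Longrightarrow> rmap (germ_groupoid X D \<theta>) (germ D s x) = \<theta> s x"
proof -
  assume x: "x \<in> D (star s)"
  have "(\<lambda>(s, x). \<theta> s x) ` germ D s x = {\<theta> s x}"
    using germ_self[OF x] nat_le_D(2) unfolding germ_eq[OF x] by (auto simp: image_iff) (metis)+
  thus ?thesis by (simp add: germ_groupoid_def)
qed

lemma gmult_germ:
  assumes x: "x \<in> D (star t)" and y: "\<theta> t x \<in> D (star s)"
  shows "gmult (germ_groupoid X D \<theta>) (germ D s (\<theta> t x)) (germ D t x) = germ D (s * t) x"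
proof -
  have "germ D (s' * t') x' = germ D (s * t) x"
    if a: "(s', \<theta> t' x') \<in> germ D s (\<theta> t x)" and b: "(t', x') \<in> germ D t x" for s' t' x'
  proof -
    obtain u where u: "u \<preceq> s" "u \<preceq> s'" "\<theta> t x \<in> D (star u)" using a by (auto simp: germ_eq[OF y])
    obtain v where v: "v \<preceq> t" "v \<preceq> t'" "x \<in> D (star v)" and [simp]: "x' = x"
      using b by (auto simp: germ_eq[OF x])
    have "x \<in> D (star (u * v))" using u v nat_le_D(2)[OF v(1,3)] dom_mult[of u v] by auto
    hence "germ D (s' * t') x = germ D (s * t) x"
      using u v by (intro germ_eqI[of "u * v"] nat_le_mult)
    thus ?thesis by simp
  qed
  hence "{germ D (s' * t') x' | s' t' x'. (s', \<theta> t' x') \<in> germ D s (\<theta> t x) \<and> (t', x') \<in> germ D t x}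
      = {germ D (s * t) x}"
    using germ_self[OF x] germ_self[OF y] by blast
  thus ?thesis by (simp add: germ_groupoid_def)
qed

lemma star_mult: "star (s * t) = star t * star (s :: 's)"
proof (rule star_unique)
  have c: "t * star t * (star s * s) = star s * s * (t * star t)"
    by (intro idem_commute idem_star_mult)
  have "s * t * (star t * star s) * (s * t) = s * (t * star t * (star s * s)) * t"
    by (simp add: mult.assoc)
  also have "\<dots> = (s * star s * s) * (t * star t * t)" by (simp only: c) (simp add: mult.assoc)
  finally show "s * t * (star t * star s) * (s * t) = s * t" by (simp add: star_props)
  have "star t * star s * (s * t) * (star t * star s)
      = star t * (star s * s * (t * star t)) * star s" by (simp add: mult.assoc)
  also have "\<dots> = (star t * t * star t) * (star s * s * star s)"
    by (simp only: c[symmetric]) (simp add: mult.assoc)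
  finally show "star t * star s * (s * t) * (star t * star s) = star t * star s"
    by (simp add: star_props)
qed

lemma nat_le_star: "u \<preceq> s \<Longrightarrow> star u \<preceq> star (s :: 's)"
proof -
  assume "u \<preceq> s"
  then obtain e where e: "idem e" "u = s * e" by (auto simp: nat_le_def)
  have "star u = e * star s" by (simp add: e(2) star_mult star_idem[OF e(1)])
  also note idem_mult_swap(2)[OF e(1)]
  finally show ?thesis
    unfolding nat_le_def using idem_mult_swap(1)[OF e(1)] by blast
qed

lemma ginv_germ:
  assumes x: "x \<in> D (star s)"
  shows "ginv (germ_groupoid X D \<theta>) (germ D s x) = germ D (star s) (\<theta> s x)"
proof -
  have "germ D (star t) (\<theta> t y) = germ D (star s) (\<theta> s x)" if a: "(t, y) \<in> germ D s x" for t y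
  proof -
    obtain u where u: "u \<preceq> s" "u \<preceq> t" "x \<in> D (star u)" and [simp]: "y = x"
      using a unfolding germ_eq[OF x] by blast
    have su: "\<theta> u x = \<theta> s x" and tu: "\<theta> u x = \<theta> t x"
      using nat_le_D(2)[OF u(1,3)] nat_le_D(2)[OF u(2,3)] by auto
    have "\<theta> u x \<in> D (star (star u))" using theta_mem[OF u(3)] by (simp only: star_star)
    from germ_eqI[OF nat_le_star[OF u(2)] nat_le_star[OF u(1)] this]
    have "germ D (star t) (\<theta> t x) = germ D (star s) (\<theta> s x)"
      by (simp only: su[symmetric] tu[symmetric])
    thus ?thesis by simp
  qed
  hence "{germ D (star t) (\<theta> t y) | t y. (t, y) \<in> germ D s x} = {germ D (star s) (\<theta> s x)}"
    using germ_self[OF x] by blast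
  thus ?thesis by (simp add: germ_groupoid_def)
qed

lemma gunit_germ:
  assumes e: "idem e" and x: "x \<in> D e"
  shows "gunit (germ_groupoid X D \<theta>) x = germ D e x"
proof -
  have "germ D f x = germ D e x" if f: "idem f" "x \<in> D f" for f
  proof (rule germ_eqI[of "e * f"])
    show "e * f \<preceq> e" using f unfolding nat_le_def by blast
    show "e * f \<preceq> f" using e f idem_commute unfolding nat_le_def by blast
    show "x \<in> D (star (e * f))"
      using dom_mult[of e f] e f x theta_idem[OF f] by (simp add: star_idem)
  qed
  hence "{germ D f x | f. idem f \<and> x \<in> D f} = {germ D e x}" using e x by blast
  thus ?thesis by (simp add: germ_groupoid_def)
qed

end

text \<open>The restriction on the carrier type in \<^const>\<open>jacobson_radical\<close> is harmless.\<close>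

lemma jacobson_radical_annihilates_cyclic:
  fixes R :: "('r, 'c) ring_scheme" and M :: "('r, 'm, 'd) module_scheme"
  assumes r: "r \<in> jacobson_radical R" and M: "simple_left_module R M"
    and m0: "\<And>y. y \<in> carrier M \<Longrightarrow> \<exists>s\<in>carrier R. s \<odot>\<^bsub>M\<^esub> m0 = y"
    and m: "m \<in> carrier M"
  shows "r \<odot>\<^bsub>M\<^esub> m = \<zero>\<^bsub>M\<^esub>"
proof -
  interpret left_module R M using M by (simp add: simple_left_module_def)
  define h where "h = (\<lambda>y. {s \<in> carrier R. s \<odot>\<^bsub>M\<^esub> m0 = y})"
  define k where "k = inv_into (carrier M) h"
  have inj: "inj_on h (carrier M)"
    using m0 by (fastforce simp: inj_on_def h_def)
  have kh [simp]: "k (h y) = y" if "y \<in> carrier M" for y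
    using that inj by (simp add: k_def)
  define N :: "('r, 'r set) module" where
    "N = \<lparr>carrier = h ` carrier M, mult = undefined, one = undefined, zero = h \<zero>\<^bsub>M\<^esub>,
          add = (\<lambda>a b. h (k a \<oplus>\<^bsub>M\<^esub> k b)), smult = (\<lambda>s a. h (s \<odot>\<^bsub>M\<^esub> k a))\<rparr>"
  have N [simp]: "carrier N = h ` carrier M" "\<zero>\<^bsub>N\<^esub> = h \<zero>\<^bsub>M\<^esub>"
    "a \<oplus>\<^bsub>N\<^esub> b = h (k a \<oplus>\<^bsub>M\<^esub> k b)" "s \<odot>\<^bsub>N\<^esub> a = h (s \<odot>\<^bsub>M\<^esub> k a)" for a b s
    by (simp_all add: N_def)
  have hz: "h y = h z \<longleftrightarrow> y = z" if "y \<in> carrier M" "z \<in> carrier M" for y z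
    using that inj by (auto dest: inj_onD)
  have "abelian_group N"
  proof (rule abelian_groupI)
    fix a assume "a \<in> carrier N"
    then obtain y where y: "y \<in> carrier M" "a = h y" by auto
    thus "\<exists>b\<in>carrier N. b \<oplus>\<^bsub>N\<^esub> a = \<zero>\<^bsub>N\<^esub>"
      by (intro bexI[of _ "h (\<ominus>\<^bsub>M\<^esub> y)"]) (auto simp: l_neg)
  qed (auto simp: hz a_assoc a_comm a_lcomm)
  moreover have "left_module_axioms R N"
    by unfold_locales (auto simp: act_closed act_l_distr act_r_distr act_assoc)
  ultimately have LN: "left_module R N" by (simp add: left_module_def)
  obtain s y where sy: "s \<in> carrier R" "y \<in> carrier M" "s \<odot>\<^bsub>M\<^esub> y \<noteq> \<zero>\<^bsub>M\<^esub>"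
    using M by (auto simp: simple_left_module_def)
  have "\<exists>s\<in>carrier R. \<exists>a\<in>carrier N. s \<odot>\<^bsub>N\<^esub> a \<noteq> \<zero>\<^bsub>N\<^esub>"
    using sy by (intro bexI[of _ s] bexI[of _ "h y"]) (auto simp: hz act_closed)
  moreover have "A = {\<zero>\<^bsub>N\<^esub>} \<or> A = carrier N" if A: "submodule A R N" for A
  proof -
    interpret A: submodule A R N by fact
    have sub: "A \<subseteq> h ` carrier M" using A.subset by simp
    define B where "B = k ` A"
    have AB: "A = h ` B" using sub by (force simp: B_def image_iff)
    have Bsub: "B \<subseteq> carrier M" using sub by (auto simp: B_def)
    have hB: "h y \<in> A \<longleftrightarrow> y \<in> B" if "y \<in> carrier M" for y
      using that AB Bsub hz by auto
    have smB: "s \<odot>\<^bsub>M\<^esub> y \<in> B" if "s \<in> carrier R" "y \<in> B" for s y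
      using A.smult_closed[of s "h y"] that Bsub hB by (auto simp: act_closed subsetD)
    have addB: "y \<oplus>\<^bsub>M\<^esub> z \<in> B" if "y \<in> B" "z \<in> B" for y z
      using A.m_closed[of "h y" "h z"] that Bsub hB by (auto simp: subsetD)
    have zB: "\<zero>\<^bsub>M\<^esub> \<in> B" using A.one_closed hB by simp
    have negB: "\<ominus>\<^bsub>M\<^esub> y \<in> B" if "y \<in> B" for y
    proof -
      have yM: "y \<in> carrier M" using that Bsub by auto
      interpret NG: abelian_group N by fact
      have "\<ominus>\<^bsub>N\<^esub> (h y) = h (\<ominus>\<^bsub>M\<^esub> y)"
        by (rule NG.minus_equality) (use yM in \<open>auto simp: l_neg\<close>)
      moreover have "\<ominus>\<^bsub>N\<^esub> (h y) \<in> A"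
        using A.m_inv_closed[of "h y"] that yM hB by (simp add: a_inv_def)
      ultimately show ?thesis using hB yM by simp
    qed
    have "submodule B R M"
    proof -
      have "subgroup B (add_monoid M)"
        by (rule subgroup.intro) (use Bsub zB addB negB in \<open>auto simp flip: a_inv_def\<close>)
      thus ?thesis using smB by (simp add: submodule_def submodule_axioms_def)
    qed
    hence "B = {\<zero>\<^bsub>M\<^esub>} \<or> B = carrier M" using M by (auto simp: simple_left_module_def)
    thus ?thesis using AB by auto
  qed
  ultimately have "simple_left_module R N" using LN by (auto simp: simple_left_module_def)
  hence "r \<odot>\<^bsub>N\<^esub> h m = \<zero>\<^bsub>N\<^esub>" and "r \<in> carrier R"
    using r m by (auto simp: jacobson_radical_def)
  thus ?thesis using m by (simp add: hz act_closed)
qed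

lemma jacobson_radical_annihilates:
  fixes R :: "('r, 'c) ring_scheme" and M :: "('r, 'm, 'd) module_scheme"
  assumes R: "abelian_group R" "\<And>a b. \<lbrakk>a \<in> carrier R; b \<in> carrier R\<rbrakk> \<Longrightarrow> a \<otimes>\<^bsub>R\<^esub> b \<in> carrier R"
    and r: "r \<in> jacobson_radical R" and M: "simple_left_module R M" and m: "m \<in> carrier M"
  shows "r \<odot>\<^bsub>M\<^esub> m = \<zero>\<^bsub>M\<^esub>"
proof -
  interpret left_module R M using M by (simp add: simple_left_module_def)
  interpret R: abelian_group R by fact
  obtain s0 m0 where s0: "s0 \<in> carrier R" "m0 \<in> carrier M" "s0 \<odot>\<^bsub>M\<^esub> m0 \<noteq> \<zero>\<^bsub>M\<^esub>"
    using M by (auto simp: simple_left_module_def)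
  define B where "B = (\<lambda>s. s \<odot>\<^bsub>M\<^esub> m0) ` carrier R"
  have z: "\<zero>\<^bsub>R\<^esub> \<odot>\<^bsub>M\<^esub> m0 = \<zero>\<^bsub>M\<^esub>"
  proof -
    have "\<zero>\<^bsub>R\<^esub> \<odot>\<^bsub>M\<^esub> m0 \<oplus>\<^bsub>M\<^esub> \<zero>\<^bsub>R\<^esub> \<odot>\<^bsub>M\<^esub> m0 = \<zero>\<^bsub>R\<^esub> \<odot>\<^bsub>M\<^esub> m0 \<oplus>\<^bsub>M\<^esub> \<zero>\<^bsub>M\<^esub>"
      using act_l_distr[of "\<zero>\<^bsub>R\<^esub>" "\<zero>\<^bsub>R\<^esub>" m0] s0 by (simp add: act_closed)
    thus ?thesis using s0 by (simp add: act_closed)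
  qed
  have neg: "\<ominus>\<^bsub>M\<^esub> (s \<odot>\<^bsub>M\<^esub> m0) = (\<ominus>\<^bsub>R\<^esub> s) \<odot>\<^bsub>M\<^esub> m0" if "s \<in> carrier R" for s
    by (rule minus_equality) (use that s0 z in \<open>auto simp: act_closed R.l_neg simp flip: act_l_distr\<close>)
  have "subgroup B (add_monoid M)"
  proof (rule subgroup.intro)
    show "B \<subseteq> carrier (add_monoid M)" using s0 by (auto simp: B_def act_closed)
    show "\<one>\<^bsub>add_monoid M\<^esub> \<in> B" using z R.zero_closed by (force simp: B_def)
    show "x \<otimes>\<^bsub>add_monoid M\<^esub> y \<in> B" if "x \<in> B" "y \<in> B" for x y
      using that s0 by (auto simp: B_def simp flip: act_l_distr)
    show "inv\<^bsub>add_monoid M\<^esub> x \<in> B" if "x \<in> B" for x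
      using that neg by (auto simp: B_def simp flip: a_inv_def)
  qed
  moreover have "s \<odot>\<^bsub>M\<^esub> x \<in> B" if "s \<in> carrier R" "x \<in> B" for s x
    using that s0 R(2) by (auto simp: B_def simp flip: act_assoc)
  ultimately have "submodule B R M" by (simp add: submodule_def submodule_axioms_def)
  hence "B = {\<zero>\<^bsub>M\<^esub>} \<or> B = carrier M" using M by (auto simp: simple_left_module_def)
  hence "B = carrier M" using s0 by (auto simp: B_def)
  thus ?thesis
    unfolding B_def
    by (intro jacobson_radical_annihilates_cyclic[OF r M _ m, of m0]) (metis imageE)
qed

end

theory Submission
  imports Defs "HOL-Algebra.UnivPoly"
begin

text \<open>
  Every point \<open>x\<close> gives a module: the finitely supported sections \<open>v\<close> of the stalks over the orbit of
  \<open>x\<close>, on which \<open>f\<close> acts by \<open>(f \<cdot> v) z = (\<Sum>\<gamma> with r \<gamma> = z. f \<gamma> \<cdot> \<alpha>\<^sub>\<gamma> (v (d \<gamma>)))\<close>.  It is simple, because the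
  stalks are fields and sections on small compact open bisections move one entry of \<open>v\<close> to any place
  of the orbit with any value while annihilating the others.  So an element \<open>f\<close> of the Jacobson
  radical kills all these modules.  If \<open>f\<close> is not \<open>0\<close>, then, the groupoid being Hausdorff, \<open>f\<close> is
  continuous and hence non-zero on the germs of some \<open>s\<close> over a non-empty open set.  The support of
  \<open>f\<close> lies in finitely many open bisections, and by topological freeness each of them is parallel to
  the germs of \<open>s\<close> without being equal to them only over a nowhere dense set.  At a point \<open>y\<close> avoiding
  these sets, no cancellation occurs and \<open>f\<close> does not kill the unit vector at \<open>y\<close>.
\<close>

section \<open>Sheaves of rings and fields over a groupoid\<close>

text \<open>The obstacle is isotropy. Since each \<alpha>-map preserves 1, the entry at
  \<open>z\<close> of \<open>f\<close> applied to the unit vector at \<open>y\<close> is the sum of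
  \<open>f\<close> over all arrows from \<open>y\<close> to \<open>z\<close>, and such a sum can
  cancel. Topological freeness speaks of interiors only and controls no individual point, so an
  arrow \<gamma> with a nonzero value of \<open>f\<close> may itself be unusable and must be
  exchanged for a nearby one. Hence non-vanishing has to be an open condition. Elementary sections
  are continuous only on a compact open set \<open>U\<close>; in a Hausdorff space \<open>U\<close>
  is also closed, so extension by zero is continuous. This passes to sums, whose summands live on
  different sets.

  Fields enter twice: invertibility, unlike being nonzero, spreads to a neighbourhood, and division
  in a stalk gives a vector any prescribed entry.

  The ring has no identity in general, so simplicity is derived from a stronger statement: every
  nonzero vector \<open>v\<close> satisfies \<Gamma> \<open>v\<close> = whole module. The same
  statement carries the orbit modules, whose elements have another type, to the modules over which
  \<open>jacobson_radical\<close> quantifies.\<close>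

lemma continuous_map_locally:
  assumes "\<And>t. t \<in> topspace T \<Longrightarrow>
      \<exists>N. openin T N \<and> t \<in> N \<and> continuous_map (subtopology T N) Y f"
  shows "continuous_map T Y f"
  by (rule pasting_lemma[of "{N. openin T N \<and> continuous_map (subtopology T N) Y f}" T "\<lambda>N. N" Y "\<lambda>_. f"])
    (use assms in auto)

section \<open>Local lifts along the projection of a sheaf\<close>

context groupoid_sheaf
begin

lemma p_topspace: "e \<in> topspace E \<Longrightarrow> p e \<in> topspace (units G)"
  using p_local_homeo openin_subset unfolding local_homeomorphism_def by fast

lemma continuous_map_p: "continuous_map E (units G) p"
proof (rule continuous_map_locally)
  fix e assume "e \<in> topspace E"
  then obtain U where U: "openin E U" "e \<in> U"
      "homeomorphic_map (subtopology E U) (subtopology (units G) (p ` U)) p"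
    using p_local_homeo unfolding local_homeomorphism_def by blast
  have "continuous_map (subtopology E U) (units G) p"
    using homeomorphic_imp_continuous_map[OF U(3)] continuous_map_in_subtopology by blast
  then show "\<exists>N. openin E N \<and> e \<in> N \<and> continuous_map (subtopology E N) (units G) p"
    using U by blast
qed

text \<open>Near the common value \<open>p\<close> is injective, so lifts with equal projections
  coincide as long as both stay there. It turns an identity in one stalk into an identity in all
  neighbouring stalks.\<close>

lemma lifts_agree_near:
  assumes f: "continuous_map T E f" and g: "continuous_map T E g"
    and pfg: "\<And>t. t \<in> topspace T \<Longrightarrow> p (f t) = p (g t)"
    and t: "t \<in> topspace T" "f t = g t"
  obtains N where "openin T N" "t \<in> N" "\<And>s. s \<in> N \<Longrightarrow> f s = g s"
proof -
  have "f t \<in> topspace E"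
    using f t by (metis continuous_map_def PiE)
  then obtain U where U: "openin E U" "f t \<in> U"
      "homeomorphic_map (subtopology E U) (subtopology (units G) (p ` U)) p"
    using p_local_homeo unfolding local_homeomorphism_def by blast
  have inj: "inj_on p U"
    using homeomorphic_imp_injective_map[OF U(3)] openin_subset[OF U(1)]
    by (simp add: Int_absorb1)
  define N where "N = {s \<in> topspace T. f s \<in> U} \<inter> {s \<in> topspace T. g s \<in> U}"
  have "openin T N"
    unfolding N_def using f g U(1) by (blast intro: openin_continuous_map_preimage)
  moreover have "t \<in> N" using t U(2) by (auto simp: N_def)
  moreover have "f s = g s" if "s \<in> N" for s
    using that inj pfg by (auto simp: N_def dest: inj_onD)
  ultimately show ?thesis using that by blast
qed

text \<open>A local inverse of \<open>p\<close> near \<open>e\<close>, composed with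
  \<open>h\<close>. The base map is arbitrary because lifts are taken both over the units, with
  \<open>h\<close> the identity, and over the arrows, with \<open>h\<close> the range map.\<close>

lemma lift_through_point:
  assumes h: "continuous_map T (units G) h" and t: "t \<in> topspace T"
    and e: "e \<in> topspace E" "p e = h t"
  obtains N g where "openin T N" "t \<in> N" "continuous_map (subtopology T N) E g"
    "\<And>s. s \<in> N \<Longrightarrow> g s \<in> topspace E \<and> p (g s) = h s" "g t = e"
proof -
  obtain U where U: "openin E U" "e \<in> U" "openin (units G) (p ` U)"
      "homeomorphic_map (subtopology E U) (subtopology (units G) (p ` U)) p"
    using e(1) p_local_homeo unfolding local_homeomorphism_def by blast
  have UE: "U \<subseteq> topspace E" using U(1) by (rule openin_subset)
  obtain \<sigma> where \<sigma>: "homeomorphic_maps (subtopology E U) (subtopology (units G) (p ` U)) p \<sigma>"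
    using U(4) unfolding homeomorphic_map_maps by blast
  have cont: "continuous_map (subtopology (units G) (p ` U)) E \<sigma>"
    and inv: "\<And>a. a \<in> U \<Longrightarrow> \<sigma> (p a) = a"
    using \<sigma> UE by (auto simp: homeomorphic_maps_def continuous_map_in_subtopology)
  define N where "N = {s \<in> topspace T. h s \<in> p ` U}"
  have hN: "continuous_map (subtopology T N) (subtopology (units G) (p ` U)) h"
    using h by (auto simp: continuous_map_in_subtopology N_def continuous_map_from_subtopology)
  show ?thesis
  proof (rule that)
    show "openin T N"
      unfolding N_def using h U(3) by (rule openin_continuous_map_preimage)
    show "continuous_map (subtopology T N) E (\<sigma> \<circ> h)"
      using hN cont by (rule continuous_map_compose)
    show "t \<in> N" "(\<sigma> \<circ> h) t = e"
      using t U(2) inv[OF U(2)] by (auto simp: N_def simp flip: e(2))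
    show "(\<sigma> \<circ> h) s \<in> topspace E \<and> p ((\<sigma> \<circ> h) s) = h s" if "s \<in> N" for s
      using that UE inv by (auto simp: N_def)
  qed
qed

end

section \<open>Continuity of the stalk operations along lifts\<close>

context sheaf_of_rings
begin

lemma stalk_memD: "\<lbrakk>x \<in> topspace (units G); e \<in> carrier (\<O> x)\<rbrakk> \<Longrightarrow> e \<in> topspace E \<and> p e = x"
  using stalk_carrier by blast

lemma stalk_memI: "e \<in> topspace E \<Longrightarrow> e \<in> carrier (\<O> (p e))"
  using stalk_carrier p_topspace by blast

lemma continuous_map_add:
  assumes "continuous_map T E f" "continuous_map T E g"
    and "\<And>t. t \<in> topspace T \<Longrightarrow> p (f t) = h t" "\<And>t. t \<in> topspace T \<Longrightarrow> p (g t) = h t"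
  shows "continuous_map T E (\<lambda>t. f t \<oplus>\<^bsub>\<O> (h t)\<^esub> g t)"
proof -
  have "continuous_map T (subtopology (prod_topology E E) {(a, b). p a = p b}) (\<lambda>t. (f t, g t))"
    using assms by (auto simp: continuous_map_in_subtopology continuous_map_paired)
  from continuous_map_compose[OF this add_continuous] show ?thesis
    by (rule continuous_map_eq) (simp add: assms(3))
qed

lemma continuous_map_mult:
  assumes "continuous_map T E f" "continuous_map T E g"
    and "\<And>t. t \<in> topspace T \<Longrightarrow> p (f t) = h t" "\<And>t. t \<in> topspace T \<Longrightarrow> p (g t) = h t"
  shows "continuous_map T E (\<lambda>t. f t \<otimes>\<^bsub>\<O> (h t)\<^esub> g t)"
proof -
  have "continuous_map T (subtopology (prod_topology E E) {(a, b). p a = p b}) (\<lambda>t. (f t, g t))"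
    using assms by (auto simp: continuous_map_in_subtopology continuous_map_paired)
  from continuous_map_compose[OF this mult_continuous] show ?thesis
    by (rule continuous_map_eq) (simp add: assms(3))
qed

text \<open>The axioms provide continuity of addition, multiplication and the unit section only. A
  local section \<sigma> through the zero at \<open>x\<close> satisfies \<sigma> + \<sigma> =
  \<sigma> at \<open>x\<close>; both sides are lifts, so this holds near \<open>x\<close>, and zero
  is the only solution of that equation in a ring.\<close>

lemma continuous_map_zero: "continuous_map (units G) E (\<lambda>x. \<zero>\<^bsub>\<O> x\<^esub>)"
proof (rule continuous_map_locally)
  fix x assume x: "x \<in> topspace (units G)"
  interpret R: ring "\<O> x" using stalk_ring[OF x] .
  have z: "\<zero>\<^bsub>\<O> x\<^esub> \<in> topspace E" "p \<zero>\<^bsub>\<O> x\<^esub> = x"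
    using stalk_memD[OF x] by auto
  obtain W \<sigma> where W: "openin (units G) W" "x \<in> W"
    and \<sigma>: "continuous_map (subtopology (units G) W) E \<sigma>"
      "\<And>y. y \<in> W \<Longrightarrow> \<sigma> y \<in> topspace E \<and> p (\<sigma> y) = y" "\<sigma> x = \<zero>\<^bsub>\<O> x\<^esub>"
    using lift_through_point[OF continuous_map_id x z(1), unfolded id_def, OF z(2)] by blast
  have WX: "W \<subseteq> topspace (units G)" using W(1) by (rule openin_subset)
  have mem: "\<sigma> y \<in> carrier (\<O> y)" if "y \<in> W" for y
    using \<sigma>(2)[OF that] stalk_memI by metis
  have add: "continuous_map (subtopology (units G) W) E (\<lambda>y. \<sigma> y \<oplus>\<^bsub>\<O> y\<^esub> \<sigma> y)"
    using \<sigma> by (intro continuous_map_add) auto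
  have padd: "p (\<sigma> y \<oplus>\<^bsub>\<O> y\<^esub> \<sigma> y) = y" if "y \<in> W" for y
  proof -
    interpret ring "\<O> y" using stalk_ring that WX by blast
    show ?thesis using stalk_memD[of y] mem that WX by blast
  qed
  obtain N where N: "openin (subtopology (units G) W) N" "x \<in> N"
      "\<And>y. y \<in> N \<Longrightarrow> \<sigma> y \<oplus>\<^bsub>\<O> y\<^esub> \<sigma> y = \<sigma> y"
    using lifts_agree_near[OF add \<sigma>(1), of x] x W(2) \<sigma>(2,3) padd by auto
  have NW: "N \<subseteq> W" using openin_subset[OF N(1)] by auto
  have eq: "\<sigma> y = \<zero>\<^bsub>\<O> y\<^esub>" if "y \<in> N" for y
  proof -
    interpret ring "\<O> y" using stalk_ring that WX NW by blast
    show ?thesis using N(3)[OF that] mem that NW by auto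
  qed
  have "continuous_map (subtopology (units G) N) E \<sigma>"
    using \<sigma>(1) NW by (rule continuous_map_from_subtopology_mono)
  hence "continuous_map (subtopology (units G) N) E (\<lambda>x. \<zero>\<^bsub>\<O> x\<^esub>)"
    by (rule continuous_map_eq) (simp add: eq)
  thus "\<exists>N. openin (units G) N \<and> x \<in> N \<and> continuous_map (subtopology (units G) N) E (\<lambda>x. \<zero>\<^bsub>\<O> x\<^esub>)"
    using N W(1) openin_trans_full by blast
qed

text \<open>A local section through \<open>- f t\<close> agrees with \<open>- f\<close> near \<open>t\<close>, because its sum with \<open>f\<close> is a lift
  that vanishes at \<open>t\<close>.\<close>

lemma continuous_map_neg:
  assumes f: "continuous_map T E f" and pf: "\<And>t. t \<in> topspace T \<Longrightarrow> p (f t) = h t"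
  shows "continuous_map T E (\<lambda>t. \<ominus>\<^bsub>\<O> (h t)\<^esub> f t)"
proof (rule continuous_map_locally)
  fix t assume t: "t \<in> topspace T"
  have fE: "f s \<in> topspace E" if "s \<in> topspace T" for s
    using f that by (metis continuous_map_def PiE)
  have hX: "h s \<in> topspace (units G)" if "s \<in> topspace T" for s
    using pf[OF that] p_topspace[OF fE[OF that]] by simp
  have fO: "f s \<in> carrier (\<O> (h s))" if "s \<in> topspace T" for s
    using stalk_memI[OF fE[OF that]] pf[OF that] by simp
  interpret R: ring "\<O> (h t)" using stalk_ring hX t by blast
  have n: "\<ominus>\<^bsub>\<O> (h t)\<^esub> f t \<in> topspace E" "p (\<ominus>\<^bsub>\<O> (h t)\<^esub> f t) = h t"
    using stalk_memD[OF hX[OF t]] fO[OF t] by auto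
  have h: "continuous_map T (units G) h"
    using continuous_map_compose[OF f continuous_map_p] by (rule continuous_map_eq) (simp add: pf)
  obtain N g where N: "openin T N" "t \<in> N"
    and g: "continuous_map (subtopology T N) E g"
      "\<And>s. s \<in> N \<Longrightarrow> g s \<in> topspace E \<and> p (g s) = h s" "g t = \<ominus>\<^bsub>\<O> (h t)\<^esub> f t"
    using lift_through_point[OF h t n] by blast
  have NT: "N \<subseteq> topspace T" using N(1) by (rule openin_subset)
  have fN: "continuous_map (subtopology T N) E f"
    using f by (rule continuous_map_from_subtopology)
  have zN: "continuous_map (subtopology T N) E (\<lambda>s. \<zero>\<^bsub>\<O> (h s)\<^esub>)"
    using continuous_map_compose[OF continuous_map_from_subtopology[OF h] continuous_map_zero]
    by (simp add: o_def)
  have gO: "g s \<in> carrier (\<O> (h s))" if "s \<in> N" for s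
    using g(2)[OF that] stalk_memI[of "g s"] by simp
  have aN: "continuous_map (subtopology T N) E (\<lambda>s. g s \<oplus>\<^bsub>\<O> (h s)\<^esub> f s)"
    using g(2) pf by (intro continuous_map_add[OF g(1) fN]) (use NT in auto)
  have paN: "p (g s \<oplus>\<^bsub>\<O> (h s)\<^esub> f s) = p \<zero>\<^bsub>\<O> (h s)\<^esub>" if "s \<in> N" for s
  proof -
    interpret ring "\<O> (h s)" using stalk_ring that NT hX by blast
    show ?thesis using stalk_memD[OF hX[of s]] gO fO that NT by auto
  qed
  have a0: "g t \<oplus>\<^bsub>\<O> (h t)\<^esub> f t = \<zero>\<^bsub>\<O> (h t)\<^esub>"
    using g(3) fO[OF t] by (simp add: R.l_neg)
  obtain M where M: "openin (subtopology T N) M" "t \<in> M"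
      "\<And>s. s \<in> M \<Longrightarrow> g s \<oplus>\<^bsub>\<O> (h s)\<^esub> f s = \<zero>\<^bsub>\<O> (h s)\<^esub>"
    using lifts_agree_near[OF aN zN, of t] paN a0 t N NT by auto
  have MN: "M \<subseteq> N" using openin_subset[OF M(1)] by auto
  have eq: "g s = \<ominus>\<^bsub>\<O> (h s)\<^esub> f s" if "s \<in> M" for s
  proof -
    have s: "s \<in> N" "s \<in> topspace T" using that MN NT by auto
    interpret ring "\<O> (h s)" using stalk_ring s hX by blast
    show ?thesis using M(3)[OF that] gO[OF s(1)] fO[OF s(2)] minus_equality by metis
  qed
  have "continuous_map (subtopology T M) E (\<lambda>s. g s)"
    using g(1) MN by (rule continuous_map_from_subtopology_mono)
  hence "continuous_map (subtopology T M) E (\<lambda>s. \<ominus>\<^bsub>\<O> (h s)\<^esub> f s)"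
    by (rule continuous_map_eq) (simp add: eq)
  thus "\<exists>N. openin T N \<and> t \<in> N \<and> continuous_map (subtopology T N) E (\<lambda>s. \<ominus>\<^bsub>\<O> (h s)\<^esub> f s)"
    using M N(1) openin_trans_full by blast
qed

end

context sheaf_of_fields
begin

text \<open>\<open>E\<close> need not be Hausdorff, so the non-zero locus of a section of a sheaf of rings need not be
  open.  Over a sheaf of fields a local section through the inverse of \<open>f t\<close> witnesses that
  \<open>f\<close> is invertible near \<open>t\<close>.\<close>

lemma nonzero_near:
  assumes f: "continuous_map T E f" and pf: "\<And>t. t \<in> topspace T \<Longrightarrow> p (f t) = h t"
    and t: "t \<in> topspace T" "f t \<noteq> \<zero>\<^bsub>\<O> (h t)\<^esub>"
  obtains N where "openin T N" "t \<in> N" "\<And>s. s \<in> N \<Longrightarrow> f s \<noteq> \<zero>\<^bsub>\<O> (h s)\<^esub>"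
proof -
  have fE: "f s \<in> topspace E" if "s \<in> topspace T" for s
    using f that by (metis continuous_map_def PiE)
  have hX: "h s \<in> topspace (units G)" if "s \<in> topspace T" for s
    using pf[OF that] p_topspace[OF fE[OF that]] by simp
  have fO: "f s \<in> carrier (\<O> (h s))" if "s \<in> topspace T" for s
    using stalk_memI[OF fE[OF that]] pf[OF that] by simp
  interpret R: field "\<O> (h t)" using stalk_field hX t by blast
  have fU: "f t \<in> Units (\<O> (h t))" using t fO by (auto simp: R.field_Units)
  define c where "c = inv\<^bsub>\<O> (h t)\<^esub> f t"
  have cO: "c \<in> carrier (\<O> (h t))" "c \<otimes>\<^bsub>\<O> (h t)\<^esub> f t = \<one>\<^bsub>\<O> (h t)\<^esub>"
    using fU by (auto simp: c_def)
  have n: "c \<in> topspace E" "p c = h t"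
    using stalk_memD[OF hX[OF t(1)]] cO(1) by auto
  have h: "continuous_map T (units G) h"
    using continuous_map_compose[OF f continuous_map_p] by (rule continuous_map_eq) (simp add: pf)
  obtain N g where N: "openin T N" "t \<in> N"
    and g: "continuous_map (subtopology T N) E g"
      "\<And>s. s \<in> N \<Longrightarrow> g s \<in> topspace E \<and> p (g s) = h s" "g t = c"
    using lift_through_point[OF h t(1) n] by blast
  have NT: "N \<subseteq> topspace T" using N(1) by (rule openin_subset)
  have fN: "continuous_map (subtopology T N) E f"
    using f by (rule continuous_map_from_subtopology)
  have oN: "continuous_map (subtopology T N) E (\<lambda>s. \<one>\<^bsub>\<O> (h s)\<^esub>)"
    using continuous_map_compose[OF continuous_map_from_subtopology[OF h] one_continuous]
    by (simp add: o_def)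
  have gO: "g s \<in> carrier (\<O> (h s))" if "s \<in> N" for s
    using g(2)[OF that] stalk_memI[of "g s"] by simp
  have aN: "continuous_map (subtopology T N) E (\<lambda>s. g s \<otimes>\<^bsub>\<O> (h s)\<^esub> f s)"
    using g(2) pf by (intro continuous_map_mult[OF g(1) fN]) (use NT in auto)
  have paN: "p (g s \<otimes>\<^bsub>\<O> (h s)\<^esub> f s) = p \<one>\<^bsub>\<O> (h s)\<^esub>" if "s \<in> N" for s
  proof -
    interpret ring "\<O> (h s)" using stalk_ring that NT hX by blast
    show ?thesis using stalk_memD[OF hX[of s]] gO fO that NT by auto
  qed
  obtain M where M: "openin (subtopology T N) M" "t \<in> M"
      "\<And>s. s \<in> M \<Longrightarrow> g s \<otimes>\<^bsub>\<O> (h s)\<^esub> f s = \<one>\<^bsub>\<O> (h s)\<^esub>"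
    using lifts_agree_near[OF aN oN, of t] paN g(3) cO t N NT by auto
  have MN: "M \<subseteq> N" using openin_subset[OF M(1)] by auto
  show ?thesis
  proof (rule that)
    show "openin T M" using M N(1) openin_trans_full by blast
    show "t \<in> M" by fact
    fix s assume "s \<in> M"
    hence s: "s \<in> N" "s \<in> topspace T" "s \<in> M" using MN NT by auto
    interpret field "\<O> (h s)" using stalk_field s hX by blast
    show "f s \<noteq> \<zero>\<^bsub>\<O> (h s)\<^esub>"
      using M(3)[OF s(3)] gO[OF s(1)] by auto
  qed
qed

end

section \<open>Sections over an ample groupoid\<close>

text \<open>Each member of the cover contributes at most one point to a fibre of \<open>h\<close>.
  Applied with a cover by bisections and \<open>h\<close> the source or range map.\<close>

lemma finite_fibre_of_injective_cover:
  assumes "finite \<U>" "\<And>U. U \<in> \<U> \<Longrightarrow> inj_on h U" "A \<subseteq> \<Union>\<U>" "h ` A \<subseteq> {c}"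
  shows "finite A"
proof -
  have "finite (U \<inter> A)" if "U \<in> \<U>" for U
  proof (rule finite_imageD)
    show "finite (h ` (U \<inter> A))" using assms(4) by (metis finite.simps finite_subset image_mono inf_le2)
    show "inj_on h (U \<inter> A)" using assms(2)[OF that] by (rule inj_on_subset) auto
  qed
  hence "finite (\<Union>U\<in>\<U>. U \<inter> A)" using assms(1) by blast
  moreover have "A = (\<Union>U\<in>\<U>. U \<inter> A)" using assms(3) by blast
  ultimately show ?thesis by simp
qed

text \<open>Only the sources and ranges of products and inverses matter below, so the associative, unit and
  inverse laws are left out.\<close>

locale hausdorff_ample_groupoid =
  fixes G :: "('g, 'x) groupoid"
  assumes Hausdorff_units: "Hausdorff_space (units G)"
    and Hausdorff_arrows: "Hausdorff_space (arrows G)"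
    and continuous_map_dmap: "continuous_map (arrows G) (units G) (dmap G)"
    and continuous_map_rmap: "continuous_map (arrows G) (units G) (rmap G)"
    and compact_open_bisection_basis: "\<lbrakk>openin (arrows G) N; \<gamma> \<in> N\<rbrakk>
      \<Longrightarrow> \<exists>U. compact_open (arrows G) U \<and> bisection G U \<and> \<gamma> \<in> U \<and> U \<subseteq> N"
    and gmult_closed: "\<lbrakk>\<beta> \<in> topspace (arrows G); \<gamma> \<in> topspace (arrows G); dmap G \<beta> = rmap G \<gamma>\<rbrakk>
      \<Longrightarrow> gmult G \<beta> \<gamma> \<in> topspace (arrows G)"
    and dmap_gmult: "\<lbrakk>\<beta> \<in> topspace (arrows G); \<gamma> \<in> topspace (arrows G); dmap G \<beta> = rmap G \<gamma>\<rbrakk>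
      \<Longrightarrow> dmap G (gmult G \<beta> \<gamma>) = dmap G \<gamma>"
    and rmap_gmult: "\<lbrakk>\<beta> \<in> topspace (arrows G); \<gamma> \<in> topspace (arrows G); dmap G \<beta> = rmap G \<gamma>\<rbrakk>
      \<Longrightarrow> rmap G (gmult G \<beta> \<gamma>) = rmap G \<beta>"
    and ginv_closed: "\<gamma> \<in> topspace (arrows G) \<Longrightarrow> ginv G \<gamma> \<in> topspace (arrows G)"
    and dmap_ginv: "\<gamma> \<in> topspace (arrows G) \<Longrightarrow> dmap G (ginv G \<gamma>) = rmap G \<gamma>"
    and rmap_ginv: "\<gamma> \<in> topspace (arrows G) \<Longrightarrow> rmap G (ginv G \<gamma>) = dmap G \<gamma>"
begin

lemma dmap_closed: "\<gamma> \<in> topspace (arrows G) \<Longrightarrow> dmap G \<gamma> \<in> topspace (units G)"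
  using continuous_map_dmap by (metis continuous_map_def PiE)

lemma rmap_closed: "\<gamma> \<in> topspace (arrows G) \<Longrightarrow> rmap G \<gamma> \<in> topspace (units G)"
  using continuous_map_rmap by (metis continuous_map_def PiE)

end

locale ample_sheaf_of_rings = hausdorff_ample_groupoid G + sheaf_of_rings G E p \<alpha> \<O>
  for G :: "('g, 'x) groupoid" and E :: "'e topology" and p :: "'e \<Rightarrow> 'x"
    and \<alpha> :: "'g \<Rightarrow> 'e \<Rightarrow> 'e" and \<O> :: "'x \<Rightarrow> 'e ring"
begin

abbreviation "\<Gamma> \<equiv> Gamma_c G E \<alpha> \<O>"

lemma Gamma_c_simps:
  "carrier \<Gamma> = generate (section_group G \<O>) (elementary_sections G E \<O>)"
  "\<zero>\<^bsub>\<Gamma>\<^esub> = (\<lambda>\<gamma>\<in>topspace (arrows G). \<zero>\<^bsub>\<O> (rmap G \<gamma>)\<^esub>)"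
  "f \<oplus>\<^bsub>\<Gamma>\<^esub> g = (\<lambda>\<gamma>\<in>topspace (arrows G). f \<gamma> \<oplus>\<^bsub>\<O> (rmap G \<gamma>)\<^esub> g \<gamma>)"
  "f \<otimes>\<^bsub>\<Gamma>\<^esub> g = convolution G \<alpha> \<O> f g"
  by (simp_all add: Gamma_c_def)

lemma zero_mem_Gamma_c: "\<zero>\<^bsub>\<Gamma>\<^esub> \<in> carrier \<Gamma>"
  using generate.one[of "section_group G \<O>" "elementary_sections G E \<O>"]
  by (simp add: Gamma_c_simps section_group_def)

lemma elementary_mem_Gamma_c: "f \<in> elementary_sections G E \<O> \<Longrightarrow> f \<in> carrier \<Gamma>"
  by (simp add: Gamma_c_simps generate.incl)

lemma add_mem_Gamma_c: "f \<in> carrier \<Gamma> \<Longrightarrow> g \<in> carrier \<Gamma> \<Longrightarrow> f \<oplus>\<^bsub>\<Gamma>\<^esub> g \<in> carrier \<Gamma>"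
  using generate.eng[of f "section_group G \<O>" "elementary_sections G E \<O>" g]
  by (simp add: Gamma_c_simps section_group_def)

text \<open>These properties are chosen to survive the induction over the generated group: covers of
  supports are joined under addition, and continuity on the whole arrow space, unlike continuity on
  one bisection, is additive. The cover yields finite fibres of the support and, at the end, the
  finitely many bisections to be avoided.\<close>

lemma Gamma_c_memD:
  assumes "f \<in> carrier \<Gamma>"
  shows "(\<forall>\<gamma>\<in>topspace (arrows G). f \<gamma> \<in> carrier (\<O> (rmap G \<gamma>)))
    \<and> f \<in> extensional (topspace (arrows G)) \<and> continuous_map (arrows G) E f
    \<and> (\<exists>\<U>. finite \<U> \<and> (\<forall>U\<in>\<U>. openin (arrows G) U \<and> bisection G U)
         \<and> (\<forall>\<gamma>\<in>topspace (arrows G). f \<gamma> \<noteq> \<zero>\<^bsub>\<O> (rmap G \<gamma>)\<^esub> \<longrightarrow> \<gamma> \<in> \<Union>\<U>))"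
    (is "?P f")
proof -
  have ring: "ring (\<O> (rmap G \<gamma>))" if "\<gamma> \<in> topspace (arrows G)" for \<gamma>
    using stalk_ring rmap_closed that by blast
  have group: "group (add_monoid (\<O> (rmap G \<gamma>)))" if "\<gamma> \<in> topspace (arrows G)" for \<gamma>
    using abelian_group.a_group ring.is_abelian_group ring that by blast
  have zero: "continuous_map (arrows G) E (\<lambda>\<gamma>. \<zero>\<^bsub>\<O> (rmap G \<gamma>)\<^esub>)"
    using continuous_map_compose[OF continuous_map_rmap continuous_map_zero] by (simp add: o_def)
  have pf: "p (f \<gamma>) = rmap G \<gamma>" if "?P f" "\<gamma> \<in> topspace (arrows G)" for f \<gamma>
    using that stalk_memD rmap_closed by blast
  have elementary: "?P f" if f: "f \<in> elementary_sections G E \<O>" for f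
  proof -
    obtain U where U: "compact_open (arrows G) U" "bisection G U"
      and fU: "continuous_map (subtopology (arrows G) U) E f"
        "\<And>\<gamma>. \<gamma> \<in> topspace (arrows G) \<Longrightarrow> \<gamma> \<notin> U \<Longrightarrow> f \<gamma> = \<zero>\<^bsub>\<O> (rmap G \<gamma>)\<^esub>"
      using f unfolding elementary_sections_def by blast
    \<comment> \<open>Here the Hausdorff property of the arrow space is used: \<open>U\<close> is
      clopen, so \<open>f\<close> is pasted from its restriction to \<open>U\<close> and the zero
      section off \<open>U\<close>.\<close>
    have oU: "openin (arrows G) U" and cU: "closedin (arrows G) U"
      using U(1) Hausdorff_arrows compactin_imp_closedin by (auto simp: compact_open_def)
    have "continuous_map (arrows G) E f"
    proof (rule continuous_map_locally)
      fix \<gamma> assume \<gamma>: "\<gamma> \<in> topspace (arrows G)"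
      have "continuous_map (subtopology (arrows G) (topspace (arrows G) - U)) E
          (\<lambda>\<gamma>. \<zero>\<^bsub>\<O> (rmap G \<gamma>)\<^esub>)"
        using zero by (rule continuous_map_from_subtopology)
      hence "continuous_map (subtopology (arrows G) (topspace (arrows G) - U)) E f"
        by (rule continuous_map_eq) (simp add: fU(2))
      moreover have "openin (arrows G) (topspace (arrows G) - U)"
        using cU by blast
      ultimately show "\<exists>N. openin (arrows G) N \<and> \<gamma> \<in> N \<and> continuous_map (subtopology (arrows G) N) E f"
        using fU(1) oU \<gamma> by blast
    qed
    moreover have "f \<in> (\<Pi>\<^sub>E \<gamma>\<in>topspace (arrows G). carrier (\<O> (rmap G \<gamma>)))"
      using f by (simp add: elementary_sections_def section_group_def)
    ultimately show ?thesis
      using U(2) oU fU(2) by (intro conjI exI[of _ "{U}"]) (auto simp: PiE_iff)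
  qed
  \<comment> \<open>The group operations of the product group all return functions cut down to the
    arrows, so zero, negatives and sums are treated alike.\<close>
  have P_restrict: "?P (restrict h (topspace (arrows G)))"
    if "\<And>\<gamma>. \<gamma> \<in> topspace (arrows G) \<Longrightarrow> h \<gamma> \<in> carrier (\<O> (rmap G \<gamma>))"
      and h: "continuous_map (arrows G) E h"
      and \<U>: "finite \<U>" "\<forall>U\<in>\<U>. openin (arrows G) U \<and> bisection G U"
        "\<And>\<gamma>. \<gamma> \<in> topspace (arrows G) \<Longrightarrow> h \<gamma> \<noteq> \<zero>\<^bsub>\<O> (rmap G \<gamma>)\<^esub> \<Longrightarrow> \<gamma> \<in> \<Union>\<U>" for h \<U>
  proof (intro conjI)
    show "continuous_map (arrows G) E (restrict h (topspace (arrows G)))"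
      using h by (rule continuous_map_eq) simp
    show "\<exists>\<U>. finite \<U> \<and> (\<forall>U\<in>\<U>. openin (arrows G) U \<and> bisection G U)
        \<and> (\<forall>\<gamma>\<in>topspace (arrows G). restrict h (topspace (arrows G)) \<gamma> \<noteq> \<zero>\<^bsub>\<O> (rmap G \<gamma>)\<^esub> \<longrightarrow> \<gamma> \<in> \<Union>\<U>)"
      using \<U> by (intro exI[of _ \<U>]) simp
    show "restrict h (topspace (arrows G)) \<in> extensional (topspace (arrows G))"
      by (rule restrict_extensional)
  qed (use that(1) in simp)
  show ?thesis
    using assms unfolding Gamma_c_simps
  proof (induction rule: generate.induct)
    case one
    have eq: "\<one>\<^bsub>section_group G \<O>\<^esub> = (\<lambda>\<gamma>\<in>topspace (arrows G). \<zero>\<^bsub>\<O> (rmap G \<gamma>)\<^esub>)"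
      by (simp add: section_group_def)
    show ?case
      unfolding eq using ring zero
      by (intro P_restrict[of _ "{}"]) (auto simp: ring.ring_simprules)
  next
    case (incl f)
    then show ?case by (rule elementary)
  next
    case (inv f)
    note P = elementary[OF inv]
    obtain \<U> where \<U>: "finite \<U>" "\<forall>U\<in>\<U>. openin (arrows G) U \<and> bisection G U"
        "\<forall>\<gamma>\<in>topspace (arrows G). f \<gamma> \<noteq> \<zero>\<^bsub>\<O> (rmap G \<gamma>)\<^esub> \<longrightarrow> \<gamma> \<in> \<Union>\<U>"
      using P by blast
    have f: "f \<in> (\<Pi>\<^sub>E \<gamma>\<in>topspace (arrows G). carrier (add_monoid (\<O> (rmap G \<gamma>))))"
      using P by (auto simp: PiE_iff)
    have eq: "inv\<^bsub>section_group G \<O>\<^esub> f = (\<lambda>\<gamma>\<in>topspace (arrows G). \<ominus>\<^bsub>\<O> (rmap G \<gamma>)\<^esub> f \<gamma>)"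
      using inv_product_group[OF f group] by (simp add: section_group_def a_inv_def)
    show ?case
      unfolding eq
    proof (rule P_restrict[OF _ _ \<U>(1,2)])
      show "continuous_map (arrows G) E (\<lambda>\<gamma>. \<ominus>\<^bsub>\<O> (rmap G \<gamma>)\<^esub> f \<gamma>)"
        using P pf[OF P] by (intro continuous_map_neg) auto
      fix \<gamma> assume \<gamma>: "\<gamma> \<in> topspace (arrows G)"
      interpret ring "\<O> (rmap G \<gamma>)" using ring \<gamma> .
      show "\<ominus>\<^bsub>\<O> (rmap G \<gamma>)\<^esub> f \<gamma> \<in> carrier (\<O> (rmap G \<gamma>))" using P \<gamma> by auto
      show "\<gamma> \<in> \<Union>\<U>" if "\<ominus>\<^bsub>\<O> (rmap G \<gamma>)\<^esub> f \<gamma> \<noteq> \<zero>\<^bsub>\<O> (rmap G \<gamma>)\<^esub>"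
      proof -
        have "f \<gamma> \<noteq> \<zero>\<^bsub>\<O> (rmap G \<gamma>)\<^esub>" using that by auto
        then show ?thesis using \<U>(3) \<gamma> by blast
      qed
    qed
  next
    case (eng f g)
    obtain \<U> where \<U>: "finite \<U>" "\<forall>U\<in>\<U>. openin (arrows G) U \<and> bisection G U"
        "\<forall>\<gamma>\<in>topspace (arrows G). f \<gamma> \<noteq> \<zero>\<^bsub>\<O> (rmap G \<gamma>)\<^esub> \<longrightarrow> \<gamma> \<in> \<Union>\<U>"
      using eng.IH(1) by blast
    obtain \<V> where \<V>: "finite \<V>" "\<forall>U\<in>\<V>. openin (arrows G) U \<and> bisection G U"
        "\<forall>\<gamma>\<in>topspace (arrows G). g \<gamma> \<noteq> \<zero>\<^bsub>\<O> (rmap G \<gamma>)\<^esub> \<longrightarrow> \<gamma> \<in> \<Union>\<V>"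
      using eng.IH(2) by blast
    have eq: "f \<otimes>\<^bsub>section_group G \<O>\<^esub> g = (\<lambda>\<gamma>\<in>topspace (arrows G). f \<gamma> \<oplus>\<^bsub>\<O> (rmap G \<gamma>)\<^esub> g \<gamma>)"
      by (simp add: section_group_def)
    show ?case
      unfolding eq
    proof (rule P_restrict)
      show "finite (\<U> \<union> \<V>)" "\<forall>U\<in>\<U> \<union> \<V>. openin (arrows G) U \<and> bisection G U"
        using \<U> \<V> by auto
      show "continuous_map (arrows G) E (\<lambda>\<gamma>. f \<gamma> \<oplus>\<^bsub>\<O> (rmap G \<gamma>)\<^esub> g \<gamma>)"
        using eng.IH pf[OF eng.IH(1)] pf[OF eng.IH(2)] by (intro continuous_map_add) auto
      fix \<gamma> assume \<gamma>: "\<gamma> \<in> topspace (arrows G)"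
      interpret ring "\<O> (rmap G \<gamma>)" using ring \<gamma> .
      show "f \<gamma> \<oplus>\<^bsub>\<O> (rmap G \<gamma>)\<^esub> g \<gamma> \<in> carrier (\<O> (rmap G \<gamma>))" using eng.IH \<gamma> by auto
      show "\<gamma> \<in> \<Union>(\<U> \<union> \<V>)" if "f \<gamma> \<oplus>\<^bsub>\<O> (rmap G \<gamma>)\<^esub> g \<gamma> \<noteq> \<zero>\<^bsub>\<O> (rmap G \<gamma>)\<^esub>"
      proof -
        have "f \<gamma> \<noteq> \<zero>\<^bsub>\<O> (rmap G \<gamma>)\<^esub> \<or> g \<gamma> \<noteq> \<zero>\<^bsub>\<O> (rmap G \<gamma>)\<^esub>" using that by auto
        then show ?thesis using \<U>(3) \<V>(3) \<gamma> by blast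
      qed
    qed
  qed
qed

lemma Gamma_c_value: "f \<in> carrier \<Gamma> \<Longrightarrow> \<gamma> \<in> topspace (arrows G) \<Longrightarrow> f \<gamma> \<in> carrier (\<O> (rmap G \<gamma>))"
  using Gamma_c_memD by blast

text \<open>Finite range fibres make the sum defining the action on a vector finite; finite source
  fibres keep the resulting vector finitely supported.\<close>

lemma finite_support_fibres:
  assumes "f \<in> carrier \<Gamma>"
  shows "finite {\<gamma> \<in> topspace (arrows G). rmap G \<gamma> = z \<and> f \<gamma> \<noteq> \<zero>\<^bsub>\<O> (rmap G \<gamma>)\<^esub>}"
    and "finite {\<gamma> \<in> topspace (arrows G). dmap G \<gamma> = z \<and> f \<gamma> \<noteq> \<zero>\<^bsub>\<O> (rmap G \<gamma>)\<^esub>}"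
proof -
  obtain \<U> where \<U>: "finite \<U>" "\<forall>U\<in>\<U>. openin (arrows G) U \<and> bisection G U"
      "\<forall>\<gamma>\<in>topspace (arrows G). f \<gamma> \<noteq> \<zero>\<^bsub>\<O> (rmap G \<gamma>)\<^esub> \<longrightarrow> \<gamma> \<in> \<Union>\<U>"
    using Gamma_c_memD[OF assms] by blast
  show "finite {\<gamma> \<in> topspace (arrows G). rmap G \<gamma> = z \<and> f \<gamma> \<noteq> \<zero>\<^bsub>\<O> (rmap G \<gamma>)\<^esub>}"
    by (rule finite_fibre_of_injective_cover[of \<U> "rmap G" _ z]) (use \<U> in \<open>auto simp: bisection_def\<close>)
  show "finite {\<gamma> \<in> topspace (arrows G). dmap G \<gamma> = z \<and> f \<gamma> \<noteq> \<zero>\<^bsub>\<O> (rmap G \<gamma>)\<^esub>}"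
    by (rule finite_fibre_of_injective_cover[of \<U> "dmap G" _ z]) (use \<U> in \<open>auto simp: bisection_def\<close>)
qed

text \<open>The supply of ring elements: a local lift of the range map through \<open>c\<close>, cut
  off to zero outside a compact open bisection on which the lift is defined.\<close>

lemma elementary_section_through:
  assumes N: "openin (arrows G) N" "\<gamma> \<in> N" and c: "c \<in> carrier (\<O> (rmap G \<gamma>))"
  obtains s U where "s \<in> carrier \<Gamma>" "bisection G U" "\<gamma> \<in> U" "U \<subseteq> N" "s \<gamma> = c"
    "\<And>\<beta>. \<beta> \<in> topspace (arrows G) - U \<Longrightarrow> s \<beta> = \<zero>\<^bsub>\<O> (rmap G \<beta>)\<^esub>"
proof -
  have \<gamma>: "\<gamma> \<in> topspace (arrows G)" using N openin_subset by blast
  have cE: "c \<in> topspace E" "p c = rmap G \<gamma>"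
    using stalk_memD[OF rmap_closed[OF \<gamma>] c] by auto
  obtain M g where M: "openin (arrows G) M" "\<gamma> \<in> M"
    and g: "continuous_map (subtopology (arrows G) M) E g"
      "\<And>\<beta>. \<beta> \<in> M \<Longrightarrow> g \<beta> \<in> topspace E \<and> p (g \<beta>) = rmap G \<beta>" "g \<gamma> = c"
    using lift_through_point[OF continuous_map_rmap \<gamma> cE] by blast
  obtain U where U: "compact_open (arrows G) U" "bisection G U" "\<gamma> \<in> U" "U \<subseteq> N \<inter> M"
    using compact_open_bisection_basis[of "N \<inter> M" \<gamma>] N M by blast
  define s where "s = (\<lambda>\<beta>\<in>topspace (arrows G). if \<beta> \<in> U then g \<beta> else \<zero>\<^bsub>\<O> (rmap G \<beta>)\<^esub>)"
  have UT: "U \<subseteq> topspace (arrows G)" using U(2) by (simp add: bisection_def)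
  have "s \<in> elementary_sections G E \<O>"
    unfolding elementary_sections_def
  proof (intro CollectI conjI exI[of _ U] ballI)
    have "s \<beta> \<in> carrier (\<O> (rmap G \<beta>))" if "\<beta> \<in> topspace (arrows G)" for \<beta>
    proof (cases "\<beta> \<in> U")
      case True
      then have "g \<beta> \<in> topspace E \<and> p (g \<beta>) = rmap G \<beta>" using g(2) U(4) by blast
      then show ?thesis using True that stalk_memI[of "g \<beta>"] by (simp add: s_def)
    next
      case False
      interpret ring "\<O> (rmap G \<beta>)" using stalk_ring rmap_closed that by blast
      show ?thesis using False that by (simp add: s_def)
    qed
    then show "s \<in> carrier (section_group G \<O>)"
      by (auto simp: section_group_def s_def PiE_iff)
    have "continuous_map (subtopology (arrows G) U) E g"
      using g(1) by (rule continuous_map_from_subtopology_mono) (use U in auto)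
    then show "continuous_map (subtopology (arrows G) U) E s"
      by (rule continuous_map_eq) (auto simp: s_def)
  qed (use U in \<open>auto simp: s_def\<close>)
  then show ?thesis
    using U g(3) \<gamma> by (intro that[of s U]) (auto simp: s_def elementary_mem_Gamma_c)
qed

end

section \<open>The modules of sections over orbits\<close>

text \<open>Together with \<open>finprod_fibres\<close> this gives the two groupings of one sum
  needed for associativity of the action. Both are written multiplicatively and used for the
  additive monoid of a stalk.\<close>

lemma (in comm_monoid) finprod_Sigma:
  assumes "finite B" "\<And>b. b \<in> B \<Longrightarrow> finite (C b)" "h \<in> Sigma B C \<rightarrow> carrier G"
  shows "finprod G h (Sigma B C) = finprod G (\<lambda>b. finprod G (\<lambda>c. h (b, c)) (C b)) B"
proof -
  have "Sigma B C = (\<Union>b\<in>B. Pair b ` C b)" by auto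
  also have "finprod G h \<dots> = finprod G (\<lambda>b. finprod G h (Pair b ` C b)) B"
    using assms by (intro finprod_UN_disjoint) (auto simp: pairwise_def disjnt_def)
  also have "\<dots> = finprod G (\<lambda>b. finprod G (\<lambda>c. h (b, c)) (C b)) B"
  proof (rule finprod_cong')
    fix b assume b: "b \<in> B"
    have "inj_on (Pair b) (C b)" "h \<in> Pair b ` C b \<rightarrow> carrier G"
      using assms(3) b by (auto simp: inj_on_def)
    then show "finprod G h (Pair b ` C b) = finprod G (\<lambda>c. h (b, c)) (C b)"
      by (simp add: finprod_reindex)
  qed (use assms(3) in \<open>auto intro!: finprod_closed\<close>)
  finally show ?thesis .
qed

lemma (in comm_monoid) finprod_fibres:
  assumes "finite A" "h \<in> A \<rightarrow> carrier G"
  shows "finprod G h A = finprod G (\<lambda>c. finprod G h {a \<in> A. k a = c}) (k ` A)"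
proof -
  have "A = (\<Union>c\<in>k ` A. {a \<in> A. k a = c})" by auto
  then have "finprod G h A = finprod G h (\<Union>c\<in>k ` A. {a \<in> A. k a = c})" by simp
  also have "\<dots> = finprod G (\<lambda>c. finprod G h {a \<in> A. k a = c}) (k ` A)"
    using assms by (intro finprod_UN_disjoint) (auto simp: pairwise_def disjnt_def)
  finally show ?thesis .
qed

section \<open>Orbits\<close>

context hausdorff_ample_groupoid
begin

definition orbit :: "'x \<Rightarrow> 'x set" where
  "orbit x = rmap G ` {\<gamma> \<in> topspace (arrows G). dmap G \<gamma> = x}"

lemma orbit_units: "z \<in> orbit x \<Longrightarrow> z \<in> topspace (units G)"
  using rmap_closed by (auto simp: orbit_def)

lemma orbit_rmap:
  assumes \<gamma>: "\<gamma> \<in> topspace (arrows G)" and "dmap G \<gamma> \<in> orbit x"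
  shows "rmap G \<gamma> \<in> orbit x"
proof -
  obtain \<beta> where \<beta>: "\<beta> \<in> topspace (arrows G)" "dmap G \<beta> = x" "dmap G \<gamma> = rmap G \<beta>"
    using assms(2) by (auto simp: orbit_def)
  have "gmult G \<gamma> \<beta> \<in> topspace (arrows G)" "dmap G (gmult G \<gamma> \<beta>) = x"
    "rmap G (gmult G \<gamma> \<beta>) = rmap G \<gamma>"
    using gmult_closed[OF \<gamma> \<beta>(1,3)] dmap_gmult[OF \<gamma> \<beta>(1,3)] rmap_gmult[OF \<gamma> \<beta>(1,3)] \<beta>(2)
    by auto
  then show ?thesis unfolding orbit_def by (metis (mono_tags, lifting) imageI mem_Collect_eq)
qed

lemma orbit_dmap:
  assumes \<gamma>: "\<gamma> \<in> topspace (arrows G)" and "rmap G \<gamma> \<in> orbit x"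
  shows "dmap G \<gamma> \<in> orbit x"
  using orbit_rmap[OF ginv_closed[OF \<gamma>]] assms dmap_ginv[OF \<gamma>] rmap_ginv[OF \<gamma>] by simp

text \<open>Go back from \<open>y\<close> to \<open>x\<close> along an inverse and on from
  \<open>x\<close> to \<open>z\<close>.\<close>

lemma orbit_transitive:
  assumes "y \<in> orbit x" "z \<in> orbit x"
  obtains \<gamma> where "\<gamma> \<in> topspace (arrows G)" "dmap G \<gamma> = y" "rmap G \<gamma> = z"
proof -
  obtain \<beta> \<rho> where \<beta>: "\<beta> \<in> topspace (arrows G)" "dmap G \<beta> = x" "rmap G \<beta> = y"
    and \<rho>: "\<rho> \<in> topspace (arrows G)" "dmap G \<rho> = x" "rmap G \<rho> = z"
    using assms by (auto simp: orbit_def)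
  have i: "ginv G \<beta> \<in> topspace (arrows G)" "dmap G \<rho> = rmap G (ginv G \<beta>)"
    using \<beta> \<rho> ginv_closed rmap_ginv by auto
  show ?thesis
    using that[OF gmult_closed[OF \<rho>(1) i]] dmap_gmult[OF \<rho>(1) i] rmap_gmult[OF \<rho>(1) i]
      dmap_ginv[OF \<beta>(1)] \<beta>(3) \<rho>(3) by simp
qed

text \<open>No unit arrow is used: the range of \<gamma> lies in the orbit of its source by
  definition, and the inverse of \<gamma> leads back.\<close>

lemma orbit_self: "\<gamma> \<in> topspace (arrows G) \<Longrightarrow> dmap G \<gamma> \<in> orbit (dmap G \<gamma>)"
  using orbit_dmap[of \<gamma> "dmap G \<gamma>"] by (auto simp: orbit_def)

end

section \<open>The orbit module and its module laws\<close>

context ample_sheaf_of_rings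
begin

text \<open>The index set is the support of \<open>f\<close> in the range fibre, which is finite for
  \<open>f\<close> in \<Gamma>, whereas the whole fibre may be infinite.\<close>

definition fibre_sum :: "('g \<Rightarrow> 'e) \<Rightarrow> ('x \<Rightarrow> 'e) \<Rightarrow> 'x \<Rightarrow> 'e" where
  "fibre_sum f v z = finsum (\<O> z) (\<lambda>\<gamma>. f \<gamma> \<otimes>\<^bsub>\<O> z\<^esub> \<alpha> \<gamma> (v (dmap G \<gamma>)))
     {\<gamma> \<in> topspace (arrows G). rmap G \<gamma> = z \<and> f \<gamma> \<noteq> \<zero>\<^bsub>\<O> z\<^esub>}"

text \<open>A twisted form of the permutation module of a groupoid algebra on an orbit: an arrow
  moves the point and carries the coefficient along by \<alpha>. Vectors are extensional, so that
  they are determined by their entries on the orbit.\<close>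

definition orbit_module :: "'x \<Rightarrow> ('g \<Rightarrow> 'e, 'x \<Rightarrow> 'e) module" where
  "orbit_module x = \<lparr>
     carrier = {v \<in> (\<Pi>\<^sub>E z\<in>orbit x. carrier (\<O> z)). finite {z \<in> orbit x. v z \<noteq> \<zero>\<^bsub>\<O> z\<^esub>}},
     mult = undefined, one = undefined,
     zero = (\<lambda>z\<in>orbit x. \<zero>\<^bsub>\<O> z\<^esub>),
     add = (\<lambda>v w. \<lambda>z\<in>orbit x. v z \<oplus>\<^bsub>\<O> z\<^esub> w z),
     smult = (\<lambda>f v. \<lambda>z\<in>orbit x. fibre_sum f v z)\<rparr>"

lemma orbit_module_simps:
  "carrier (orbit_module x) =
     {v \<in> (\<Pi>\<^sub>E z\<in>orbit x. carrier (\<O> z)). finite {z \<in> orbit x. v z \<noteq> \<zero>\<^bsub>\<O> z\<^esub>}}"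
  "\<zero>\<^bsub>orbit_module x\<^esub> = (\<lambda>z\<in>orbit x. \<zero>\<^bsub>\<O> z\<^esub>)"
  "v \<oplus>\<^bsub>orbit_module x\<^esub> w = (\<lambda>z\<in>orbit x. v z \<oplus>\<^bsub>\<O> z\<^esub> w z)"
  "f \<odot>\<^bsub>orbit_module x\<^esub> v = (\<lambda>z\<in>orbit x. fibre_sum f v z)"
  by (simp_all add: orbit_module_def)

lemma orbit_ring: "z \<in> orbit x \<Longrightarrow> ring (\<O> z)"
  using stalk_ring orbit_units by blast

lemma act_ring_hom:
  assumes "\<gamma> \<in> topspace (arrows G)"
  shows "ring_hom_ring (\<O> (dmap G \<gamma>)) (\<O> (rmap G \<gamma>)) (\<alpha> \<gamma>)"
  using assms stalk_ring dmap_closed rmap_closed act_hom by (intro ring_hom_ringI2) auto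

lemma act_closed:
  "\<gamma> \<in> topspace (arrows G) \<Longrightarrow> a \<in> carrier (\<O> (dmap G \<gamma>)) \<Longrightarrow> \<alpha> \<gamma> a \<in> carrier (\<O> (rmap G \<gamma>))"
  using act_hom ring_hom_closed by fast

lemma act_zero: "\<gamma> \<in> topspace (arrows G) \<Longrightarrow> \<alpha> \<gamma> \<zero>\<^bsub>\<O> (dmap G \<gamma>)\<^esub> = \<zero>\<^bsub>\<O> (rmap G \<gamma>)\<^esub>"
  using ring_hom_zero[OF act_hom] stalk_ring dmap_closed rmap_closed by blast

lemma orbit_module_value:
  "v \<in> carrier (orbit_module x) \<Longrightarrow> z \<in> orbit x \<Longrightarrow> v z \<in> carrier (\<O> z)"
  by (auto simp: orbit_module_simps)

lemma orbit_module_act_value: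
  assumes "v \<in> carrier (orbit_module x)" "\<gamma> \<in> topspace (arrows G)" "rmap G \<gamma> \<in> orbit x"
  shows "\<alpha> \<gamma> (v (dmap G \<gamma>)) \<in> carrier (\<O> (rmap G \<gamma>))"
  using assms by (intro act_closed orbit_module_value orbit_dmap)

text \<open>Allows any finite index set that catches the arrows where both \<open>f\<close> and
  \<open>v\<close> contribute. The comparison passes through the union \<open>A \<union> B\<close>:
  terms outside \<open>B\<close> vanish because \<open>f\<close> does, terms outside
  \<open>A\<close> because \<alpha> maps zero to zero. Later choices of \<open>A\<close> include the
  empty set, a singleton and a union of two supports.\<close>

lemma fibre_sum_eq:
  assumes f: "f \<in> carrier \<Gamma>" and v: "v \<in> carrier (orbit_module x)" and z: "z \<in> orbit x"
    and A: "finite A" "A \<subseteq> {\<gamma> \<in> topspace (arrows G). rmap G \<gamma> = z}"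
    and supp: "\<And>\<gamma>. \<lbrakk>\<gamma> \<in> topspace (arrows G); rmap G \<gamma> = z; f \<gamma> \<noteq> \<zero>\<^bsub>\<O> z\<^esub>;
      v (dmap G \<gamma>) \<noteq> \<zero>\<^bsub>\<O> (dmap G \<gamma>)\<^esub>\<rbrakk> \<Longrightarrow> \<gamma> \<in> A"
  shows "fibre_sum f v z = finsum (\<O> z) (\<lambda>\<gamma>. f \<gamma> \<otimes>\<^bsub>\<O> z\<^esub> \<alpha> \<gamma> (v (dmap G \<gamma>))) A"
proof -
  interpret ring "\<O> z" using orbit_ring[OF z] .
  define h where "h = (\<lambda>\<gamma>. f \<gamma> \<otimes>\<^bsub>\<O> z\<^esub> \<alpha> \<gamma> (v (dmap G \<gamma>)))"
  define B where "B = {\<gamma> \<in> topspace (arrows G). rmap G \<gamma> = z \<and> f \<gamma> \<noteq> \<zero>\<^bsub>\<O> z\<^esub>}"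
  have fc: "f \<gamma> \<in> carrier (\<O> z)" and vc: "\<alpha> \<gamma> (v (dmap G \<gamma>)) \<in> carrier (\<O> z)"
    if "\<gamma> \<in> topspace (arrows G)" "rmap G \<gamma> = z" for \<gamma>
    using Gamma_c_value[OF f that(1)] orbit_module_act_value[OF v that(1)] that z by auto
  have "B = {\<gamma> \<in> topspace (arrows G). rmap G \<gamma> = z \<and> f \<gamma> \<noteq> \<zero>\<^bsub>\<O> (rmap G \<gamma>)\<^esub>}"
    by (auto simp: B_def)
  then have fin: "finite B" using finite_support_fibres(1)[OF f] by simp
  have hc: "h \<gamma> \<in> carrier (\<O> z)" if "\<gamma> \<in> A \<union> B" for \<gamma>
  proof -
    have "\<gamma> \<in> topspace (arrows G)" "rmap G \<gamma> = z" using that A(2) by (auto simp: B_def)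
    then show ?thesis using fc vc by (simp add: h_def)
  qed
  have "finsum (\<O> z) h B = finsum (\<O> z) h (A \<union> B)"
  proof (rule add.finprod_mono_neutral_cong_left)
    fix \<gamma> assume "\<gamma> \<in> A \<union> B - B"
    then have "\<gamma> \<in> topspace (arrows G)" "rmap G \<gamma> = z" "f \<gamma> = \<zero>\<^bsub>\<O> z\<^esub>"
      using A(2) by (auto simp: B_def)
    then show "h \<gamma> = \<zero>\<^bsub>\<O> z\<^esub>" using vc by (simp add: h_def)
  qed (use fin A(1) hc in auto)
  also have "\<dots> = finsum (\<O> z) h A"
  proof (rule add.finprod_mono_neutral_cong_right)
    fix \<gamma> assume "\<gamma> \<in> A \<union> B - A"
    then have \<gamma>: "\<gamma> \<in> topspace (arrows G)" "rmap G \<gamma> = z" "v (dmap G \<gamma>) = \<zero>\<^bsub>\<O> (dmap G \<gamma>)\<^esub>"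
      using supp by (auto simp: B_def)
    then show "h \<gamma> = \<zero>\<^bsub>\<O> z\<^esub>" using act_zero[OF \<gamma>(1)] fc[OF \<gamma>(1,2)] by (simp add: h_def)
  qed (use fin A(1) hc in auto)
  finally show ?thesis by (simp add: fibre_sum_def h_def B_def)
qed

lemma fibre_sum_closed:
  assumes f: "f \<in> carrier \<Gamma>" and v: "v \<in> carrier (orbit_module x)" and z: "z \<in> orbit x"
  shows "fibre_sum f v z \<in> carrier (\<O> z)"
proof -
  interpret ring "\<O> z" using orbit_ring[OF z] .
  show ?thesis
    unfolding fibre_sum_def
  proof (rule finsum_closed, rule funcsetI)
    fix \<gamma> assume "\<gamma> \<in> {\<gamma> \<in> topspace (arrows G). rmap G \<gamma> = z \<and> f \<gamma> \<noteq> \<zero>\<^bsub>\<O> z\<^esub>}"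
    then show "f \<gamma> \<otimes>\<^bsub>\<O> z\<^esub> \<alpha> \<gamma> (v (dmap G \<gamma>)) \<in> carrier (\<O> z)"
      using Gamma_c_value[OF f, of \<gamma>] orbit_module_act_value[OF v, of \<gamma>] z by simp
  qed
qed

text \<open>A nonzero entry can only occur at the range of an arrow that lies in the support of
  \<open>f\<close> and starts in the support of \<open>v\<close>; the finitely many source fibres
  involved are finite.\<close>

lemma smult_closed:
  assumes f: "f \<in> carrier \<Gamma>" and v: "v \<in> carrier (orbit_module x)"
  shows "f \<odot>\<^bsub>orbit_module x\<^esub> v \<in> carrier (orbit_module x)"
proof -
  define S where "S = (\<Union>y\<in>{z \<in> orbit x. v z \<noteq> \<zero>\<^bsub>\<O> z\<^esub>}.
    rmap G ` {\<gamma> \<in> topspace (arrows G). dmap G \<gamma> = y \<and> f \<gamma> \<noteq> \<zero>\<^bsub>\<O> (rmap G \<gamma>)\<^esub>})"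
  have "finite S"
    unfolding S_def using v finite_support_fibres(2)[OF f] by (auto simp: orbit_module_simps)
  moreover have "fibre_sum f v z = \<zero>\<^bsub>\<O> z\<^esub>" if z: "z \<in> orbit x" "z \<notin> S" for z
  proof -
    interpret ring "\<O> z" using orbit_ring[OF z(1)] .
    have "\<gamma> \<in> {}" if "\<gamma> \<in> topspace (arrows G)" "rmap G \<gamma> = z" "f \<gamma> \<noteq> \<zero>\<^bsub>\<O> z\<^esub>"
      "v (dmap G \<gamma>) \<noteq> \<zero>\<^bsub>\<O> (dmap G \<gamma>)\<^esub>" for \<gamma>
      using that z orbit_dmap[of \<gamma> x] by (force simp: S_def)
    then have "fibre_sum f v z = finsum (\<O> z) (\<lambda>\<gamma>. f \<gamma> \<otimes>\<^bsub>\<O> z\<^esub> \<alpha> \<gamma> (v (dmap G \<gamma>))) {}"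
      by (intro fibre_sum_eq[OF f v z(1)]) auto
    then show ?thesis by simp
  qed
  then have "{z \<in> orbit x. fibre_sum f v z \<noteq> \<zero>\<^bsub>\<O> z\<^esub>} \<subseteq> S" by blast
  ultimately have "finite {z \<in> orbit x. fibre_sum f v z \<noteq> \<zero>\<^bsub>\<O> z\<^esub>}" using finite_subset by blast
  moreover have "{z \<in> orbit x. (f \<odot>\<^bsub>orbit_module x\<^esub> v) z \<noteq> \<zero>\<^bsub>\<O> z\<^esub>}
      = {z \<in> orbit x. fibre_sum f v z \<noteq> \<zero>\<^bsub>\<O> z\<^esub>}"
    by (auto simp: orbit_module_simps)
  ultimately show ?thesis
    using fibre_sum_closed[OF f v] by (simp add: orbit_module_simps PiE_iff)
qed

lemma abelian_group_orbit_module: "abelian_group (orbit_module x)"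
proof (rule abelian_groupI)
  let ?M = "orbit_module x"
  have restrict_mem: "(\<lambda>z\<in>orbit x. h z) \<in> carrier ?M"
    if "\<And>z. z \<in> orbit x \<Longrightarrow> h z \<in> carrier (\<O> z)"
      "finite A" "\<And>z. z \<in> orbit x \<Longrightarrow> h z \<noteq> \<zero>\<^bsub>\<O> z\<^esub> \<Longrightarrow> z \<in> A" for h A
  proof -
    have "{z \<in> orbit x. (\<lambda>z\<in>orbit x. h z) z \<noteq> \<zero>\<^bsub>\<O> z\<^esub>} \<subseteq> A" using that(3) by auto
    then show ?thesis using that(1) finite_subset[OF _ that(2)] by (simp add: orbit_module_simps)
  qed
  note R = ring.ring_simprules[OF orbit_ring]
  note val = orbit_module_value
  show "\<zero>\<^bsub>?M\<^esub> \<in> carrier ?M"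
    unfolding orbit_module_simps(2) by (rule restrict_mem[of _ "{}"]) (auto intro: R)
  fix u v assume u: "u \<in> carrier ?M" and v: "v \<in> carrier ?M"
  show "u \<oplus>\<^bsub>?M\<^esub> v \<in> carrier ?M"
    unfolding orbit_module_simps(3)
  proof (rule restrict_mem)
    show "finite ({z \<in> orbit x. u z \<noteq> \<zero>\<^bsub>\<O> z\<^esub>} \<union> {z \<in> orbit x. v z \<noteq> \<zero>\<^bsub>\<O> z\<^esub>})"
      using u v by (simp add: orbit_module_simps)
    fix z assume z: "z \<in> orbit x"
    interpret ring "\<O> z" using orbit_ring[OF z] .
    show "u z \<oplus>\<^bsub>\<O> z\<^esub> v z \<in> carrier (\<O> z)" using val[OF u z] val[OF v z] by simp
    show "z \<in> {z \<in> orbit x. u z \<noteq> \<zero>\<^bsub>\<O> z\<^esub>} \<union> {z \<in> orbit x. v z \<noteq> \<zero>\<^bsub>\<O> z\<^esub>}"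
      if "u z \<oplus>\<^bsub>\<O> z\<^esub> v z \<noteq> \<zero>\<^bsub>\<O> z\<^esub>" using that z by auto
  qed
  show "u \<oplus>\<^bsub>?M\<^esub> v = v \<oplus>\<^bsub>?M\<^esub> u"
    unfolding orbit_module_simps(3) by (rule restrict_ext) (rule R(10); use val u v in blast)
  show "u \<oplus>\<^bsub>?M\<^esub> v \<oplus>\<^bsub>?M\<^esub> w = u \<oplus>\<^bsub>?M\<^esub> (v \<oplus>\<^bsub>?M\<^esub> w)" if w: "w \<in> carrier ?M" for w
    unfolding orbit_module_simps(3)
  proof (rule restrict_ext)
    fix z assume z: "z \<in> orbit x"
    interpret ring "\<O> z" using orbit_ring[OF z] .
    show "(\<lambda>z\<in>orbit x. u z \<oplus>\<^bsub>\<O> z\<^esub> v z) z \<oplus>\<^bsub>\<O> z\<^esub> w z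
        = u z \<oplus>\<^bsub>\<O> z\<^esub> (\<lambda>z\<in>orbit x. v z \<oplus>\<^bsub>\<O> z\<^esub> w z) z"
      using val[OF u z] val[OF v z] val[OF w z] z by (simp add: a_assoc)
  qed
next
  let ?M = "orbit_module x"
  fix u assume u: "u \<in> carrier ?M"
  have ue: "u \<in> extensional (orbit x)" using u by (simp add: orbit_module_simps PiE_iff)
  show "\<zero>\<^bsub>?M\<^esub> \<oplus>\<^bsub>?M\<^esub> u = u"
  proof (rule extensionalityI[OF _ ue])
    fix z assume z: "z \<in> orbit x"
    interpret ring "\<O> z" using orbit_ring[OF z] .
    show "(\<zero>\<^bsub>?M\<^esub> \<oplus>\<^bsub>?M\<^esub> u) z = u z"
      using orbit_module_value[OF u z] z by (simp add: orbit_module_simps)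
  qed (simp add: orbit_module_simps)
  define w where "w = (\<lambda>z\<in>orbit x. \<ominus>\<^bsub>\<O> z\<^esub> u z)"
  have wz: "w z \<in> carrier (\<O> z)" "w z \<oplus>\<^bsub>\<O> z\<^esub> u z = \<zero>\<^bsub>\<O> z\<^esub>" "w z \<noteq> \<zero>\<^bsub>\<O> z\<^esub> \<Longrightarrow> u z \<noteq> \<zero>\<^bsub>\<O> z\<^esub>"
    if z: "z \<in> orbit x" for z
  proof -
    interpret ring "\<O> z" using orbit_ring[OF z] .
    show "w z \<in> carrier (\<O> z)" "w z \<oplus>\<^bsub>\<O> z\<^esub> u z = \<zero>\<^bsub>\<O> z\<^esub>" "w z \<noteq> \<zero>\<^bsub>\<O> z\<^esub> \<Longrightarrow> u z \<noteq> \<zero>\<^bsub>\<O> z\<^esub>"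
      using orbit_module_value[OF u z] z by (auto simp: w_def l_neg)
  qed
  have "{z \<in> orbit x. w z \<noteq> \<zero>\<^bsub>\<O> z\<^esub>} \<subseteq> {z \<in> orbit x. u z \<noteq> \<zero>\<^bsub>\<O> z\<^esub>}" using wz(3) by blast
  moreover have "finite {z \<in> orbit x. u z \<noteq> \<zero>\<^bsub>\<O> z\<^esub>}" using u by (simp add: orbit_module_simps)
  ultimately have "finite {z \<in> orbit x. w z \<noteq> \<zero>\<^bsub>\<O> z\<^esub>}" using finite_subset by blast
  then have "w \<in> carrier ?M" using wz(1) by (simp add: orbit_module_simps PiE_iff) (simp add: w_def)
  moreover have "w \<oplus>\<^bsub>?M\<^esub> u = \<zero>\<^bsub>?M\<^esub>"
    unfolding orbit_module_simps(2,3) using wz(2) by (rule restrict_ext)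
  ultimately show "\<exists>w\<in>carrier ?M. w \<oplus>\<^bsub>?M\<^esub> u = \<zero>\<^bsub>?M\<^esub>" by blast
qed

text \<open>Both sides are the sum of \<open>f \<beta> \<cdot> \<alpha>\<^sub>\<beta> (g \<rho>) \<cdot> \<alpha>\<^sub>\<beta>\<^sub>\<rho> (v (d \<rho>))\<close> over the finite set \<open>P\<close> of composable
  pairs in the supports of \<open>f\<close> and \<open>g\<close>, grouped by \<open>\<beta> \<rho>\<close> on the left and by \<open>\<beta>\<close> on the right.\<close>

lemma fibre_sum_convolution:
  assumes f: "f \<in> carrier \<Gamma>" and g: "g \<in> carrier \<Gamma>" and v: "v \<in> carrier (orbit_module x)"
    and z: "z \<in> orbit x"
  shows "fibre_sum (convolution G \<alpha> \<O> f g) v z = fibre_sum f (g \<odot>\<^bsub>orbit_module x\<^esub> v) z"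
proof -
  interpret ring "\<O> z" using orbit_ring[OF z] .
  define h where "h = convolution G \<alpha> \<O> f g"
  define B where "B = {\<beta> \<in> topspace (arrows G). rmap G \<beta> = z \<and> f \<beta> \<noteq> \<zero>\<^bsub>\<O> z\<^esub>}"
  define C where "C = (\<lambda>\<beta>. {\<rho> \<in> topspace (arrows G). rmap G \<rho> = dmap G \<beta> \<and> g \<rho> \<noteq> \<zero>\<^bsub>\<O> (dmap G \<beta>)\<^esub>})"
  define P where "P = Sigma B C"
  define m where "m = (\<lambda>(\<beta>, \<rho>). gmult G \<beta> \<rho>)"
  define T where "T = (\<lambda>(\<beta>, \<rho>). f \<beta> \<otimes>\<^bsub>\<O> z\<^esub> \<alpha> \<beta> (g \<rho>))"
  define S where "S = (\<lambda>q. T q \<otimes>\<^bsub>\<O> z\<^esub> \<alpha> (m q) (v (dmap G (m q))))"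
  have B: "\<beta> \<in> topspace (arrows G)" "rmap G \<beta> = z" "dmap G \<beta> \<in> orbit x" "f \<beta> \<in> carrier (\<O> z)"
    if "\<beta> \<in> B" for \<beta>
    using that z Gamma_c_value[OF f, of \<beta>] orbit_dmap[of \<beta> x] by (auto simp: B_def)
  have C: "\<rho> \<in> topspace (arrows G)" "rmap G \<rho> = dmap G \<beta>" "g \<rho> \<in> carrier (\<O> (dmap G \<beta>))"
    "dmap G \<rho> \<in> orbit x"
    if "\<beta> \<in> B" "\<rho> \<in> C \<beta>" for \<beta> \<rho>
    using that Gamma_c_value[OF g, of \<rho>] orbit_dmap[of \<rho> x] B(3)[of \<beta>] by (auto simp: C_def)
  have "B = {\<beta> \<in> topspace (arrows G). rmap G \<beta> = z \<and> f \<beta> \<noteq> \<zero>\<^bsub>\<O> (rmap G \<beta>)\<^esub>}"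
    by (auto simp: B_def)
  then have finB: "finite B" using finite_support_fibres(1)[OF f] by simp
  have "C \<beta> = {\<rho> \<in> topspace (arrows G). rmap G \<rho> = dmap G \<beta> \<and> g \<rho> \<noteq> \<zero>\<^bsub>\<O> (rmap G \<rho>)\<^esub>}" for \<beta>
    by (auto simp: C_def)
  then have finC: "finite (C \<beta>)" for \<beta> using finite_support_fibres(1)[OF g] by simp
  have finP: "finite P" unfolding P_def using finB finC by blast
  have m: "m q \<in> topspace (arrows G)" "dmap G (m q) = dmap G (snd q)" "rmap G (m q) = z"
    if "q \<in> P" for q
    using that B C gmult_closed dmap_gmult rmap_gmult by (auto simp: P_def m_def)
  have act_g: "\<alpha> \<beta> (g \<rho>) \<in> carrier (\<O> z)" if "\<beta> \<in> B" "\<rho> \<in> C \<beta>" for \<beta> \<rho>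
    using act_closed[OF B(1)[OF that(1)] C(3)[OF that]] B(2)[OF that(1)] by simp
  have T: "T q \<in> carrier (\<O> z)" if "q \<in> P" for q
    using that B act_g by (auto simp: P_def T_def)
  have act_v: "\<alpha> \<gamma> (v (dmap G \<gamma>)) \<in> carrier (\<O> z)"
    if "\<gamma> \<in> topspace (arrows G)" "rmap G \<gamma> = z" for \<gamma>
    using orbit_module_act_value[OF v that(1)] that(2) z by simp
  have S: "S q \<in> carrier (\<O> z)" if "q \<in> P" for q
    using T[OF that] act_v[OF m(1,3)[OF that]] by (simp add: S_def)
  have h: "h \<gamma> = finsum (\<O> z) T {q \<in> P. m q = \<gamma>}"
    if \<gamma>: "\<gamma> \<in> topspace (arrows G)" "rmap G \<gamma> = z" for \<gamma>
  proof -
    let ?Q = "{(\<beta>, \<rho>). \<beta> \<in> topspace (arrows G) \<and> \<rho> \<in> topspace (arrows G) \<and> dmap G \<beta> = rmap G \<rho>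
          \<and> gmult G \<beta> \<rho> = \<gamma> \<and> f \<beta> \<otimes>\<^bsub>\<O> z\<^esub> \<alpha> \<beta> (g \<rho>) \<noteq> \<zero>\<^bsub>\<O> z\<^esub>}"
    \<comment> \<open>The convolution keeps nonzero products, while \<open>P\<close> only asks that
      both factors be nonzero. In a ring such a product may vanish, so the inclusion can be strict;
      the extra terms are zero.\<close>
    have sub: "?Q \<subseteq> {q \<in> P. m q = \<gamma>}"
    proof clarify
      fix \<beta> \<rho>
      assume q: "\<beta> \<in> topspace (arrows G)" "\<rho> \<in> topspace (arrows G)" "dmap G \<beta> = rmap G \<rho>"
        and ne: "f \<beta> \<otimes>\<^bsub>\<O> z\<^esub> \<alpha> \<beta> (g \<rho>) \<noteq> \<zero>\<^bsub>\<O> z\<^esub>" and eq: "\<gamma> = gmult G \<beta> \<rho>"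
      have r: "rmap G \<beta> = z" using rmap_gmult[OF q] eq \<gamma>(2) by simp
      have "\<alpha> \<beta> (g \<rho>) \<in> carrier (\<O> z)"
        using act_closed[OF q(1)] Gamma_c_value[OF g q(2)] q(3) r by simp
      then have "f \<beta> \<noteq> \<zero>\<^bsub>\<O> z\<^esub>" using ne by auto
      moreover have "g \<rho> \<noteq> \<zero>\<^bsub>\<O> (dmap G \<beta>)\<^esub>"
      proof
        assume "g \<rho> = \<zero>\<^bsub>\<O> (dmap G \<beta>)\<^esub>"
        then have "\<alpha> \<beta> (g \<rho>) = \<zero>\<^bsub>\<O> z\<^esub>" using act_zero[OF q(1)] r by simp
        then show False using ne Gamma_c_value[OF f q(1)] r by simp
      qed
      ultimately show "(\<beta>, \<rho>) \<in> P \<and> m (\<beta>, \<rho>) = gmult G \<beta> \<rho>"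
        using q r by (auto simp: P_def B_def C_def m_def)
    qed
    have "h \<gamma> = finsum (\<O> z) T ?Q"
      using \<gamma> by (simp add: h_def convolution_def T_def)
    also have "\<dots> = finsum (\<O> z) T {q \<in> P. m q = \<gamma>}"
    proof (rule add.finprod_mono_neutral_cong_left)
      show "T q = \<zero>\<^bsub>\<O> z\<^esub>" if "q \<in> {q \<in> P. m q = \<gamma>} - ?Q" for q
        using that B(1) C(1,2) by (auto simp: P_def m_def T_def)
    qed (use finP sub T in auto)
    finally show ?thesis .
  qed
  have hc: "h \<gamma> \<in> carrier (\<O> z)" if "\<gamma> \<in> topspace (arrows G)" "rmap G \<gamma> = z" for \<gamma>
    unfolding h[OF that] using T by (intro finsum_closed) auto
  \<comment> \<open>Finiteness of the support of \<open>h\<close> in this fibre is read off from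
    \<open>P\<close>, not from membership of \<open>h\<close> in the ring: the support lies in the
    image of \<open>P\<close> under \<open>m\<close>, and the sum is enlarged to that image.\<close>
  have "fibre_sum h v z = finsum (\<O> z) (\<lambda>\<gamma>. h \<gamma> \<otimes>\<^bsub>\<O> z\<^esub> \<alpha> \<gamma> (v (dmap G \<gamma>))) (m ` P)"
    unfolding fibre_sum_def
  proof (rule add.finprod_mono_neutral_cong_left)
    show "{\<gamma> \<in> topspace (arrows G). rmap G \<gamma> = z \<and> h \<gamma> \<noteq> \<zero>\<^bsub>\<O> z\<^esub>} \<subseteq> m ` P"
    proof clarify
      fix \<gamma> assume \<gamma>: "\<gamma> \<in> topspace (arrows G)" "z = rmap G \<gamma>" "h \<gamma> \<noteq> \<zero>\<^bsub>\<O> (rmap G \<gamma>)\<^esub>"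
      have "{q \<in> P. m q = \<gamma>} \<noteq> {}"
      proof
        assume e: "{q \<in> P. m q = \<gamma>} = {}"
        then have "h \<gamma> = \<zero>\<^bsub>\<O> z\<^esub>" using h[OF \<gamma>(1) \<gamma>(2)[symmetric]] unfolding e by simp
        then show False using \<gamma> by simp
      qed
      then show "\<gamma> \<in> m ` P" by blast
    qed
    show "h \<gamma> \<otimes>\<^bsub>\<O> z\<^esub> \<alpha> \<gamma> (v (dmap G \<gamma>)) = \<zero>\<^bsub>\<O> z\<^esub>"
      if "\<gamma> \<in> m ` P - {\<gamma> \<in> topspace (arrows G). rmap G \<gamma> = z \<and> h \<gamma> \<noteq> \<zero>\<^bsub>\<O> z\<^esub>}" for \<gamma>
    proof -
      have "\<gamma> \<in> topspace (arrows G)" "rmap G \<gamma> = z" "h \<gamma> = \<zero>\<^bsub>\<O> z\<^esub>" using that m by auto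
      then show ?thesis using act_v by simp
    qed
    show "(\<lambda>\<gamma>. h \<gamma> \<otimes>\<^bsub>\<O> z\<^esub> \<alpha> \<gamma> (v (dmap G \<gamma>))) \<in> m ` P \<rightarrow> carrier (\<O> z)"
    proof
      fix \<gamma> assume "\<gamma> \<in> m ` P"
      then have "\<gamma> \<in> topspace (arrows G)" "rmap G \<gamma> = z" using m by auto
      then show "h \<gamma> \<otimes>\<^bsub>\<O> z\<^esub> \<alpha> \<gamma> (v (dmap G \<gamma>)) \<in> carrier (\<O> z)" using hc act_v by simp
    qed
  qed (use finP in auto)
  also have "\<dots> = finsum (\<O> z) (\<lambda>\<gamma>. finsum (\<O> z) S {q \<in> P. m q = \<gamma>}) (m ` P)"
  proof (rule add.finprod_cong')
    fix \<gamma> assume "\<gamma> \<in> m ` P"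
    then have \<gamma>: "\<gamma> \<in> topspace (arrows G)" "rmap G \<gamma> = z" using m by auto
    have "h \<gamma> \<otimes>\<^bsub>\<O> z\<^esub> \<alpha> \<gamma> (v (dmap G \<gamma>))
        = finsum (\<O> z) (\<lambda>q. T q \<otimes>\<^bsub>\<O> z\<^esub> \<alpha> \<gamma> (v (dmap G \<gamma>))) {q \<in> P. m q = \<gamma>}"
      unfolding h[OF \<gamma>] using finP T act_v[OF \<gamma>] by (intro finsum_ldistr) auto
    also have "\<dots> = finsum (\<O> z) S {q \<in> P. m q = \<gamma>}"
      using S by (intro add.finprod_cong') (auto simp: S_def)
    finally show "h \<gamma> \<otimes>\<^bsub>\<O> z\<^esub> \<alpha> \<gamma> (v (dmap G \<gamma>)) = finsum (\<O> z) S {q \<in> P. m q = \<gamma>}" .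
  qed (use S in \<open>auto intro!: finsum_closed\<close>)
  also have "\<dots> = finsum (\<O> z) S P"
    using finP S by (intro add.finprod_fibres[symmetric]) auto
  also have "\<dots> = finsum (\<O> z) (\<lambda>\<beta>. finsum (\<O> z) (\<lambda>\<rho>. S (\<beta>, \<rho>)) (C \<beta>)) B"
    unfolding P_def using finB finC S by (intro add.finprod_Sigma) (auto simp: P_def)
  also have "\<dots> = finsum (\<O> z) (\<lambda>\<beta>. f \<beta> \<otimes>\<^bsub>\<O> z\<^esub> \<alpha> \<beta> ((g \<odot>\<^bsub>orbit_module x\<^esub> v) (dmap G \<beta>))) B"
  proof (rule add.finprod_cong')
    show "(\<lambda>\<beta>. f \<beta> \<otimes>\<^bsub>\<O> z\<^esub> \<alpha> \<beta> ((g \<odot>\<^bsub>orbit_module x\<^esub> v) (dmap G \<beta>))) \<in> B \<rightarrow> carrier (\<O> z)"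
    proof
      fix \<beta> assume \<beta>: "\<beta> \<in> B"
      show "f \<beta> \<otimes>\<^bsub>\<O> z\<^esub> \<alpha> \<beta> ((g \<odot>\<^bsub>orbit_module x\<^esub> v) (dmap G \<beta>)) \<in> carrier (\<O> z)"
        using B[OF \<beta>] orbit_module_act_value[OF smult_closed[OF g v], of \<beta>] z by simp
    qed
    fix \<beta> assume \<beta>: "\<beta> \<in> B"
    interpret \<alpha>: ring_hom_ring "\<O> (dmap G \<beta>)" "\<O> z" "\<alpha> \<beta>"
      using act_ring_hom[OF B(1)[OF \<beta>]] B(2)[OF \<beta>] by simp
    let ?s = "\<lambda>\<rho>. g \<rho> \<otimes>\<^bsub>\<O> (dmap G \<beta>)\<^esub> \<alpha> \<rho> (v (dmap G \<rho>))"
    have vc: "\<alpha> \<rho> (v (dmap G \<rho>)) \<in> carrier (\<O> (dmap G \<beta>))" if "\<rho> \<in> C \<beta>" for \<rho>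
      using orbit_module_act_value[OF v C(1)[OF \<beta> that]] C(2)[OF \<beta> that] B(3)[OF \<beta>] by simp
    \<comment> \<open>Multiplicativity of the map of \<beta> splits off its value on
      \<open>g \<rho>\<close>, and \<open>act_mult\<close> merges the two remaining maps into that
      of the product arrow.\<close>
    have Sq: "f \<beta> \<otimes>\<^bsub>\<O> z\<^esub> \<alpha> \<beta> (?s \<rho>) = S (\<beta>, \<rho>)" if \<rho>: "\<rho> \<in> C \<beta>" for \<rho>
    proof -
      have "v (dmap G \<rho>) \<in> topspace E \<and> p (v (dmap G \<rho>)) = dmap G \<rho>"
        using stalk_memD orbit_units orbit_module_value[OF v] C(4)[OF \<beta> \<rho>] by blast
      then have "\<alpha> \<beta> (\<alpha> \<rho> (v (dmap G \<rho>))) = \<alpha> (gmult G \<beta> \<rho>) (v (dmap G \<rho>))"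
        using act_mult[OF B(1)[OF \<beta>] C(1)[OF \<beta> \<rho>], of "v (dmap G \<rho>)"] C(2)[OF \<beta> \<rho>] by simp
      moreover have "dmap G (gmult G \<beta> \<rho>) = dmap G \<rho>"
        using dmap_gmult B(1)[OF \<beta>] C(1,2)[OF \<beta> \<rho>] by simp
      ultimately show ?thesis
        using vc[OF \<rho>] C(3)[OF \<beta> \<rho>] B(4)[OF \<beta>] act_g[OF \<beta> \<rho>] \<alpha>.hom_closed[OF vc[OF \<rho>]]
        by (simp add: S_def T_def m_def m_assoc)
    qed
    have "(g \<odot>\<^bsub>orbit_module x\<^esub> v) (dmap G \<beta>) = finsum (\<O> (dmap G \<beta>)) ?s (C \<beta>)"
      using B(3)[OF \<beta>] by (simp add: orbit_module_simps fibre_sum_def C_def)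
    then have "\<alpha> \<beta> ((g \<odot>\<^bsub>orbit_module x\<^esub> v) (dmap G \<beta>)) = finsum (\<O> z) (\<lambda>\<rho>. \<alpha> \<beta> (?s \<rho>)) (C \<beta>)"
      using \<alpha>.hom_finsum[of ?s "C \<beta>"] vc C(3)[OF \<beta>] by (simp add: o_def)
    moreover have "f \<beta> \<otimes>\<^bsub>\<O> z\<^esub> finsum (\<O> z) (\<lambda>\<rho>. \<alpha> \<beta> (?s \<rho>)) (C \<beta>)
        = finsum (\<O> z) (\<lambda>\<rho>. f \<beta> \<otimes>\<^bsub>\<O> z\<^esub> \<alpha> \<beta> (?s \<rho>)) (C \<beta>)"
      using finC vc C(3)[OF \<beta>] B(4)[OF \<beta>] by (intro finsum_rdistr) auto
    moreover have "\<dots> = finsum (\<O> z) (\<lambda>\<rho>. S (\<beta>, \<rho>)) (C \<beta>)"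
      using Sq S \<beta> by (intro add.finprod_cong') (auto simp: P_def)
    ultimately show "finsum (\<O> z) (\<lambda>\<rho>. S (\<beta>, \<rho>)) (C \<beta>)
        = f \<beta> \<otimes>\<^bsub>\<O> z\<^esub> \<alpha> \<beta> ((g \<odot>\<^bsub>orbit_module x\<^esub> v) (dmap G \<beta>))" by simp
  qed simp
  also have "\<dots> = fibre_sum f (g \<odot>\<^bsub>orbit_module x\<^esub> v) z"
    by (simp add: fibre_sum_def B_def)
  finally show ?thesis by (simp add: h_def)
qed

lemma left_module_orbit_module: "left_module \<Gamma> (orbit_module x)"
proof (rule left_module.intro[OF abelian_group_orbit_module], unfold_locales)
  let ?M = "orbit_module x"
  show "f \<odot>\<^bsub>?M\<^esub> v \<in> carrier ?M" if "f \<in> carrier \<Gamma>" "v \<in> carrier ?M" for f v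
    using smult_closed that .
next
  let ?M = "orbit_module x"
  interpret M: abelian_group ?M by (rule abelian_group_orbit_module)
  fix f g v assume f: "f \<in> carrier \<Gamma>" and g: "g \<in> carrier \<Gamma>" and v: "v \<in> carrier ?M"
  have "fibre_sum (f \<oplus>\<^bsub>\<Gamma>\<^esub> g) v z = fibre_sum f v z \<oplus>\<^bsub>\<O> z\<^esub> fibre_sum g v z" if z: "z \<in> orbit x" for z
  proof -
    interpret ring "\<O> z" using orbit_ring[OF z] .
    \<comment> \<open>All three sums are taken over the union of the two supports, since the support
      of the sum may be smaller through cancellation.\<close>
    define A where "A = {\<gamma> \<in> topspace (arrows G). rmap G \<gamma> = z \<and> f \<gamma> \<noteq> \<zero>\<^bsub>\<O> (rmap G \<gamma>)\<^esub>}
      \<union> {\<gamma> \<in> topspace (arrows G). rmap G \<gamma> = z \<and> g \<gamma> \<noteq> \<zero>\<^bsub>\<O> (rmap G \<gamma>)\<^esub>}"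
    have finA: "finite A"
      unfolding A_def using finite_support_fibres(1)[OF f] finite_support_fibres(1)[OF g] by simp
    have A: "\<gamma> \<in> topspace (arrows G)" "rmap G \<gamma> = z" if "\<gamma> \<in> A" for \<gamma>
      using that by (auto simp: A_def)
    have c: "f \<gamma> \<in> carrier (\<O> z)" "g \<gamma> \<in> carrier (\<O> z)" "\<alpha> \<gamma> (v (dmap G \<gamma>)) \<in> carrier (\<O> z)"
      if "\<gamma> \<in> A" for \<gamma>
      using A[OF that] Gamma_c_value[OF f, of \<gamma>] Gamma_c_value[OF g, of \<gamma>]
        orbit_module_act_value[OF v, of \<gamma>] z by auto
    have f_sum: "fibre_sum f v z = finsum (\<O> z) (\<lambda>\<gamma>. f \<gamma> \<otimes>\<^bsub>\<O> z\<^esub> \<alpha> \<gamma> (v (dmap G \<gamma>))) A"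
      by (rule fibre_sum_eq[OF f v z finA]) (auto simp: A_def)
    have g_sum: "fibre_sum g v z = finsum (\<O> z) (\<lambda>\<gamma>. g \<gamma> \<otimes>\<^bsub>\<O> z\<^esub> \<alpha> \<gamma> (v (dmap G \<gamma>))) A"
      by (rule fibre_sum_eq[OF g v z finA]) (auto simp: A_def)
    have "fibre_sum (f \<oplus>\<^bsub>\<Gamma>\<^esub> g) v z
        = finsum (\<O> z) (\<lambda>\<gamma>. (f \<oplus>\<^bsub>\<Gamma>\<^esub> g) \<gamma> \<otimes>\<^bsub>\<O> z\<^esub> \<alpha> \<gamma> (v (dmap G \<gamma>))) A"
    proof (rule fibre_sum_eq[OF add_mem_Gamma_c[OF f g] v z finA])
      fix \<gamma> assume \<gamma>: "\<gamma> \<in> topspace (arrows G)" "rmap G \<gamma> = z"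
        and "(f \<oplus>\<^bsub>\<Gamma>\<^esub> g) \<gamma> \<noteq> \<zero>\<^bsub>\<O> z\<^esub>"
      moreover have "(f \<oplus>\<^bsub>\<Gamma>\<^esub> g) \<gamma> = \<zero>\<^bsub>\<O> z\<^esub>" if "f \<gamma> = \<zero>\<^bsub>\<O> z\<^esub>" "g \<gamma> = \<zero>\<^bsub>\<O> z\<^esub>"
        using that \<gamma> by (simp add: Gamma_c_simps)
      ultimately have "f \<gamma> \<noteq> \<zero>\<^bsub>\<O> z\<^esub> \<or> g \<gamma> \<noteq> \<zero>\<^bsub>\<O> z\<^esub>" by blast
      then show "\<gamma> \<in> A" using \<gamma> by (auto simp: A_def)
    qed (use A in blast)
    also have "\<dots> = finsum (\<O> z) (\<lambda>\<gamma>. f \<gamma> \<otimes>\<^bsub>\<O> z\<^esub> \<alpha> \<gamma> (v (dmap G \<gamma>))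
        \<oplus>\<^bsub>\<O> z\<^esub> g \<gamma> \<otimes>\<^bsub>\<O> z\<^esub> \<alpha> \<gamma> (v (dmap G \<gamma>))) A"
      using A c by (intro add.finprod_cong') (auto simp: Gamma_c_simps l_distr)
    finally show ?thesis
      using c unfolding f_sum g_sum by (simp add: finsum_addf Pi_def)
  qed
  then show "(f \<oplus>\<^bsub>\<Gamma>\<^esub> g) \<odot>\<^bsub>?M\<^esub> v = f \<odot>\<^bsub>?M\<^esub> v \<oplus>\<^bsub>?M\<^esub> g \<odot>\<^bsub>?M\<^esub> v"
    unfolding orbit_module_simps(3,4) by (intro restrict_ext) simp
  show "f \<otimes>\<^bsub>\<Gamma>\<^esub> g \<odot>\<^bsub>?M\<^esub> v = f \<odot>\<^bsub>?M\<^esub> (g \<odot>\<^bsub>?M\<^esub> v)"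
    using fibre_sum_convolution[OF f g v]
    by (subst (1 2) orbit_module_simps(4)) (auto simp: Gamma_c_simps(4) intro: restrict_ext)
next
  let ?M = "orbit_module x"
  interpret M: abelian_group ?M by (rule abelian_group_orbit_module)
  fix f v w assume f: "f \<in> carrier \<Gamma>" and v: "v \<in> carrier ?M" and w: "w \<in> carrier ?M"
  have "fibre_sum f (v \<oplus>\<^bsub>?M\<^esub> w) z = fibre_sum f v z \<oplus>\<^bsub>\<O> z\<^esub> fibre_sum f w z" if z: "z \<in> orbit x" for z
  proof -
    interpret ring "\<O> z" using orbit_ring[OF z] .
    define A where "A = {\<gamma> \<in> topspace (arrows G). rmap G \<gamma> = z \<and> f \<gamma> \<noteq> \<zero>\<^bsub>\<O> z\<^esub>}"
    have A: "\<gamma> \<in> topspace (arrows G)" "rmap G \<gamma> = z" if "\<gamma> \<in> A" for \<gamma>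
      using that by (auto simp: A_def)
    have c: "f \<gamma> \<in> carrier (\<O> z)" "\<alpha> \<gamma> (v (dmap G \<gamma>)) \<in> carrier (\<O> z)"
      "\<alpha> \<gamma> (w (dmap G \<gamma>)) \<in> carrier (\<O> z)" if "\<gamma> \<in> A" for \<gamma>
      using A[OF that] Gamma_c_value[OF f, of \<gamma>] orbit_module_act_value[OF v, of \<gamma>]
        orbit_module_act_value[OF w, of \<gamma>] z by auto
    have vw: "\<alpha> \<gamma> ((v \<oplus>\<^bsub>?M\<^esub> w) (dmap G \<gamma>)) = \<alpha> \<gamma> (v (dmap G \<gamma>)) \<oplus>\<^bsub>\<O> z\<^esub> \<alpha> \<gamma> (w (dmap G \<gamma>))"
      if "\<gamma> \<in> A" for \<gamma>
    proof -
      have d: "dmap G \<gamma> \<in> orbit x" using A[OF that] orbit_dmap z by auto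
      show ?thesis
        using ring_hom_add[OF act_hom[OF A(1)[OF that]]] A(2)[OF that] d
          orbit_module_value[OF v d] orbit_module_value[OF w d]
        by (simp add: orbit_module_simps(3))
    qed
    have "fibre_sum f (v \<oplus>\<^bsub>?M\<^esub> w) z
        = finsum (\<O> z) (\<lambda>\<gamma>. f \<gamma> \<otimes>\<^bsub>\<O> z\<^esub> \<alpha> \<gamma> ((v \<oplus>\<^bsub>?M\<^esub> w) (dmap G \<gamma>))) A"
      by (simp add: fibre_sum_def A_def)
    also have "\<dots> = finsum (\<O> z) (\<lambda>\<gamma>. f \<gamma> \<otimes>\<^bsub>\<O> z\<^esub> \<alpha> \<gamma> (v (dmap G \<gamma>))
        \<oplus>\<^bsub>\<O> z\<^esub> f \<gamma> \<otimes>\<^bsub>\<O> z\<^esub> \<alpha> \<gamma> (w (dmap G \<gamma>))) A"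
      using c vw by (intro add.finprod_cong') (auto simp: r_distr)
    also have "\<dots> = fibre_sum f v z \<oplus>\<^bsub>\<O> z\<^esub> fibre_sum f w z"
      using c by (simp add: fibre_sum_def finsum_addf Pi_def flip: A_def)
    finally show ?thesis .
  qed
  then show "f \<odot>\<^bsub>?M\<^esub> (v \<oplus>\<^bsub>?M\<^esub> w) = f \<odot>\<^bsub>?M\<^esub> v \<oplus>\<^bsub>?M\<^esub> f \<odot>\<^bsub>?M\<^esub> w"
    by (simp add: orbit_module_simps(4) orbit_module_simps(3)[of x "\<lambda>z\<in>orbit x. _ z"] cong: restrict_cong)
qed

end

section \<open>Simplicity of the orbit modules and the Jacobson radical\<close>

locale ample_sheaf_of_fields = hausdorff_ample_groupoid G + sheaf_of_fields G E p \<alpha> \<O>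
  for G :: "('g, 'x) groupoid" and E :: "'e topology" and p :: "'e \<Rightarrow> 'x"
    and \<alpha> :: "'g \<Rightarrow> 'e \<Rightarrow> 'e" and \<O> :: "'x \<Rightarrow> 'e ring"
begin

sublocale ample_sheaf_of_rings G E p \<alpha> \<O> ..

lemma orbit_field: "z \<in> orbit x \<Longrightarrow> field (\<O> z)"
  using stalk_field orbit_units by blast

text \<open>A unital homomorphism maps an inverse of \<open>a\<close> to an inverse of the image of
  \<open>a\<close>, and 1 is not 0 in the target field.\<close>

lemma act_nonzero:
  assumes \<gamma>: "\<gamma> \<in> topspace (arrows G)"
    and a: "a \<in> carrier (\<O> (dmap G \<gamma>))" "a \<noteq> \<zero>\<^bsub>\<O> (dmap G \<gamma>)\<^esub>"
  shows "\<alpha> \<gamma> a \<noteq> \<zero>\<^bsub>\<O> (rmap G \<gamma>)\<^esub>"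
proof
  assume eq: "\<alpha> \<gamma> a = \<zero>\<^bsub>\<O> (rmap G \<gamma>)\<^esub>"
  interpret A: field "\<O> (dmap G \<gamma>)" using stalk_field[OF dmap_closed[OF \<gamma>]] .
  interpret B: field "\<O> (rmap G \<gamma>)" using stalk_field[OF rmap_closed[OF \<gamma>]] .
  interpret \<alpha>: ring_hom_ring "\<O> (dmap G \<gamma>)" "\<O> (rmap G \<gamma>)" "\<alpha> \<gamma>" using act_ring_hom[OF \<gamma>] .
  have "a \<in> Units (\<O> (dmap G \<gamma>))" using a by (simp add: A.field_Units)
  then have "a \<otimes>\<^bsub>\<O> (dmap G \<gamma>)\<^esub> inv\<^bsub>\<O> (dmap G \<gamma>)\<^esub> a = \<one>\<^bsub>\<O> (dmap G \<gamma>)\<^esub>"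
    and "inv\<^bsub>\<O> (dmap G \<gamma>)\<^esub> a \<in> carrier (\<O> (dmap G \<gamma>))" by simp_all
  then have "\<alpha> \<gamma> a \<otimes>\<^bsub>\<O> (rmap G \<gamma>)\<^esub> \<alpha> \<gamma> (inv\<^bsub>\<O> (dmap G \<gamma>)\<^esub> a) = \<one>\<^bsub>\<O> (rmap G \<gamma>)\<^esub>"
    and "\<alpha> \<gamma> (inv\<^bsub>\<O> (dmap G \<gamma>)\<^esub> a) \<in> carrier (\<O> (rmap G \<gamma>))"
    using a(1) by (simp_all flip: \<alpha>.hom_mult)
  then show False using eq by simp
qed

definition single :: "'x \<Rightarrow> 'x \<Rightarrow> 'e \<Rightarrow> 'x \<Rightarrow> 'e" where
  "single x y a = (\<lambda>z\<in>orbit x. if z = y then a else \<zero>\<^bsub>\<O> z\<^esub>)"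

lemma single_closed:
  assumes "y \<in> orbit x" "a \<in> carrier (\<O> y)"
  shows "single x y a \<in> carrier (orbit_module x)"
proof -
  have "{z \<in> orbit x. single x y a z \<noteq> \<zero>\<^bsub>\<O> z\<^esub>} \<subseteq> {y}" by (auto simp: single_def)
  then have "finite {z \<in> orbit x. single x y a z \<noteq> \<zero>\<^bsub>\<O> z\<^esub>}" using finite_subset by blast
  moreover have "single x y a z \<in> carrier (\<O> z)" if "z \<in> orbit x" for z
    using ring.ring_simprules(2)[OF orbit_ring[OF that]] assms that by (auto simp: single_def)
  ultimately show ?thesis by (simp add: orbit_module_simps(1) PiE_iff) (simp add: single_def)
qed

text \<open>A section concentrated on a small bisection around an arrow from \<open>y\<close> to \<open>z\<close> whose domain meets
  the support of \<open>v\<close> in \<open>y\<close> only.\<close>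

lemma single_attained:
  assumes v: "v \<in> carrier (orbit_module x)" and y: "y \<in> orbit x" "v y \<noteq> \<zero>\<^bsub>\<O> y\<^esub>"
    and z: "z \<in> orbit x" and a: "a \<in> carrier (\<O> z)"
  shows "\<exists>s\<in>carrier \<Gamma>. s \<odot>\<^bsub>orbit_module x\<^esub> v = single x z a"
proof -
  obtain \<gamma> where \<gamma>: "\<gamma> \<in> topspace (arrows G)" "dmap G \<gamma> = y" "rmap G \<gamma> = z"
    using orbit_transitive[OF y(1) z] .
  interpret field "\<O> z" using orbit_field[OF z] .
  define b where "b = \<alpha> \<gamma> (v y)"
  have vy: "v y \<in> carrier (\<O> (dmap G \<gamma>))" using orbit_module_value[OF v y(1)] \<gamma>(2) by simp
  have "b \<in> carrier (\<O> z)" "b \<noteq> \<zero>\<^bsub>\<O> z\<^esub>"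
    using act_closed[OF \<gamma>(1) vy] act_nonzero[OF \<gamma>(1) vy] y(2) \<gamma> by (auto simp: b_def)
  then have b: "b \<in> Units (\<O> z)" "b \<in> carrier (\<O> z)" by (auto simp: field_Units)
  \<comment> \<open>Chosen so that the surviving term, \<open>c\<close> times the transported entry
    \<open>b\<close> of \<open>v\<close>, equals \<open>a\<close>.\<close>
  define c where "c = a \<otimes>\<^bsub>\<O> z\<^esub> inv\<^bsub>\<O> z\<^esub> b"
  have c: "c \<in> carrier (\<O> (rmap G \<gamma>))" "c \<otimes>\<^bsub>\<O> z\<^esub> b = a"
    using a b \<gamma>(3) by (auto simp: c_def m_assoc)
  \<comment> \<open>The points of the support of \<open>v\<close> to be kept out of the source of
    the section. Being finite, \<open>S\<close> is closed in the Hausdorff unit space, so the arrows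
    starting outside it form an open set.\<close>
  define S where "S = {w \<in> orbit x. v w \<noteq> \<zero>\<^bsub>\<O> w\<^esub>} - {y}"
  define N where "N = {\<beta> \<in> topspace (arrows G). dmap G \<beta> \<in> topspace (units G) - S}"
  have "finite S" "S \<subseteq> topspace (units G)"
    using v orbit_units by (auto simp: S_def orbit_module_simps(1))
  then have "closedin (units G) S"
    using Hausdorff_units closedin_Hausdorff_finite by blast
  then have "openin (arrows G) N"
    unfolding N_def by (intro openin_continuous_map_preimage[OF continuous_map_dmap]) blast
  moreover have "\<gamma> \<in> N" using \<gamma> orbit_units[OF y(1)] by (auto simp: N_def S_def)
  ultimately obtain s U where s: "s \<in> carrier \<Gamma>" "bisection G U" "\<gamma> \<in> U" "U \<subseteq> N" "s \<gamma> = c"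
    "\<And>\<beta>. \<beta> \<in> topspace (arrows G) - U \<Longrightarrow> s \<beta> = \<zero>\<^bsub>\<O> (rmap G \<beta>)\<^esub>"
    using elementary_section_through c(1) by blast
  have only: "\<beta> = \<gamma>" if \<beta>: "\<beta> \<in> topspace (arrows G)" "rmap G \<beta> \<in> orbit x"
    "s \<beta> \<noteq> \<zero>\<^bsub>\<O> (rmap G \<beta>)\<^esub>" "v (dmap G \<beta>) \<noteq> \<zero>\<^bsub>\<O> (dmap G \<beta>)\<^esub>" for \<beta>
  proof -
    have U: "\<beta> \<in> U" using s(6) \<beta> by blast
    then have "dmap G \<beta> \<notin> S" using s(4) by (auto simp: N_def)
    then have "dmap G \<beta> = y" using \<beta>(4) orbit_dmap[OF \<beta>(1,2)] by (simp add: S_def)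
    then have "dmap G \<beta> = dmap G \<gamma>" using \<gamma>(2) by simp
    moreover have "inj_on (dmap G) U" using s(2) by (simp add: bisection_def)
    ultimately show ?thesis using U s(3) by (meson inj_onD)
  qed
  have "fibre_sum s v w = (if w = z then a else \<zero>\<^bsub>\<O> w\<^esub>)" if w: "w \<in> orbit x" for w
  proof (cases "w = z")
    case True
    have "fibre_sum s v z = finsum (\<O> z) (\<lambda>\<gamma>. s \<gamma> \<otimes>\<^bsub>\<O> z\<^esub> \<alpha> \<gamma> (v (dmap G \<gamma>))) {\<gamma>}"
    proof (rule fibre_sum_eq[OF s(1) v z])
      fix \<beta> assume "\<beta> \<in> topspace (arrows G)" "rmap G \<beta> = z" "s \<beta> \<noteq> \<zero>\<^bsub>\<O> z\<^esub>"
        "v (dmap G \<beta>) \<noteq> \<zero>\<^bsub>\<O> (dmap G \<beta>)\<^esub>"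
      then show "\<beta> \<in> {\<gamma>}" using only[of \<beta>] z by simp
    qed (use \<gamma> in auto)
    also have "\<dots> = a" using c(2) s(5) \<gamma> a by (simp add: b_def)
    finally show ?thesis using True by simp
  next
    case False
    interpret W: field "\<O> w" using orbit_field[OF w] .
    have "fibre_sum s v w = finsum (\<O> w) (\<lambda>\<gamma>. s \<gamma> \<otimes>\<^bsub>\<O> w\<^esub> \<alpha> \<gamma> (v (dmap G \<gamma>))) {}"
    proof (rule fibre_sum_eq[OF s(1) v w])
      fix \<beta> assume "\<beta> \<in> topspace (arrows G)" "rmap G \<beta> = w" "s \<beta> \<noteq> \<zero>\<^bsub>\<O> w\<^esub>"
        "v (dmap G \<beta>) \<noteq> \<zero>\<^bsub>\<O> (dmap G \<beta>)\<^esub>"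
      then show "\<beta> \<in> {}" using only[of \<beta>] w \<gamma>(3) False by simp
    qed auto
    then show ?thesis using False by simp
  qed
  then have "s \<odot>\<^bsub>orbit_module x\<^esub> v = single x z a"
    unfolding orbit_module_simps(4) single_def by (rule restrict_ext)
  then show ?thesis using s(1) by blast
qed

text \<open>One nonzero entry of \<open>v\<close> already reaches every vector concentrated at one
  point; adding these up over the support of \<open>w\<close> gives \<open>w\<close>. The induction
  runs over a finite set containing the support, so that a point where \<open>w\<close> vanishes or
  which lies off the orbit does no harm.\<close>

lemma orbit_module_cyclic:
  assumes v: "v \<in> carrier (orbit_module x)" "v \<noteq> \<zero>\<^bsub>orbit_module x\<^esub>"
    and w: "w \<in> carrier (orbit_module x)"
  shows "\<exists>s\<in>carrier \<Gamma>. s \<odot>\<^bsub>orbit_module x\<^esub> v = w"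
proof -
  interpret M: left_module \<Gamma> "orbit_module x" by (rule left_module_orbit_module)
  have ext: "v \<in> extensional (orbit x)" using v(1) by (simp add: orbit_module_simps(1) PiE_iff)
  have "\<exists>y\<in>orbit x. v y \<noteq> \<zero>\<^bsub>\<O> y\<^esub>"
  proof (rule ccontr)
    assume "\<not> (\<exists>y\<in>orbit x. v y \<noteq> \<zero>\<^bsub>\<O> y\<^esub>)"
    then have "v = \<zero>\<^bsub>orbit_module x\<^esub>"
      unfolding orbit_module_simps(2) by (intro extensionalityI[OF ext restrict_extensional]) simp
    then show False using v(2) by contradiction
  qed
  then obtain y where y: "y \<in> orbit x" "v y \<noteq> \<zero>\<^bsub>\<O> y\<^esub>" by blast
  have "\<exists>s\<in>carrier \<Gamma>. s \<odot>\<^bsub>orbit_module x\<^esub> v = w"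
    if "finite F" "w \<in> carrier (orbit_module x)" "{z \<in> orbit x. w z \<noteq> \<zero>\<^bsub>\<O> z\<^esub>} \<subseteq> F" for F w
    using that
  proof (induction F arbitrary: w rule: finite_induct)
    case empty
    then have "w z = \<zero>\<^bsub>\<O> z\<^esub>" if "z \<in> orbit x" for z using that by blast
    moreover have "w \<in> extensional (orbit x)" using empty.prems(1) by (simp add: orbit_module_simps(1) PiE_iff)
    moreover have "single x y \<zero>\<^bsub>\<O> y\<^esub> z = \<zero>\<^bsub>\<O> z\<^esub>" if "z \<in> orbit x" for z
      using that by (simp add: single_def)
    \<comment> \<open>The zero vector is the concentrated vector with entry zero, so
      \<open>single_attained\<close> covers it too.\<close>
    ultimately have "w = single x y \<zero>\<^bsub>\<O> y\<^esub>"
      by (intro extensionalityI[of w "orbit x"]) (auto simp: single_def)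
    then show ?case
      using single_attained[OF v(1) y y(1)] ring.ring_simprules(2)[OF orbit_ring[OF y(1)]] by simp
  next
    case (insert z F)
    show ?case
    proof (cases "z \<in> orbit x")
      case False
      then show ?thesis using insert by blast
    next
      case True
      interpret ring "\<O> z" using orbit_ring[OF True] .
      have wz: "w z \<in> carrier (\<O> z)" using orbit_module_value[OF insert.prems(1) True] .
      define u where "u = (\<lambda>t\<in>orbit x. if t = z then \<zero>\<^bsub>\<O> t\<^esub> else w t)"
      have supp: "{t \<in> orbit x. u t \<noteq> \<zero>\<^bsub>\<O> t\<^esub>} \<subseteq> F" using insert.prems(2) by (auto simp: u_def)
      then have "finite {t \<in> orbit x. u t \<noteq> \<zero>\<^bsub>\<O> t\<^esub>}" using insert.hyps(1) finite_subset by blast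
      moreover have "u t \<in> carrier (\<O> t)" if "t \<in> orbit x" for t
        using orbit_module_value[OF insert.prems(1) that] that by (auto simp: u_def)
      ultimately have u: "u \<in> carrier (orbit_module x)"
        by (simp add: orbit_module_simps(1) PiE_iff) (simp add: u_def)
      obtain s1 where s1: "s1 \<in> carrier \<Gamma>" "s1 \<odot>\<^bsub>orbit_module x\<^esub> v = u"
        using insert.IH[OF u supp] by blast
      obtain s2 where s2: "s2 \<in> carrier \<Gamma>" "s2 \<odot>\<^bsub>orbit_module x\<^esub> v = single x z (w z)"
        using single_attained[OF v(1) y True wz] by blast
      have "u \<oplus>\<^bsub>orbit_module x\<^esub> single x z (w z) = w"
      proof (rule extensionalityI)
        show "w \<in> extensional (orbit x)"
          using insert.prems(1) by (simp add: orbit_module_simps(1) PiE_iff)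
        show "u \<oplus>\<^bsub>orbit_module x\<^esub> single x z (w z) \<in> extensional (orbit x)"
          unfolding orbit_module_simps(3) by (rule restrict_extensional)
        fix t assume t: "t \<in> orbit x"
        interpret T: ring "\<O> t" using orbit_ring[OF t] .
        show "(u \<oplus>\<^bsub>orbit_module x\<^esub> single x z (w z)) t = w t"
          using t wz orbit_module_value[OF insert.prems(1) t]
          by (auto simp: orbit_module_simps(3) u_def single_def)
      qed
      then have "(s1 \<oplus>\<^bsub>\<Gamma>\<^esub> s2) \<odot>\<^bsub>orbit_module x\<^esub> v = w"
        using M.act_l_distr[OF s1(1) s2(1) v(1)] s1(2) s2(2) by simp
      then show ?thesis using add_mem_Gamma_c s1(1) s2(1) by blast
    qed
  qed
  moreover have "finite {z \<in> orbit x. w z \<noteq> \<zero>\<^bsub>\<O> z\<^esub>}" using w by (simp add: orbit_module_simps(1))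
  ultimately show ?thesis using w by blast
qed

lemma single_one_nonzero:
  assumes "y \<in> orbit x" shows "single x y \<one>\<^bsub>\<O> y\<^esub> \<noteq> \<zero>\<^bsub>orbit_module x\<^esub>"
proof
  interpret field "\<O> y" using orbit_field[OF assms] .
  assume "single x y \<one>\<^bsub>\<O> y\<^esub> = \<zero>\<^bsub>orbit_module x\<^esub>"
  then have "single x y \<one>\<^bsub>\<O> y\<^esub> y = \<zero>\<^bsub>orbit_module x\<^esub> y" by simp
  then show False using assms by (simp add: single_def orbit_module_simps(2))
qed

lemma single_one_closed: "y \<in> orbit x \<Longrightarrow> single x y \<one>\<^bsub>\<O> y\<^esub> \<in> carrier (orbit_module x)"
  using single_closed ring.ring_simprules(6)[OF orbit_ring] by blast

text \<open>The premise makes the orbit nonempty and hence the module nonzero. Cyclicity from every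
  nonzero vector then gives both requirements: some ring element fixes the unit vector at
  \<open>y\<close>, so the action is not zero, and a nonzero submodule is everything.\<close>

lemma simple_orbit_module:
  assumes y: "y \<in> orbit x"
  shows "simple_left_module \<Gamma> (orbit_module x)"
  unfolding simple_left_module_def
proof (intro conjI allI impI)
  let ?M = "orbit_module x"
  show "left_module \<Gamma> ?M" by (rule left_module_orbit_module)
  show "\<exists>r\<in>carrier \<Gamma>. \<exists>m\<in>carrier ?M. r \<odot>\<^bsub>?M\<^esub> m \<noteq> \<zero>\<^bsub>?M\<^esub>"
    using orbit_module_cyclic[OF single_one_closed single_one_nonzero single_one_closed, OF y y y]
      single_one_nonzero[OF y] single_one_closed[OF y] by metis
  fix N assume "submodule N \<Gamma> ?M"
  then interpret N: submodule N \<Gamma> ?M .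
  have "N = carrier ?M" if ne: "N \<noteq> {\<zero>\<^bsub>?M\<^esub>}"
  proof -
    have "\<zero>\<^bsub>?M\<^esub> \<in> N" using N.one_closed by simp
    then obtain v where v: "v \<in> N" "v \<noteq> \<zero>\<^bsub>?M\<^esub>" using ne by blast
    have sub: "N \<subseteq> carrier ?M" using N.subset by simp
    have "w \<in> N" if "w \<in> carrier ?M" for w
    proof -
      have "v \<in> carrier ?M" using v(1) sub by blast
      from orbit_module_cyclic[OF this v(2) that]
      obtain s where s: "s \<in> carrier \<Gamma>" "s \<odot>\<^bsub>?M\<^esub> v = w" by (elim bexE)
      show ?thesis using N.smult_closed[OF s(1) v(1)] s(2) by simp
    qed
    then show ?thesis using sub by blast
  qed
  then show "N = {\<zero>\<^bsub>?M\<^esub>} \<or> N = carrier ?M" by blast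
qed

text \<open>The value of \<open>f\<close> at \<open>\<gamma>\<close> is the entry of \<open>f \<cdot> \<delta>\<close> at \<open>r \<gamma>\<close>, for \<open>\<delta>\<close> the unit vector at \<open>d \<gamma>\<close>, as soon
  as no other arrow in the support of \<open>f\<close> is parallel to \<open>\<gamma>\<close>.\<close>

lemma jacobson_radical_vanishes:
  assumes f: "f \<in> jacobson_radical \<Gamma>" and \<gamma>: "\<gamma> \<in> topspace (arrows G)"
    and only: "\<And>\<beta>. \<lbrakk>\<beta> \<in> topspace (arrows G); dmap G \<beta> = dmap G \<gamma>; rmap G \<beta> = rmap G \<gamma>;
      f \<beta> \<noteq> \<zero>\<^bsub>\<O> (rmap G \<gamma>)\<^esub>\<rbrakk> \<Longrightarrow> \<beta> = \<gamma>"
  shows "f \<gamma> = \<zero>\<^bsub>\<O> (rmap G \<gamma>)\<^esub>"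
proof -
  define x where "x = dmap G \<gamma>"
  define z where "z = rmap G \<gamma>"
  let ?M = "orbit_module x" and ?\<delta> = "single x x \<one>\<^bsub>\<O> x\<^esub>"
  have x: "x \<in> orbit x" using orbit_self[OF \<gamma>] by (simp add: x_def)
  have z: "z \<in> orbit x" using orbit_rmap[OF \<gamma>] x by (simp add: x_def z_def)
  interpret field "\<O> z" using orbit_field[OF z] .
  note \<delta> = single_one_closed[OF x] single_one_nonzero[OF x]
  have fc: "f \<in> carrier \<Gamma>" using f by (simp add: jacobson_radical_def)
  have fz: "f \<gamma> \<in> carrier (\<O> z)" using Gamma_c_value[OF fc \<gamma>] by (simp add: z_def)
  \<comment> \<open>The radical is tested on modules whose elements are sets of sections; the
    transfer to the orbit module uses that the unit vector generates it.\<close>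
  have "f \<odot>\<^bsub>?M\<^esub> ?\<delta> = \<zero>\<^bsub>?M\<^esub>"
    by (rule jacobson_radical_annihilates_cyclic[OF f simple_orbit_module[OF x] orbit_module_cyclic[OF \<delta>] \<delta>(1)])
  then have "(f \<odot>\<^bsub>?M\<^esub> ?\<delta>) z = \<zero>\<^bsub>?M\<^esub> z" by simp
  then have "\<zero>\<^bsub>\<O> z\<^esub> = fibre_sum f ?\<delta> z"
    using z by (simp add: orbit_module_simps(2,4))
  also have "\<dots> = finsum (\<O> z) (\<lambda>\<gamma>. f \<gamma> \<otimes>\<^bsub>\<O> z\<^esub> \<alpha> \<gamma> (?\<delta> (dmap G \<gamma>))) {\<gamma>}"
  proof (rule fibre_sum_eq[OF fc \<delta>(1) z])
    fix \<beta> assume \<beta>: "\<beta> \<in> topspace (arrows G)" "rmap G \<beta> = z" "f \<beta> \<noteq> \<zero>\<^bsub>\<O> z\<^esub>"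
      and ne: "?\<delta> (dmap G \<beta>) \<noteq> \<zero>\<^bsub>\<O> (dmap G \<beta>)\<^esub>"
    have "dmap G \<beta> \<in> orbit x" using orbit_dmap \<beta>(1,2) z by simp
    then have "dmap G \<beta> = x" using ne by (simp add: single_def split: if_splits)
    then show "\<beta> \<in> {\<gamma>}" using only \<beta> by (simp add: x_def z_def)
  qed (use \<gamma> z_def in auto)
  also have "\<dots> = f \<gamma>"
  proof -
    have "?\<delta> (dmap G \<gamma>) = \<one>\<^bsub>\<O> (dmap G \<gamma>)\<^esub>" using x by (simp add: single_def flip: x_def)
    moreover have "\<alpha> \<gamma> \<one>\<^bsub>\<O> (dmap G \<gamma>)\<^esub> = \<one>\<^bsub>\<O> z\<^esub>"
      using ring_hom_one[OF act_hom[OF \<gamma>]] by (simp add: z_def)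
    ultimately show ?thesis using fz by simp
  qed
  finally show ?thesis by (simp add: z_def)
qed

text \<open>Needed because \<open>semiprimitive\<close> is an equality of sets: 0 + 0 = 0 in
  \<Gamma> forces zero to act as zero on every module.\<close>

lemma zero_mem_jacobson_radical: "\<zero>\<^bsub>\<Gamma>\<^esub> \<in> jacobson_radical \<Gamma>"
  unfolding jacobson_radical_def
proof (intro CollectI conjI allI impI ballI)
  fix M :: "('g \<Rightarrow> 'e, ('g \<Rightarrow> 'e) set) module" and m
  assume "simple_left_module \<Gamma> M" and m: "m \<in> carrier M"
  then interpret left_module \<Gamma> M by (simp add: simple_left_module_def)
  have "\<zero>\<^bsub>\<O> (rmap G \<gamma>)\<^esub> \<oplus>\<^bsub>\<O> (rmap G \<gamma>)\<^esub> \<zero>\<^bsub>\<O> (rmap G \<gamma>)\<^esub> = \<zero>\<^bsub>\<O> (rmap G \<gamma>)\<^esub>"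
    if "\<gamma> \<in> topspace (arrows G)" for \<gamma>
  proof -
    interpret ring "\<O> (rmap G \<gamma>)" using stalk_ring[OF rmap_closed[OF that]] .
    show ?thesis by simp
  qed
  then have "\<zero>\<^bsub>\<Gamma>\<^esub> \<oplus>\<^bsub>\<Gamma>\<^esub> \<zero>\<^bsub>\<Gamma>\<^esub> = \<zero>\<^bsub>\<Gamma>\<^esub>"
    unfolding Gamma_c_simps(2,3) by (intro restrict_ext) simp
  then have "\<zero>\<^bsub>\<Gamma>\<^esub> \<odot>\<^bsub>M\<^esub> m \<oplus>\<^bsub>M\<^esub> \<zero>\<^bsub>\<Gamma>\<^esub> \<odot>\<^bsub>M\<^esub> m = \<zero>\<^bsub>\<Gamma>\<^esub> \<odot>\<^bsub>M\<^esub> m"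
    using act_l_distr[OF zero_mem_Gamma_c zero_mem_Gamma_c m] by simp
  then show "\<zero>\<^bsub>\<Gamma>\<^esub> \<odot>\<^bsub>M\<^esub> m = \<zero>\<^bsub>M\<^esub>"
    using left_module.act_closed[OF left_module_axioms zero_mem_Gamma_c m] by simp
qed (rule zero_mem_Gamma_c)

end

section \<open>The groupoid of germs\<close>

context inverse_semigroup_action
begin

abbreviation "\<G> \<equiv> germ_groupoid X D \<theta>"

lemma topspace_germs: "topspace (arrows \<G>) = {germ D s x | s x. x \<in> D (star s)}"
proof -
  have "topspace (arrows \<G>) = \<Union>{germ D s ` U | s U. openin X U \<and> U \<subseteq> D (star s)}"
    by (simp add: germ_groupoid_def)
  also have "\<dots> = {germ D s x | s x. x \<in> D (star s)}" using open_D by blast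
  finally show ?thesis .
qed

lemma germ_arrow: "x \<in> D (star s) \<Longrightarrow> germ D s x \<in> topspace (arrows \<G>)"
  unfolding topspace_germs by blast

lemma germ_arrowE:
  assumes "\<gamma> \<in> topspace (arrows \<G>)"
  obtains s x where "x \<in> D (star s)" "\<gamma> = germ D s x"
  using assms unfolding topspace_germs by blast

lemma openin_germs: "\<lbrakk>openin X U; U \<subseteq> D (star s)\<rbrakk> \<Longrightarrow> openin (arrows \<G>) (germ D s ` U)"
  unfolding germ_groupoid_def by (auto intro: topology_generated_by_Basis)

lemma germ_eq_point: "\<lbrakk>x \<in> D (star s); y \<in> D (star t); germ D s x = germ D t y\<rbrakk> \<Longrightarrow> x = y"
  using dmap_germ by metis

lemma germ_eq_iff:
  assumes "x \<in> D (star s)" "x \<in> D (star t)"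
  shows "germ D s x = germ D t x \<longleftrightarrow> (\<exists>u. u \<preceq> s \<and> u \<preceq> t \<and> x \<in> D (star u))"
proof
  assume "germ D s x = germ D t x"
  then have "(t, x) \<in> germ D s x" using germ_self[OF assms(2)] by simp
  then show "\<exists>u. u \<preceq> s \<and> u \<preceq> t \<and> x \<in> D (star u)" unfolding germ_eq[OF assms(1)] by simp
next
  assume "\<exists>u. u \<preceq> s \<and> u \<preceq> t \<and> x \<in> D (star u)"
  then obtain u where "u \<preceq> s" "u \<preceq> t" "x \<in> D (star u)" by blast
  then show "germ D s x = germ D t x" by (rule germ_eqI)
qed

text \<open>Germs of \<open>s\<close> and \<open>t\<close> agree exactly on the union of the open
  domains of the common lower bounds of \<open>s\<close> and \<open>t\<close>. This is why the basic
  sets of germs intersect in open sets.\<close>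

lemma openin_germ_eq:
  "openin X {x \<in> D (star s) \<inter> D (star t). germ D s x = germ D t x}"
proof -
  have "x \<in> D (star s) \<and> x \<in> D (star t) \<and> germ D s x = germ D t x
      \<longleftrightarrow> (\<exists>u. u \<preceq> s \<and> u \<preceq> t \<and> x \<in> D (star u))" for x
    using germ_eq_iff[of x s t] nat_le_D(1)[of _ s x] nat_le_D(1)[of _ t x] by metis
  then have "{x \<in> D (star s) \<inter> D (star t). germ D s x = germ D t x}
      = (\<Union>u\<in>{u. u \<preceq> s \<and> u \<preceq> t}. D (star u))"
    by fastforce
  moreover have "openin X (\<Union>u\<in>{u. u \<preceq> s \<and> u \<preceq> t}. D (star u))" using open_D by blast
  ultimately show ?thesis by simp
qed

lemma openin_germ_vimage:
  assumes "openin (arrows \<G>) N"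
  shows "openin X {x \<in> D (star s). germ D s x \<in> N}"
proof -
  have "generate_topology_on {germ D s ` U | s U. openin X U \<and> U \<subseteq> D (star s)} N"
    using assms by (simp add: germ_groupoid_def openin_topology_generated_by)
  then show ?thesis
  proof (induction rule: generate_topology_on.induct)
    case Empty
    then show ?case by simp
  next
    case (Int a b)
    moreover have "{x \<in> D (star s). germ D s x \<in> a \<inter> b}
        = {x \<in> D (star s). germ D s x \<in> a} \<inter> {x \<in> D (star s). germ D s x \<in> b}" by blast
    ultimately show ?case by auto
  next
    case (UN K)
    have "{x \<in> D (star s). germ D s x \<in> \<Union>K} = (\<Union>k\<in>K. {x \<in> D (star s). germ D s x \<in> k})" by blast
    then show ?case using UN by auto
  next
    case (Basis B)
    then obtain t U where B: "B = germ D t ` U" "openin X U" "U \<subseteq> D (star t)" by blast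
    have "{x \<in> D (star s). germ D s x \<in> B}
        = U \<inter> {x \<in> D (star s) \<inter> D (star t). germ D s x = germ D t x}"
      using B(3) germ_eq_point unfolding B(1) by blast
    then show ?case using B(2) openin_germ_eq by auto
  qed
qed

text \<open>With \<open>openin_germ_vimage\<close> this identifies the topology of germs as the
  final topology for the maps \<open>germ D s\<close>, so openness of sets of arrows can be tested
  on \<open>X\<close>.\<close>

lemma openin_arrowsI:
  assumes "N \<subseteq> topspace (arrows \<G>)" "\<And>s. openin X {x \<in> D (star s). germ D s x \<in> N}"
  shows "openin (arrows \<G>) N"
proof -
  have "N = (\<Union>s. germ D s ` {x \<in> D (star s). germ D s x \<in> N})"
  proof
    show "N \<subseteq> (\<Union>s. germ D s ` {x \<in> D (star s). germ D s x \<in> N})"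
    proof
      fix \<gamma> assume \<gamma>: "\<gamma> \<in> N"
      then obtain s x where "x \<in> D (star s)" "\<gamma> = germ D s x"
        using assms(1) germ_arrowE by blast
      then show "\<gamma> \<in> (\<Union>s. germ D s ` {x \<in> D (star s). germ D s x \<in> N})" using \<gamma> by blast
    qed
  qed blast
  moreover have "openin (arrows \<G>) (germ D s ` {x \<in> D (star s). germ D s x \<in> N})" for s
    by (rule openin_germs[OF assms(2)]) blast
  then have "openin (arrows \<G>) (\<Union>s. germ D s ` {x \<in> D (star s). germ D s x \<in> N})"
    by blast
  ultimately show ?thesis by simp
qed

lemma continuous_map_theta: "continuous_map (subtopology X (D (star s))) X (\<theta> s)"
  using homeomorphic_imp_continuous_map[OF homeo[of s]] continuous_map_in_subtopology by blast

lemma openin_theta_vimage: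
  assumes "openin X U"
  shows "openin X {x \<in> D (star s). \<theta> s x \<in> U}"
proof -
  have "openin (subtopology X (D (star s))) {x \<in> topspace (subtopology X (D (star s))). \<theta> s x \<in> U}"
    using openin_continuous_map_preimage[OF continuous_map_theta assms] .
  moreover have "topspace (subtopology X (D (star s))) = D (star s)"
    using open_D[of "star s"] openin_subset by auto
  ultimately show ?thesis using open_D openin_trans_full by metis
qed

lemma inj_theta: "inj_on (\<theta> s) (D (star s))"
  using homeomorphic_imp_injective_map[OF homeo[of s]] openin_subset[OF open_D[of "star s"]]
  by (simp add: Int_absorb1)

text \<open>The product \<open>star s * s\<close> is idempotent and therefore acts as the identity
  on its domain.\<close>

lemma theta_star_theta:
  assumes "x \<in> D (star s)"
  shows "\<theta> (star s) (\<theta> s x) = x"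
proof -
  have sx: "\<theta> s x \<in> D (star (star s))" using theta_mem[OF assms] by (simp add: star_star)
  have "x \<in> D (star (star s * s))" using assms sx dom_mult by auto
  moreover have "star (star s * s) = star s * s" using idem_star_mult(1) by (rule star_idem)
  ultimately show ?thesis
    using map_mult[of x "star s" s] theta_idem[OF idem_star_mult(1), of x s] by simp
qed

lemma bisection_germs: "U \<subseteq> D (star s) \<Longrightarrow> bisection \<G> (germ D s ` U)"
  unfolding bisection_def
proof (intro conjI)
  assume U: "U \<subseteq> D (star s)"
  show "germ D s ` U \<subseteq> topspace (arrows \<G>)" using U germ_arrow by blast
  show "inj_on (dmap \<G>) (germ D s ` U)" using U by (intro inj_onI) (auto simp: dmap_germ subsetD)
  show "inj_on (rmap \<G>) (germ D s ` U)"
  proof (intro inj_onI, clarify)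
    fix x y assume xy: "x \<in> U" "y \<in> U" "rmap \<G> (germ D s x) = rmap \<G> (germ D s y)"
    then have "x \<in> D (star s)" "y \<in> D (star s)" using U by auto
    then have "x = y" using xy(3) inj_theta[of s] by (auto simp: rmap_germ dest: inj_onD)
    then show "germ D s x = germ D s y" by simp
  qed
qed

lemma compactin_germs:
  assumes K: "compactin X K" "K \<subseteq> D (star s)"
  shows "compactin (arrows \<G>) (germ D s ` K)"
proof (rule image_compactin)
  show "compactin (subtopology X (D (star s))) K" using K by (simp add: compactin_subtopology)
  have top: "topspace (subtopology X (D (star s))) = D (star s)"
    using open_D[of "star s"] openin_subset by auto
  show "continuous_map (subtopology X (D (star s))) (arrows \<G>) (germ D s)"
  proof (unfold continuous_map_def top, intro conjI allI impI)
    show "germ D s \<in> D (star s) \<rightarrow> topspace (arrows \<G>)" using germ_arrow by blast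
    show "openin (subtopology X (D (star s))) {x \<in> D (star s). germ D s x \<in> N}"
      if "openin (arrows \<G>) N" for N
      unfolding openin_subtopology
      by (rule exI[of _ "{x \<in> D (star s). germ D s x \<in> N}"]) (use openin_germ_vimage[OF that] in blast)
  qed
qed

lemma hausdorff_ample_groupoid_germs:
  assumes "Hausdorff_space X" "zero_dimensional X" "Hausdorff_space (arrows \<G>)"
  shows "hausdorff_ample_groupoid \<G>"
proof
  have units: "units \<G> = X" by (simp add: germ_groupoid_def)
  show "Hausdorff_space (units \<G>)" "Hausdorff_space (arrows \<G>)" using assms units by auto
  show "continuous_map (arrows \<G>) (units \<G>) (dmap \<G>)"
    unfolding continuous_map_def units
  proof (intro conjI allI impI)
    show "dmap \<G> \<in> topspace (arrows \<G>) \<rightarrow> topspace X"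
      using dmap_germ mem_topspace by (fastforce elim: germ_arrowE)
    fix U assume U: "openin X U"
    have "{x \<in> D (star s). germ D s x \<in> {\<gamma> \<in> topspace (arrows \<G>). dmap \<G> \<gamma> \<in> U}} = U \<inter> D (star s)" for s
      using germ_arrow dmap_germ by auto
    then show "openin (arrows \<G>) {\<gamma> \<in> topspace (arrows \<G>). dmap \<G> \<gamma> \<in> U}"
      using U open_D by (intro openin_arrowsI) auto
  qed
  show "continuous_map (arrows \<G>) (units \<G>) (rmap \<G>)"
    unfolding continuous_map_def units
  proof (intro conjI allI impI)
    show "rmap \<G> \<in> topspace (arrows \<G>) \<rightarrow> topspace X"
      using rmap_germ theta_mem mem_topspace by (fastforce elim: germ_arrowE)
    fix U assume U: "openin X U"
    have "{x \<in> D (star s). germ D s x \<in> {\<gamma> \<in> topspace (arrows \<G>). rmap \<G> \<gamma> \<in> U}}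
        = {x \<in> D (star s). \<theta> s x \<in> U}" for s
      using germ_arrow rmap_germ by auto
    then show "openin (arrows \<G>) {\<gamma> \<in> topspace (arrows \<G>). rmap \<G> \<gamma> \<in> U}"
      using openin_theta_vimage[OF U] by (intro openin_arrowsI) auto
  qed
  show "\<exists>U. compact_open (arrows \<G>) U \<and> bisection \<G> U \<and> \<gamma> \<in> U \<and> U \<subseteq> N"
    if N: "openin (arrows \<G>) N" "\<gamma> \<in> N" for N \<gamma>
  proof -
    obtain s x where x: "x \<in> D (star s)" "\<gamma> = germ D s x"
      using N openin_subset by (blast elim: germ_arrowE)
    have "openin X {x \<in> D (star s). germ D s x \<in> N}" using N(1) by (rule openin_germ_vimage)
    moreover have "x \<in> {x \<in> D (star s). germ D s x \<in> N}" using x N(2) by simp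
    ultimately obtain K where K: "compact_open X K" "x \<in> K" "K \<subseteq> {x \<in> D (star s). germ D s x \<in> N}"
      using assms(2)[unfolded zero_dimensional_def openin_topology_base_unique] by blast
    have KD: "K \<subseteq> D (star s)" using K(3) by blast
    \<comment> \<open>Compactness and openness are transported from \<open>K\<close>; the Hausdorff
      part is inherited from the space of arrows.\<close>
    have "compact_open (arrows \<G>) (germ D s ` K)"
      using K(1) KD compactin_germs openin_germs Hausdorff_space_subtopology[OF assms(3)]
      by (simp add: compact_open_def)
    then show ?thesis
      using K x bisection_germs[OF KD] by (intro exI[of _ "germ D s ` K"]) auto
  qed
  show "gmult \<G> \<beta> \<gamma> \<in> topspace (arrows \<G>)" "dmap \<G> (gmult \<G> \<beta> \<gamma>) = dmap \<G> \<gamma>"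
    "rmap \<G> (gmult \<G> \<beta> \<gamma>) = rmap \<G> \<beta>"
    if \<beta>: "\<beta> \<in> topspace (arrows \<G>)" and \<gamma>: "\<gamma> \<in> topspace (arrows \<G>)"
      and comp: "dmap \<G> \<beta> = rmap \<G> \<gamma>" for \<beta> \<gamma>
  proof -
    obtain s y where y: "y \<in> D (star s)" "\<beta> = germ D s y" using \<beta> by (rule germ_arrowE)
    obtain t x where x: "x \<in> D (star t)" "\<gamma> = germ D t x" using \<gamma> by (rule germ_arrowE)
    have yx: "y = \<theta> t x" using comp x y dmap_germ rmap_germ by simp
    have st: "x \<in> D (star (s * t))" using x y yx dom_mult by auto
    have eq: "gmult \<G> \<beta> \<gamma> = germ D (s * t) x"
      using gmult_germ[of x t s] x y yx by simp
    show "gmult \<G> \<beta> \<gamma> \<in> topspace (arrows \<G>)" unfolding eq using st by (rule germ_arrow)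
    show "dmap \<G> (gmult \<G> \<beta> \<gamma>) = dmap \<G> \<gamma>" unfolding eq using dmap_germ[OF st] dmap_germ x by simp
    show "rmap \<G> (gmult \<G> \<beta> \<gamma>) = rmap \<G> \<beta>"
      unfolding eq using rmap_germ[OF st] rmap_germ[OF y(1)] y(2) map_mult[OF st] yx by simp
  qed
  show "ginv \<G> \<gamma> \<in> topspace (arrows \<G>)" "dmap \<G> (ginv \<G> \<gamma>) = rmap \<G> \<gamma>" "rmap \<G> (ginv \<G> \<gamma>) = dmap \<G> \<gamma>"
    if \<gamma>: "\<gamma> \<in> topspace (arrows \<G>)" for \<gamma>
  proof -
    obtain s x where x: "x \<in> D (star s)" "\<gamma> = germ D s x" using \<gamma> by (rule germ_arrowE)
    have eq: "ginv \<G> \<gamma> = germ D (star s) (\<theta> s x)" using ginv_germ x by simp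
    have sx: "\<theta> s x \<in> D (star (star s))" using theta_mem[OF x(1)] by (simp add: star_star)
    show "ginv \<G> \<gamma> \<in> topspace (arrows \<G>)" unfolding eq using sx by (rule germ_arrow)
    show "dmap \<G> (ginv \<G> \<gamma>) = rmap \<G> \<gamma>" unfolding eq using dmap_germ[OF sx] rmap_germ x by simp
    show "rmap \<G> (ginv \<G> \<gamma>) = dmap \<G> \<gamma>"
      unfolding eq using rmap_germ[OF sx] dmap_germ x theta_star_theta by simp
  qed
qed

section \<open>Consequences of topological freeness\<close>

text \<open>On the interior of the set where \<open>\<theta> s\<close> and \<open>\<theta> t\<close> agree, \<open>star s * t\<close> acts trivially, so it lies
  above an idempotent \<open>e\<close> with \<open>x \<in> D e\<close>; then \<open>s * e\<close> is below both \<open>s\<close> and \<open>t\<close>.\<close>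

lemma germ_eq_if_agree_near:
  assumes free: "topologically_free X D \<theta>"
    and U: "openin X U" "x \<in> U" "U \<subseteq> D (star s) \<inter> D (star t)"
    and eq: "\<And>y. y \<in> U \<Longrightarrow> \<theta> s y = \<theta> t y"
  shows "germ D s x = germ D t x"
proof -
  define w where "w = star s * t"
  have "U \<subseteq> {y \<in> D (star w). \<theta> w y = y}"
  proof
    fix y assume y: "y \<in> U"
    have ty: "\<theta> t y \<in> D (star (star s))"
      using theta_mem[of y s] U(3) y by (auto simp: star_star simp flip: eq)
    have yw: "y \<in> D (star w)" unfolding w_def dom_mult using ty U(3) y by auto
    have "\<theta> w y = \<theta> (star s) (\<theta> s y)"
      using map_mult[of y "star s" t] yw by (simp add: w_def eq[OF y])
    then show "y \<in> {y \<in> D (star w). \<theta> w y = y}"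
      using yw theta_star_theta[of y s] U(3) y by auto
  qed
  then have "U \<subseteq> X interior_of {y \<in> D (star w). \<theta> w y = y}"
    using U(1) by (rule interior_of_maximal)
  then have "x \<in> {y \<in> D (star w). \<exists>e. idem e \<and> e \<preceq> w \<and> y \<in> D e}"
    using free U(2) by (auto simp: topologically_free_def)
  then obtain e where e: "idem e" "e \<preceq> w" "x \<in> D e" by blast
  obtain f where f: "idem f" "e = w * f" using e(2) by (auto simp: nat_le_def)
  \<comment> \<open>Moving the idempotent \<open>s * star s\<close> past \<open>t\<close> to the
    right exhibits \<open>s * e\<close> as \<open>t\<close> times an idempotent.\<close>
  have "s * e = (s * star s) * t * f" by (simp add: f w_def mult.assoc)
  also have "\<dots> = t * (star t * (s * star s) * t) * f"
    by (rule arg_cong[OF idem_mult_swap(2)[OF idem_star_mult(2)], of "\<lambda>w. w * f"])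
  also have "\<dots> = t * (star t * (s * star s) * t * f)" by (simp add: mult.assoc)
  finally have "s * e \<preceq> t"
    unfolding nat_le_def
    using idem_mult[OF idem_mult_swap(1)[OF idem_star_mult(2)[of s], of t] f(1)] by blast
  moreover have "s * e \<preceq> s" unfolding nat_le_def using e(1) by blast
  moreover have "x \<in> D (star (s * e))"
    unfolding dom_mult using e(1,3) theta_idem[OF e(1,3)] U(2,3) by (auto simp: star_idem)
  ultimately show ?thesis by (intro germ_eqI)
qed

text \<open>Arrows of a bisection with the same source and range as, but different from, a given germ can
  only sit over a nowhere dense set of points.\<close>

lemma avoid_bisection:
  assumes X: "Hausdorff_space X" and free: "topologically_free X D \<theta>"
    and V: "openin X V" "V \<noteq> {}" "V \<subseteq> D (star s)"
    and U: "openin (arrows \<G>) U" "bisection \<G> U"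
  obtains V' where "openin X V'" "V' \<noteq> {}" "V' \<subseteq> V"
    "\<And>y \<gamma>. \<lbrakk>y \<in> V'; \<gamma> \<in> U; dmap \<G> \<gamma> = y; rmap \<G> \<gamma> = \<theta> s y\<rbrakk> \<Longrightarrow> \<gamma> = germ D s y"
proof (cases "\<exists>y\<in>V. \<exists>\<gamma>\<in>U. dmap \<G> \<gamma> = y \<and> rmap \<G> \<gamma> = \<theta> s y \<and> \<gamma> \<noteq> germ D s y")
  case False
  then show ?thesis using V by (intro that[of V]) auto
next
  case True
  then obtain y \<gamma> where y: "y \<in> V" "\<gamma> \<in> U" "dmap \<G> \<gamma> = y" "rmap \<G> \<gamma> = \<theta> s y" "\<gamma> \<noteq> germ D s y"
    by blast
  have "\<gamma> \<in> topspace (arrows \<G>)" using y(2) openin_subset[OF U(1)] by blast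
  then obtain t where t: "y \<in> D (star t)" "\<gamma> = germ D t y"
    using y(3) dmap_germ germ_arrowE by metis
  \<comment> \<open>Over \<open>W\<close> the arrows of the bisection \<open>U\<close> are exactly
    the germs of \<open>t\<close>, since the source map is injective on \<open>U\<close>.\<close>
  define W where "W = V \<inter> {x \<in> D (star t). germ D t x \<in> U}"
  have W: "openin X W" "y \<in> W" "W \<subseteq> D (star s) \<inter> D (star t)"
    using V y t openin_germ_vimage[OF U(1)] by (auto simp: W_def)
  have inW: "germ D t x \<in> U" if "x \<in> W" for x using that by (simp add: W_def)
  \<comment> \<open>Open because maps into a Hausdorff space agree on a closed set; nonempty because
    agreement on all of \<open>W\<close> would give \<open>s\<close> and \<open>t\<close> the same
    germ at \<open>y\<close>, contrary to the choice of \<gamma>.\<close>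
  define V' where "V' = {x \<in> W. \<theta> s x \<noteq> \<theta> t x}"
  have top: "topspace (subtopology X W) = W" using W(1) openin_subset by auto
  have cs: "continuous_map (subtopology X W) X (\<theta> s)" "continuous_map (subtopology X W) X (\<theta> t)"
    using continuous_map_theta W(3) by (blast intro: continuous_map_from_subtopology_mono)+
  have "closedin (subtopology X W) {x \<in> topspace (subtopology X W). \<theta> s x = \<theta> t x}"
    using closedin_continuous_maps_eq[OF X cs] .
  then have "openin (subtopology X W) (W - {x \<in> W. \<theta> s x = \<theta> t x})"
    unfolding top by (metis openin_diff openin_topspace top)
  moreover have "W - {x \<in> W. \<theta> s x = \<theta> t x} = V'" by (auto simp: V'_def)
  ultimately have oV': "openin X V'" using W(1) openin_trans_full by metis
  have "V' \<noteq> {}"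
  proof
    assume "V' = {}"
    then have "\<theta> s x = \<theta> t x" if "x \<in> W" for x using that by (auto simp: V'_def)
    from germ_eq_if_agree_near[OF free W this] show False using y(5) t(2) by simp
  qed
  moreover have "\<beta> = germ D s x" if x: "x \<in> V'" "\<beta> \<in> U" "dmap \<G> \<beta> = x" "rmap \<G> \<beta> = \<theta> s x" for x \<beta>
  proof -
    have xW: "x \<in> W" "x \<in> D (star t)" using x(1) W(3) by (auto simp: V'_def)
    \<comment> \<open>This makes the range of \<beta> equal to \<open>\<theta> t x\<close>, which
      differs from \<open>\<theta> s x\<close> on \<open>V'\<close>. So no arrow of \<open>U\<close>
      is parallel to the germ of \<open>s\<close> at \<open>x\<close>, and the claim holds
      vacuously.\<close>
    have "\<beta> = germ D t x"
      using U(2) x(2,3) inW[OF xW(1)] dmap_germ[OF xW(2)] by (auto simp: bisection_def dest: inj_onD)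
    then show ?thesis using x(1,4) rmap_germ[OF xW(2)] by (simp add: V'_def)
  qed
  moreover have "V' \<subseteq> V" by (auto simp: V'_def W_def)
  ultimately show ?thesis using oV' by (intro that)
qed

text \<open>One shrinking per bisection, each leaving a nonempty open set; this replaces the fact
  that a finite union of nowhere dense sets is nowhere dense.\<close>

lemma avoid_bisections:
  assumes X: "Hausdorff_space X" and free: "topologically_free X D \<theta>"
    and \<U>: "finite \<U>" "\<And>U. U \<in> \<U> \<Longrightarrow> openin (arrows \<G>) U \<and> bisection \<G> U"
    and V: "openin X V" "V \<noteq> {}" "V \<subseteq> D (star s)"
  shows "\<exists>V'. openin X V' \<and> V' \<noteq> {} \<and> V' \<subseteq> V
    \<and> (\<forall>y\<in>V'. \<forall>\<gamma>\<in>\<Union>\<U>. dmap \<G> \<gamma> = y \<and> rmap \<G> \<gamma> = \<theta> s y \<longrightarrow> \<gamma> = germ D s y)"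
  using \<U>
proof (induction rule: finite_induct)
  case empty
  show ?case using V by (intro exI[of _ V]) simp
next
  case (insert U \<U>)
  have "\<exists>V'. openin X V' \<and> V' \<noteq> {} \<and> V' \<subseteq> V
    \<and> (\<forall>y\<in>V'. \<forall>\<gamma>\<in>\<Union>\<U>. dmap \<G> \<gamma> = y \<and> rmap \<G> \<gamma> = \<theta> s y \<longrightarrow> \<gamma> = germ D s y)"
    by (rule insert.IH) (rule insert.prems, rule insertI2)
  then obtain V' where V': "openin X V'" "V' \<noteq> {}" "V' \<subseteq> V"
    "\<forall>y\<in>V'. \<forall>\<gamma>\<in>\<Union>\<U>. dmap \<G> \<gamma> = y \<and> rmap \<G> \<gamma> = \<theta> s y \<longrightarrow> \<gamma> = germ D s y"
    by (elim exE conjE)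
  have U: "openin (arrows \<G>) U" "bisection \<G> U"
    using insert.prems[OF insertI1] by (rule conjunct1, rule conjunct2)
  have "V' \<subseteq> D (star s)" using V'(3) V(3) by (rule subset_trans)
  then obtain V'' where V'': "openin X V''" "V'' \<noteq> {}" "V'' \<subseteq> V'"
    "\<And>y \<gamma>. \<lbrakk>y \<in> V''; \<gamma> \<in> U; dmap \<G> \<gamma> = y; rmap \<G> \<gamma> = \<theta> s y\<rbrakk> \<Longrightarrow> \<gamma> = germ D s y"
    using avoid_bisection[OF X free V'(1,2) _ U] by metis
  have "\<gamma> = germ D s y"
    if "y \<in> V''" "\<gamma> \<in> \<Union>(insert U \<U>)" "dmap \<G> \<gamma> = y" "rmap \<G> \<gamma> = \<theta> s y" for y \<gamma>
  proof (cases "\<gamma> \<in> U")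
    case True
    then show ?thesis using V''(4) that by simp
  next
    case False
    then have "y \<in> V'" "\<gamma> \<in> \<Union>\<U>" using that(1,2) V''(3) by auto
    from V'(4)[rule_format, OF this conjI[OF that(3,4)]] show ?thesis .
  qed
  then show ?case using V''(1,2,3) V'(3) by (intro exI[of _ V'']) simp
qed

end

theorem proposition5p11:
  fixes X :: "'x topology"
    and D :: "'s::inverse_semigroup \<Rightarrow> 'x set"
    and \<theta> :: "'s \<Rightarrow> 'x \<Rightarrow> 'x"
    and E :: "'e topology"
    and p :: "'e \<Rightarrow> 'x"
    and \<alpha> :: "('s \<times> 'x) set \<Rightarrow> 'e \<Rightarrow> 'e"
    and \<O> :: "'x \<Rightarrow> 'e ring"
  assumes "locally_compact_space X" and "Hausdorff_space X" and "zero_dimensional X"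
    and "inverse_semigroup_action X D \<theta>"
    and "topologically_free X D \<theta>"
    and "sheaf_of_fields (germ_groupoid X D \<theta>) E p \<alpha> \<O>"
    and "Hausdorff_space (arrows (germ_groupoid X D \<theta>))"
  shows "semiprimitive (Gamma_c (germ_groupoid X D \<theta>) E \<alpha> \<O>)"
proof -
  let ?G = "germ_groupoid X D \<theta>"
  let ?R = "Gamma_c ?G E \<alpha> \<O>"
  interpret inverse_semigroup_action X D \<theta> by fact
  interpret sheaf_of_fields ?G E p \<alpha> \<O> by fact
  interpret hausdorff_ample_groupoid ?G
    using assms(2,3,7) by (rule hausdorff_ample_groupoid_germs)
  interpret ample_sheaf_of_fields ?G E p \<alpha> \<O> ..
  have "f = \<zero>\<^bsub>?R\<^esub>" if f: "f \<in> jacobson_radical ?R" for f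
  proof (rule ccontr)
    assume ne: "f \<noteq> \<zero>\<^bsub>?R\<^esub>"
    have fc: "f \<in> carrier ?R" using f by (simp add: jacobson_radical_def)
    note fD = Gamma_c_memD[OF fc]
    obtain \<gamma> where \<gamma>: "\<gamma> \<in> topspace (arrows ?G)" "f \<gamma> \<noteq> \<zero>\<^bsub>\<O> (rmap ?G \<gamma>)\<^esub>"
    proof -
      have "\<exists>\<gamma>\<in>topspace (arrows ?G). f \<gamma> \<noteq> \<zero>\<^bsub>\<O> (rmap ?G \<gamma>)\<^esub>"
      proof (rule ccontr)
        assume "\<not> (\<exists>\<gamma>\<in>topspace (arrows ?G). f \<gamma> \<noteq> \<zero>\<^bsub>\<O> (rmap ?G \<gamma>)\<^esub>)"
        then have "f = \<zero>\<^bsub>?R\<^esub>"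
          unfolding Gamma_c_simps(2) using fD
          by (intro extensionalityI[of f "topspace (arrows ?G)"] restrict_extensional) simp_all
        then show False using ne by contradiction
      qed
      then show ?thesis using that by blast
    qed
    have cont: "continuous_map (arrows ?G) E f" using fD by blast
    have pf: "p (f \<beta>) = rmap ?G \<beta>" if "\<beta> \<in> topspace (arrows ?G)" for \<beta>
      using stalk_memD[OF rmap_closed[OF that] Gamma_c_value[OF fc that]] by simp
    obtain N where N: "openin (arrows ?G) N" "\<gamma> \<in> N"
        "\<And>\<beta>. \<beta> \<in> N \<Longrightarrow> f \<beta> \<noteq> \<zero>\<^bsub>\<O> (rmap ?G \<beta>)\<^esub>"
      using nonzero_near[OF cont pf \<gamma>] by blast
    obtain s x where x: "x \<in> D (star s)" "\<gamma> = germ D s x"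
      using germ_arrowE[OF \<gamma>(1)] .
    define V where "V = {y \<in> D (star s). germ D s y \<in> N}"
    have V: "openin X V" "V \<noteq> {}" "V \<subseteq> D (star s)"
      using openin_germ_vimage[OF N(1)] N(2) x by (auto simp: V_def)
    obtain \<U> where \<U>: "finite \<U>" "\<forall>U\<in>\<U>. openin (arrows ?G) U \<and> bisection ?G U"
        "\<forall>\<beta>\<in>topspace (arrows ?G). f \<beta> \<noteq> \<zero>\<^bsub>\<O> (rmap ?G \<beta>)\<^esub> \<longrightarrow> \<beta> \<in> \<Union>\<U>"
      using fD by blast
    \<comment> \<open>The cover of the support also contains the germs of \<open>s\<close> over
      \<open>V\<close>, where \<open>f\<close> is nonzero, so parallel arrows cannot be excluded
      altogether, only identified with these germs.\<close>
    have "\<exists>V'. openin X V' \<and> V' \<noteq> {} \<and> V' \<subseteq> V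
        \<and> (\<forall>y\<in>V'. \<forall>\<beta>\<in>\<Union>\<U>. dmap ?G \<beta> = y \<and> rmap ?G \<beta> = \<theta> s y \<longrightarrow> \<beta> = germ D s y)"
      by (rule avoid_bisections[OF assms(2,5) \<U>(1) _ V]) (rule bspec[OF \<U>(2)])
    then obtain V' where V': "V' \<noteq> {}" "V' \<subseteq> V"
        "\<forall>y\<in>V'. \<forall>\<beta>\<in>\<Union>\<U>. dmap ?G \<beta> = y \<and> rmap ?G \<beta> = \<theta> s y \<longrightarrow> \<beta> = germ D s y"
      by (elim exE conjE)
    obtain y where y: "y \<in> V'" using V'(1) by blast
    have yV: "y \<in> V" using V'(2) y by (rule subsetD)
    then have yD: "y \<in> D (star s)" and yN: "germ D s y \<in> N" by (simp_all add: V_def)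
    \<comment> \<open>Membership in the radical forces zero at the new arrow, while
      \<open>germ D s y\<close> still lies in \<open>N\<close>, where \<open>f\<close> does not
      vanish.\<close>
    have "f (germ D s y) = \<zero>\<^bsub>\<O> (rmap ?G (germ D s y))\<^esub>"
    proof (rule jacobson_radical_vanishes[OF f germ_arrow[OF yD]])
      fix \<beta>
      assume \<beta>: "\<beta> \<in> topspace (arrows ?G)" "dmap ?G \<beta> = dmap ?G (germ D s y)"
        "rmap ?G \<beta> = rmap ?G (germ D s y)" "f \<beta> \<noteq> \<zero>\<^bsub>\<O> (rmap ?G (germ D s y))\<^esub>"
      have "\<beta> \<in> \<Union>\<U>" using \<U>(3) \<beta>(1,3,4) by simp
      moreover have "dmap ?G \<beta> = y \<and> rmap ?G \<beta> = \<theta> s y"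
        using \<beta>(2,3) dmap_germ[OF yD] rmap_germ[OF yD] by simp
      ultimately show "\<beta> = germ D s y" using V'(3)[rule_format, OF y] by simp
    qed
    then show False using N(3)[OF yN] by contradiction
  qed
  then show ?thesis
    unfolding semiprimitive_def using zero_mem_jacobson_radical by blast
qed

end
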